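(* Fix a standard $n\ge1$. Let $\Gamma$ be a sentence of the form $\forall X\,\exists Y\,\theta(X,Y)$ where $\theta$ is a $\Pi^0_{n+1}$-formula. Suppose the following condition holds: for every countable recursively saturated model $(M,S)\models\mathrm{B}\Sigma^0_{n+1}$ and every $X\in S$, there exists $Y\subseteq M$ such that $(M,S\cup\{Y\})\models\mathrm{I}\Sigma^0_n+\theta(X,Y)$. Then $\mathsf{RCA}_0+\mathrm{B}\Sigma^0_{n+1}+\Gamma$ is a $\tilde\Pi^0_{n+2}$-conservative extension of $\mathrm{I}\Sigma^0_n$, i.e. every $\tilde\Pi^0_{n+2}$-sentence provable in the former theory is provable in $\mathrm{I}\Sigma^0_n$.
   Context: $\mathcal L_2$ is the language of second-order arithmetic and $\mathcal L_{\rm PA}$ the language of first-order arithmetic. An $\mathcal L_2$-structure is a pair $(M,S)$ with $M$ an $\mathcal L_{\rm PA}$-structure and $S\subseteq\mathcal P(M)$; it is countable if both $M$ and $S$ are. $(M,S)$ is also regarded as a first-order structure on $M$ in the language $\mathcal L_{\rm PA}\cup S$, with a unary predicate for each member of $S$; "recursively saturated" refers to this structure: every recursive set of first-order formulas in one variable over $\mathcal L_{\rm PA}$ together with finitely many predicates from $S$ and finitely many parameters from $M$ that is finitely satisfiable in the structure is realized in it. $\mathrm{I}\Sigma^0_n$: axioms of discrete ordered semirings plus induction for $\Sigma^0_n$-formulas (number and set parameters allowed). $\mathrm{B}\Sigma^0_{n+1}$: axioms of discrete ordered semirings, $\Sigma^0_0$-induction, and the bounding scheme $\forall a\,[(\forall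 x<a)\exists y\,\varphi(x,y)\to\exists b(\forall x<a)(\exists y<b)\varphi(x,y)]$ for $\Sigma^0_{n+1}$-formulas $\varphi$ with parameters. $\mathsf{RCA}_0$: $\mathrm{I}\Sigma^0_1$ plus $\Delta^0_1$-comprehension. A $\tilde\Pi^0_{n+2}$-formula has the form $\forall X\,\varphi(X)$ with $\varphi$ in $\Pi^0_{n+2}$. *)

theory Defs
  imports Complex_Main "HOL-Library.Countable_Set" "HOL-Library.Nat_Bijection"
begin

section \<open>The language of second-order arithmetic\<close>

text \<open>
  Formulas are in de Bruijn style, with separate indices for number and set variables.
  \<open>Var i\<close> is the \<open>i\<close>-th number variable and the second argument of \<open>Mem\<close> is the index of a
  set variable; \<open>All\<close> binds number variable 0 and \<open>AllS\<close> binds set variable 0. As usual there is no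
  equality symbol for sets.
\<close>

datatype tm = Var nat | Zero | One | Add tm tm | Mul tm tm

datatype fm = Fls | Eq tm tm | Less tm tm | Mem tm nat | Imp fm fm | All fm | AllS fm

definition Neg :: "fm \<Rightarrow> fm" where "Neg p = Imp p Fls"
definition Conj :: "fm \<Rightarrow> fm \<Rightarrow> fm" where "Conj p q = Neg (Imp p (Neg q))"
definition Disj :: "fm \<Rightarrow> fm \<Rightarrow> fm" where "Disj p q = Imp (Neg p) q"
definition Iff :: "fm \<Rightarrow> fm \<Rightarrow> fm" where "Iff p q = Conj (Imp p q) (Imp q p)"
definition ExN :: "fm \<Rightarrow> fm" where "ExN p = Neg (All (Neg p))"
definition ExS :: "fm \<Rightarrow> fm" where "ExS p = Neg (AllS (Neg p))"

text \<open>Simultaneous substitution of terms for number variables and set variables for set variables.\<close>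

primrec tsubst :: "(nat \<Rightarrow> tm) \<Rightarrow> tm \<Rightarrow> tm" where
  "tsubst \<sigma> (Var i) = \<sigma> i"
| "tsubst \<sigma> Zero = Zero"
| "tsubst \<sigma> One = One"
| "tsubst \<sigma> (Add t u) = Add (tsubst \<sigma> t) (tsubst \<sigma> u)"
| "tsubst \<sigma> (Mul t u) = Mul (tsubst \<sigma> t) (tsubst \<sigma> u)"

definition tlift :: "tm \<Rightarrow> tm" where "tlift = tsubst (\<lambda>i. Var (Suc i))"

primrec subst :: "(nat \<Rightarrow> tm) \<Rightarrow> (nat \<Rightarrow> nat) \<Rightarrow> fm \<Rightarrow> fm" where
  "subst \<sigma> \<rho> Fls = Fls"
| "subst \<sigma> \<rho> (Eq t u) = Eq (tsubst \<sigma> t) (tsubst \<sigma> u)"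
| "subst \<sigma> \<rho> (Less t u) = Less (tsubst \<sigma> t) (tsubst \<sigma> u)"
| "subst \<sigma> \<rho> (Mem t X) = Mem (tsubst \<sigma> t) (\<rho> X)"
| "subst \<sigma> \<rho> (Imp p q) = Imp (subst \<sigma> \<rho> p) (subst \<sigma> \<rho> q)"
| "subst \<sigma> \<rho> (All p) = All (subst (case_nat (Var 0) (\<lambda>i. tlift (\<sigma> i))) \<rho> p)"
| "subst \<sigma> \<rho> (AllS p) = AllS (subst \<sigma> (case_nat 0 (\<lambda>i. Suc (\<rho> i))) p)"

definition lift :: "fm \<Rightarrow> fm" where "lift = subst (\<lambda>i. Var (Suc i)) id"
definition liftS :: "fm \<Rightarrow> fm" where "liftS = subst Var Suc"
definition inst :: "tm \<Rightarrow> fm \<Rightarrow> fm" where "inst t = subst (case_nat t Var) id"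
definition instS :: "nat \<Rightarrow> fm \<Rightarrow> fm" where "instS X = subst Var (case_nat X id)"

text \<open>
  \<open>fv_below k m p\<close>: the free number variables of \<open>p\<close> have index below \<open>k\<close>, the free set variables
  have index below \<open>m\<close>.
\<close>

primrec tfv_below :: "nat \<Rightarrow> tm \<Rightarrow> bool" where
  "tfv_below k (Var i) = (i < k)"
| "tfv_below k Zero = True"
| "tfv_below k One = True"
| "tfv_below k (Add t u) = (tfv_below k t \<and> tfv_below k u)"
| "tfv_below k (Mul t u) = (tfv_below k t \<and> tfv_below k u)"

primrec fv_below :: "nat \<Rightarrow> nat \<Rightarrow> fm \<Rightarrow> bool" where
  "fv_below k m Fls = True"
| "fv_below k m (Eq t u) = (tfv_below k t \<and> tfv_below k u)"
| "fv_below k m (Less t u) = (tfv_below k t \<and> tfv_below k u)"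
| "fv_below k m (Mem t X) = (tfv_below k t \<and> X < m)"
| "fv_below k m (Imp p q) = (fv_below k m p \<and> fv_below k m q)"
| "fv_below k m (All p) = fv_below (Suc k) m p"
| "fv_below k m (AllS p) = fv_below k (Suc m) p"

definition sentence :: "fm \<Rightarrow> bool" where "sentence p \<longleftrightarrow> fv_below 0 0 p"

primrec arithmetical :: "fm \<Rightarrow> bool" where
  "arithmetical Fls = True"
| "arithmetical (Eq t u) = True"
| "arithmetical (Less t u) = True"
| "arithmetical (Mem t X) = True"
| "arithmetical (Imp p q) = (arithmetical p \<and> arithmetical q)"
| "arithmetical (All p) = arithmetical p"
| "arithmetical (AllS p) = False"

section \<open>The arithmetical hierarchy\<close>

text \<open>The lifting ensures that the bound \<open>t\<close> does not contain the quantified variable.\<close>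

definition BAll :: "tm \<Rightarrow> fm \<Rightarrow> fm" where
  "BAll t p = All (Imp (Less (Var 0) (tlift t)) p)"
definition BEx :: "tm \<Rightarrow> fm \<Rightarrow> fm" where
  "BEx t p = Neg (BAll t (Neg p))"

inductive is_Delta0 :: "fm \<Rightarrow> bool" where
  "is_Delta0 Fls"
| "is_Delta0 (Eq t u)"
| "is_Delta0 (Less t u)"
| "is_Delta0 (Mem t X)"
| "is_Delta0 p \<Longrightarrow> is_Delta0 q \<Longrightarrow> is_Delta0 (Imp p q)"
| "is_Delta0 p \<Longrightarrow> is_Delta0 (BAll t p)"

text \<open>Blocks of like quantifiers, possibly empty, are allowed.\<close>

inductive is_Sigma :: "nat \<Rightarrow> fm \<Rightarrow> bool" and is_Pi :: "nat \<Rightarrow> fm \<Rightarrow> bool" where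
  "is_Delta0 p \<Longrightarrow> is_Sigma 0 p"
| "is_Delta0 p \<Longrightarrow> is_Pi 0 p"
| "is_Pi n p \<Longrightarrow> is_Sigma (Suc n) p"
| "is_Sigma (Suc n) p \<Longrightarrow> is_Sigma (Suc n) (ExN p)"
| "is_Sigma n p \<Longrightarrow> is_Pi (Suc n) p"
| "is_Pi (Suc n) p \<Longrightarrow> is_Pi (Suc n) (All p)"

text \<open>Sentences \<open>\<forall>X. \<phi>(X)\<close> with \<open>\<phi>\<close> in \<open>\<Pi>\<^sup>0\<^sub>n\<close>.\<close>

definition tilde_Pi_sentence :: "nat \<Rightarrow> fm \<Rightarrow> bool" where
  "tilde_Pi_sentence n \<psi> \<longleftrightarrow> sentence \<psi> \<and> (\<exists>\<phi>. is_Pi n \<phi> \<and> \<psi> = AllS \<phi>)"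

section \<open>Provability\<close>

text \<open>
  Classical two-sorted natural deduction with equality on the number sort. The set of hypotheses
  may be infinite; a theory is a set of sentences used as hypotheses.
\<close>

inductive prv :: "fm set \<Rightarrow> fm \<Rightarrow> bool" (infix "\<turnstile>" 50) where
  Assm: "p \<in> \<Gamma> \<Longrightarrow> \<Gamma> \<turnstile> p"
| ImpI: "insert p \<Gamma> \<turnstile> q \<Longrightarrow> \<Gamma> \<turnstile> Imp p q"
| ImpE: "\<Gamma> \<turnstile> Imp p q \<Longrightarrow> \<Gamma> \<turnstile> p \<Longrightarrow> \<Gamma> \<turnstile> q"
| Contr: "insert (Neg p) \<Gamma> \<turnstile> Fls \<Longrightarrow> \<Gamma> \<turnstile> p"
| AllI: "lift ` \<Gamma> \<turnstile> p \<Longrightarrow> \<Gamma> \<turnstile> All p"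
| AllE: "\<Gamma> \<turnstile> All p \<Longrightarrow> \<Gamma> \<turnstile> inst t p"
| AllSI: "liftS ` \<Gamma> \<turnstile> p \<Longrightarrow> \<Gamma> \<turnstile> AllS p"
| AllSE: "\<Gamma> \<turnstile> AllS p \<Longrightarrow> \<Gamma> \<turnstile> instS X p"
| Refl: "\<Gamma> \<turnstile> Eq t t"
| Leibniz: "\<Gamma> \<turnstile> Eq t u \<Longrightarrow> \<Gamma> \<turnstile> inst t p \<Longrightarrow> \<Gamma> \<turnstile> inst u p"

definition conservative_over :: "(fm \<Rightarrow> bool) \<Rightarrow> fm set \<Rightarrow> fm set \<Rightarrow> bool" where
  "conservative_over C T U \<longleftrightarrow> (\<forall>\<psi>. C \<psi> \<longrightarrow> T \<turnstile> \<psi> \<longrightarrow> U \<turnstile> \<psi>)"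

section \<open>Axiom systems\<close>

text \<open>
  Axioms are stated as open formulas whose free variables are the parameters; \<open>closures p\<close> consists
  of the sentences obtained from \<open>p\<close> by prefixing universal number and set quantifiers.
\<close>

definition closures :: "fm \<Rightarrow> fm set" where
  "closures p = {q. sentence q \<and> (\<exists>k m. q = (AllS ^^ m) ((All ^^ k) p))}"

definition PA_minus :: "fm set" where
  "PA_minus =
    (let x = Var 0; y = Var 1; z = Var 2 in
     \<Union> (closures `
      {Eq (Add (Add x y) z) (Add x (Add y z)),
       Eq (Add x y) (Add y x),
       Eq (Mul (Mul x y) z) (Mul x (Mul y z)),
       Eq (Mul x y) (Mul y x),
       Eq (Mul x (Add y z)) (Add (Mul x y) (Mul x z)),
       Eq (Add x Zero) x,
       Eq (Mul x Zero) Zero,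
       Eq (Mul x One) x,
       Neg (Less x x),
       Imp (Less x y) (Imp (Less y z) (Less x z)),
       Disj (Less x y) (Disj (Eq x y) (Less y x)),
       Imp (Less x y) (Less (Add x z) (Add y z)),
       Imp (Less Zero z) (Imp (Less x y) (Less (Mul x z) (Mul y z))),
       Imp (Less x y) (ExN (Eq (Add (tlift x) (Var 0)) (tlift y))),
       Less Zero One,
       Imp (Less Zero x) (Disj (Less One x) (Eq One x)),
       Disj (Less Zero x) (Eq Zero x)}))"

text \<open>\<open>\<phi>(0) \<and> \<forall>x (\<phi>(x) \<rightarrow> \<phi>(x+1)) \<rightarrow> \<forall>x \<phi>(x)\<close>, where \<open>x\<close> is number variable 0 of \<open>\<phi>\<close>.\<close>

definition induction_ax :: "fm \<Rightarrow> fm" where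
  "induction_ax \<phi> =
     Imp (Conj (inst Zero \<phi>)
               (All (Imp \<phi> (subst (case_nat (Add (Var 0) One) (\<lambda>i. Var (Suc i))) id \<phi>))))
         (All \<phi>)"

text \<open>
  \<open>\<forall>a ((\<forall>x<a) \<exists>y \<phi>(x,y) \<rightarrow> \<exists>b (\<forall>x<a) (\<exists>y<b) \<phi>(x,y))\<close>, where \<open>y\<close> and \<open>x\<close> are number variables 0 and 1
  of \<open>\<phi>\<close>. The two substitutions make room for \<open>a\<close>, respectively for \<open>b\<close> and \<open>a\<close>, between them and
  the parameters.
\<close>

definition bounding_ax :: "fm \<Rightarrow> fm" where
  "bounding_ax \<phi> =
     All (Imp (BAll (Var 0) (ExN (subst (\<lambda>i. Var (if i < 2 then i else i + 1)) id \<phi>)))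
              (ExN (BAll (Var 1) (BEx (Var 1) (subst (\<lambda>i. Var (if i < 2 then i else i + 2)) id \<phi>)))))"

text \<open>\<open>\<forall>x (\<phi>(x) \<leftrightarrow> \<psi>(x)) \<rightarrow> \<exists>X \<forall>x (x \<in> X \<leftrightarrow> \<phi>(x))\<close>, where \<open>X\<close> is not free in \<open>\<phi>\<close>.\<close>

definition comprehension_ax :: "fm \<Rightarrow> fm \<Rightarrow> fm" where
  "comprehension_ax \<phi> \<psi> =
     Imp (All (Iff \<phi> \<psi>)) (ExS (All (Iff (Mem (Var 0) 0) (liftS \<phi>))))"

definition ISigma :: "nat \<Rightarrow> fm set" where
  "ISigma n = PA_minus \<union> \<Union> {closures (induction_ax \<phi>) |\<phi>. is_Sigma n \<phi>}"

definition BSigma :: "nat \<Rightarrow> fm set" where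
  "BSigma n = ISigma 0 \<union> \<Union> {closures (bounding_ax \<phi>) |\<phi>. is_Sigma n \<phi>}"

definition RCA0 :: "fm set" where
  "RCA0 = ISigma 1 \<union> \<Union> {closures (comprehension_ax \<phi> \<psi>) |\<phi> \<psi>. is_Sigma 1 \<phi> \<and> is_Pi 1 \<psi>}"

section \<open>Structures and satisfaction\<close>

record 'a L2_struct =
  num_dom :: "'a set"
  zeroM :: 'a
  oneM :: 'a
  addM :: "'a \<Rightarrow> 'a \<Rightarrow> 'a"
  mulM :: "'a \<Rightarrow> 'a \<Rightarrow> 'a"
  lessM :: "'a \<Rightarrow> 'a \<Rightarrow> bool"
  set_dom :: "'a set set"

definition L2_structure :: "'a L2_struct \<Rightarrow> bool" where
  "L2_structure M \<longleftrightarrow>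
     zeroM M \<in> num_dom M \<and> oneM M \<in> num_dom M \<and>
     (\<forall>a\<in>num_dom M. \<forall>b\<in>num_dom M. addM M a b \<in> num_dom M \<and> mulM M a b \<in> num_dom M) \<and>
     set_dom M \<subseteq> Pow (num_dom M)"

definition countable_structure :: "'a L2_struct \<Rightarrow> bool" where
  "countable_structure M \<longleftrightarrow> countable (num_dom M) \<and> countable (set_dom M)"

definition add_set :: "'a set \<Rightarrow> 'a L2_struct \<Rightarrow> 'a L2_struct" where
  "add_set Y M = M\<lparr>set_dom := insert Y (set_dom M)\<rparr>"

primrec tval :: "'a L2_struct \<Rightarrow> (nat \<Rightarrow> 'a) \<Rightarrow> tm \<Rightarrow> 'a" where
  "tval M e (Var i) = e i"
| "tval M e Zero = zeroM M"
| "tval M e One = oneM M"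
| "tval M e (Add t u) = addM M (tval M e t) (tval M e u)"
| "tval M e (Mul t u) = mulM M (tval M e t) (tval M e u)"

primrec sat :: "'a L2_struct \<Rightarrow> (nat \<Rightarrow> 'a) \<Rightarrow> (nat \<Rightarrow> 'a set) \<Rightarrow> fm \<Rightarrow> bool" where
  "sat M e s Fls = False"
| "sat M e s (Eq t u) = (tval M e t = tval M e u)"
| "sat M e s (Less t u) = lessM M (tval M e t) (tval M e u)"
| "sat M e s (Mem t X) = (tval M e t \<in> s X)"
| "sat M e s (Imp p q) = (sat M e s p \<longrightarrow> sat M e s q)"
| "sat M e s (All p) = (\<forall>a\<in>num_dom M. sat M (case_nat a e) s p)"
| "sat M e s (AllS p) = (\<forall>A\<in>set_dom M. sat M e (case_nat A s) p)"

text \<open>For sets of sentences only, whose truth value does not depend on the assignments.\<close>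

definition models :: "'a L2_struct \<Rightarrow> fm set \<Rightarrow> bool" where
  "models M T \<longleftrightarrow> (\<forall>p\<in>T. \<forall>e s. sat M e s p)"

text \<open>
  \<open>\<theta>(X,Y)\<close> holds in \<open>M\<close>, for a formula \<open>\<theta>\<close> whose only free variables are set variables 1 (for \<open>X\<close>)
  and 0 (for \<open>Y\<close>); this is the indexing of the matrix of \<open>\<forall>X \<exists>Y \<theta>\<close>.
\<close>

definition holds_at :: "'a L2_struct \<Rightarrow> fm \<Rightarrow> 'a set \<Rightarrow> 'a set \<Rightarrow> bool" where
  "holds_at M \<theta> X Y \<longleftrightarrow> (\<forall>e s. sat M e (case_nat Y (case_nat X s)) \<theta>)"

section \<open>Recursive sets and recursive saturation\<close>

text \<open>
  \<open>recursive_fun k f\<close>: the function given by the values of \<open>f\<close> at lists of length \<open>k\<close> is total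
  recursive, the minimisation operator being restricted to regular functions.
\<close>

inductive recursive_fun :: "nat \<Rightarrow> (nat list \<Rightarrow> nat) \<Rightarrow> bool" where
  zero: "recursive_fun k (\<lambda>xs. 0)"
| succ: "recursive_fun 1 (\<lambda>xs. Suc (hd xs))"
| proj: "i < k \<Longrightarrow> recursive_fun k (\<lambda>xs. xs ! i)"
| comp: "recursive_fun (length gs) f \<Longrightarrow> (\<forall>g\<in>set gs. recursive_fun k g) \<Longrightarrow>
         recursive_fun k (\<lambda>xs. f (map (\<lambda>g. g xs) gs))"
| prec: "recursive_fun k f \<Longrightarrow> recursive_fun (Suc (Suc k)) g \<Longrightarrow>
         recursive_fun (Suc k)
           (\<lambda>xs. rec_nat (f (tl xs)) (\<lambda>i r. g (i # r # tl xs)) (hd xs))"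
| mini: "recursive_fun (Suc k) f \<Longrightarrow> (\<forall>xs. length xs = k \<longrightarrow> (\<exists>i. f (i # xs) = 0)) \<Longrightarrow>
         recursive_fun k (\<lambda>xs. LEAST i. f (i # xs) = 0)"

definition recursive_set :: "nat set \<Rightarrow> bool" where
  "recursive_set A \<longleftrightarrow> (\<exists>f. recursive_fun 1 f \<and> (\<forall>x. f [x] = (if x \<in> A then 1 else 0)))"

text \<open>Goedel numbers.\<close>

primrec tcode :: "tm \<Rightarrow> nat" where
  "tcode (Var i) = prod_encode (0, i)"
| "tcode Zero = prod_encode (1, 0)"
| "tcode One = prod_encode (2, 0)"
| "tcode (Add t u) = prod_encode (3, prod_encode (tcode t, tcode u))"
| "tcode (Mul t u) = prod_encode (4, prod_encode (tcode t, tcode u))"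

primrec code :: "fm \<Rightarrow> nat" where
  "code Fls = prod_encode (0, 0)"
| "code (Eq t u) = prod_encode (1, prod_encode (tcode t, tcode u))"
| "code (Less t u) = prod_encode (2, prod_encode (tcode t, tcode u))"
| "code (Mem t X) = prod_encode (3, prod_encode (tcode t, X))"
| "code (Imp p q) = prod_encode (4, prod_encode (code p, code q))"
| "code (All p) = prod_encode (5, code p)"
| "code (AllS p) = prod_encode (6, code p)"

text \<open>
  Arithmetical formulas with free set variables below \<open>m\<close> serve as first-order formulas over
  \<open>\<L>\<^sub>P\<^sub>A\<close> with \<open>m\<close> unary predicates, interpreted by the members \<open>s 0, \<dots>, s (m - 1)\<close> of
  \<open>S\<close>. Number variable 0 is the variable of the type, number variables \<open>1, \<dots>, k\<close> stand for the
  parameters \<open>e 0, \<dots>, e (k - 1)\<close>.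
\<close>

definition recursively_saturated :: "'a L2_struct \<Rightarrow> bool" where
  "recursively_saturated M \<longleftrightarrow>
     (\<forall>k m p e s.
        (\<forall>\<phi>\<in>p. arithmetical \<phi> \<and> fv_below (Suc k) m \<phi>) \<longrightarrow>
        recursive_set (code ` p) \<longrightarrow>
        (\<forall>i<k. e i \<in> num_dom M) \<longrightarrow>
        (\<forall>i<m. s i \<in> set_dom M) \<longrightarrow>
        (\<forall>F. finite F \<and> F \<subseteq> p \<longrightarrow> (\<exists>a\<in>num_dom M. \<forall>\<phi>\<in>F. sat M (case_nat a e) s \<phi>)) \<longrightarrow>
        (\<exists>a\<in>num_dom M. \<forall>\<phi>\<in>p. sat M (case_nat a e) s \<phi>))"

end

theory Submission
  imports Defs
begin

text \<open>
  Suppose a sentence \<open>\<forall>X. \<phi>(X)\<close> with \<open>\<phi>\<close> in \<open>\<Pi>\<^sup>0\<close> of level \<open>n + 2\<close> fails in a countable model of \<open>I\<Sigma>\<^sub>n\<close>. Every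
  countable model \<open>M\<close> of \<open>I\<Sigma>\<^sub>n\<close> has a \<open>\<Sigma>\<close>-elementary extension of level \<open>n + 1\<close> to a model of the bounding
  scheme: take an elementary extension with an element above \<open>M\<close> and cut it down to the initial segment
  generated by \<open>M\<close>. By strong collection in \<open>M\<close> this cut is elementary at level \<open>n\<close> in the big model, and
  the least number principle there yields bounding in the cut. A further elementary extension makes the
  result recursively saturated. The hypothesis supplies a witness \<open>Y\<close> for \<open>\<theta>(X, Y)\<close> that preserves \<open>I\<Sigma>\<^sub>n\<close>, and
  so does adjoining a \<open>\<Delta>\<^sub>1\<close>-definable set; afterwards the model is extended again, which recovers bounding.
  Iterating \<open>\<omega>\<close> times with bookkeeping, the union of the chain satisfies \<open>RCA\<^sub>0\<close>, bounding and \<open>\<Gamma>\<close>, since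
  \<open>\<Pi>\<close>-facts of level \<open>n + 1\<close> persist, and so does the failure of \<open>\<phi>\<close>.
\<close>

text \<open>The hypothesis returns only \<open>I\<Sigma>\<^sub>n\<close>, so bounding has to be
  restored after every new set by passing to a larger model, and everything achieved so far must
  survive this. That fixes the level: \<theta> and the failure of a Pi_(n+2) formula at given
  parameters both come down to Pi_(n+1) facts, which Sigma_(n+1)-elementary extensions preserve. An
  extension changes the sets along with the numbers. Structures are therefore compared through
  names: the set \<open>s i\<close> of the old structure corresponds to \<open>t i\<close> in the
  new one, and set variables serve as names throughout. Strong collection needs a code for a
  Sigma_n-definable part of an initial segment. The code avoids exponentiation: it is a least common
  multiple of Goedel moduli. Recursive saturation is not obtained from a saturated model but from
  the Henkin construction itself, which realizes the countably many recursive types on its way. Its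
  models live on the natural numbers, the type for which the hypothesis is stated. Elements have to
  be renamed at each step because a union of a chain needs inclusions, not embeddings.\<close>

instance tm :: countable by countable_datatype
instance fm :: countable by countable_datatype

section \<open>Substitution and free variables\<close>

abbreviation up :: "(nat \<Rightarrow> tm) \<Rightarrow> nat \<Rightarrow> tm" where
  "up \<sigma> \<equiv> case_nat (Var 0) (\<lambda>i. tlift (\<sigma> i))"

abbreviation upS :: "(nat \<Rightarrow> nat) \<Rightarrow> nat \<Rightarrow> nat" where
  "upS \<rho> \<equiv> case_nat 0 (\<lambda>i. Suc (\<rho> i))"

lemma tsubst_tsubst: "tsubst \<sigma> (tsubst \<tau> t) = tsubst (\<lambda>i. tsubst \<sigma> (\<tau> i)) t"
  by (induction t) auto

lemma tsubst_Var [simp]: "tsubst Var t = t"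
  by (induction t) auto

lemma tlift_simps [simp]:
  "tlift (Var i) = Var (Suc i)" "tlift Zero = Zero" "tlift One = One"
  "tlift (Add t u) = Add (tlift t) (tlift u)" "tlift (Mul t u) = Mul (tlift t) (tlift u)"
  by (auto simp: tlift_def)

lemma tsubst_up_tlift [simp]: "tsubst (up \<sigma>) (tlift t) = tlift (tsubst \<sigma> t)"
  by (simp add: tlift_def tsubst_tsubst)

lemma up_comp: "(\<lambda>i. tsubst (up \<sigma>) (up \<tau> i)) = up (\<lambda>i. tsubst \<sigma> (\<tau> i))"
  by (auto simp: fun_eq_iff split: nat.split)

lemma up_Var [simp]: "up Var = Var"
  by (auto simp: fun_eq_iff split: nat.split)

lemma upS_comp: "(\<lambda>i. upS \<rho> (upS \<pi> i)) = upS (\<lambda>i. \<rho> (\<pi> i))"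
  by (auto simp: fun_eq_iff split: nat.split)

lemma upS_id [simp]: "upS (\<lambda>i. i) = (\<lambda>i. i)" "upS id = id"
  by (auto simp: fun_eq_iff split: nat.split)

lemma subst_subst:
  "subst \<sigma> \<rho> (subst \<tau> \<pi> p) = subst (\<lambda>i. tsubst \<sigma> (\<tau> i)) (\<lambda>i. \<rho> (\<pi> i)) p"
proof (induction p arbitrary: \<sigma> \<rho> \<tau> \<pi>)
  case (All p)
  then show ?case by (simp only: subst.simps up_comp)
next
  case (AllS p)
  then show ?case by (simp only: subst.simps upS_comp)
qed (auto simp: tsubst_tsubst)

lemma subst_id [simp]: "subst Var (\<lambda>i. i) p = p" "subst Var id p = p"
proof -
  show "subst Var (\<lambda>i. i) p = p"
    by (induction p) (simp_all only: subst.simps up_Var upS_id tsubst_Var)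
  then show "subst Var id p = p" by (simp add: id_def)
qed

text \<open>The bounds in \<open>fv_below\<close> cannot express that a single variable is fresh or
  that all variables are even, as the Henkin construction requires; hence the sets of free
  variables.\<close>

primrec fvt :: "tm \<Rightarrow> nat set" where
  "fvt (Var i) = {i}"
| "fvt Zero = {}"
| "fvt One = {}"
| "fvt (Add t u) = fvt t \<union> fvt u"
| "fvt (Mul t u) = fvt t \<union> fvt u"

primrec fvN :: "fm \<Rightarrow> nat set" where
  "fvN Fls = {}"
| "fvN (Eq t u) = fvt t \<union> fvt u"
| "fvN (Less t u) = fvt t \<union> fvt u"
| "fvN (Mem t X) = fvt t"
| "fvN (Imp p q) = fvN p \<union> fvN q"
| "fvN (All p) = {i. Suc i \<in> fvN p}"
| "fvN (AllS p) = fvN p"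

primrec fvS :: "fm \<Rightarrow> nat set" where
  "fvS Fls = {}"
| "fvS (Eq t u) = {}"
| "fvS (Less t u) = {}"
| "fvS (Mem t X) = {X}"
| "fvS (Imp p q) = fvS p \<union> fvS q"
| "fvS (All p) = fvS p"
| "fvS (AllS p) = {i. Suc i \<in> fvS p}"

lemma tfv_below_iff: "tfv_below k t \<longleftrightarrow> fvt t \<subseteq> {..<k}"
  by (induction t) auto

lemma Suc_Collect_subset: "{i. Suc i \<in> A} \<subseteq> {..<k} \<longleftrightarrow> A \<subseteq> {..<Suc k}"
  by (auto simp: subset_iff less_Suc_eq_0_disj) (metis Suc_less_eq lessI not0_implies_Suc zero_less_Suc)

lemma fv_below_iff: "fv_below k m p \<longleftrightarrow> fvN p \<subseteq> {..<k} \<and> fvS p \<subseteq> {..<m}"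
  by (induction p arbitrary: k m) (auto simp: tfv_below_iff Suc_Collect_subset)

lemma finite_fv: "finite (fvN p)" "finite (fvS p)"
proof -
  have t: "finite (fvt t)" for t by (induction t) auto
  have s: "finite {i. Suc i \<in> A}" if "finite A" for A
    using finite_vimageI[OF that, of Suc] by (simp add: vimage_def)
  show "finite (fvN p)" "finite (fvS p)" by (induction p) (auto simp: t s)
qed

lemma ex_fv_below: "\<exists>k. fv_below k k p"
proof -
  obtain k1 k2 where "fvN p \<subseteq> {..<k1}" "fvS p \<subseteq> {..<k2}"
    using finite_fv[of p] finite_nat_iff_bounded by metis
  then have "fv_below (max k1 k2) (max k1 k2) p"
    unfolding fv_below_iff using lessThan_subset_iff[of k1 "max k1 k2"] lessThan_subset_iff[of k2 "max k1 k2"]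
    by fastforce
  then show ?thesis ..
qed

lemma tsubst_cong: "(\<And>i. i \<in> fvt t \<Longrightarrow> \<sigma> i = \<tau> i) \<Longrightarrow> tsubst \<sigma> t = tsubst \<tau> t"
  by (induction t) auto

lemma subst_cong:
  "(\<And>i. i \<in> fvN p \<Longrightarrow> \<sigma> i = \<tau> i) \<Longrightarrow> (\<And>i. i \<in> fvS p \<Longrightarrow> \<rho> i = \<pi> i) \<Longrightarrow> subst \<sigma> \<rho> p = subst \<tau> \<pi> p"
proof (induction p arbitrary: \<sigma> \<rho> \<tau> \<pi>)
  case (All p)
  have "subst (up \<sigma>) \<rho> p = subst (up \<tau>) \<pi> p"
  proof (rule All.IH)
    show "up \<sigma> i = up \<tau> i" if "i \<in> fvN p" for i
      using All.prems(1) that by (cases i) auto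
  qed (use All.prems(2) in \<open>auto simp only: fvS.simps\<close>)
  then show ?case by simp
next
  case (AllS p)
  have "subst \<sigma> (upS \<rho>) p = subst \<tau> (upS \<pi>) p"
  proof (rule AllS.IH)
    show "upS \<rho> i = upS \<pi> i" if "i \<in> fvS p" for i
      using AllS.prems(2) that by (cases i) auto
  qed (use AllS.prems(1) in \<open>auto simp only: fvN.simps\<close>)
  then show ?case by simp
next
  case (Imp p q)
  have "subst \<sigma> \<rho> p = subst \<tau> \<pi> p" by (rule Imp.IH) (use Imp.prems in auto)
  moreover have "subst \<sigma> \<rho> q = subst \<tau> \<pi> q" by (rule Imp.IH) (use Imp.prems in auto)
  ultimately show ?case by simp
next
  case (Eq t u)
  have "tsubst \<sigma> t = tsubst \<tau> t" "tsubst \<sigma> u = tsubst \<tau> u"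
    by (rule tsubst_cong, rule Eq.prems(1), simp)+
  then show ?case by simp
next
  case (Less t u)
  have "tsubst \<sigma> t = tsubst \<tau> t" "tsubst \<sigma> u = tsubst \<tau> u"
    by (rule tsubst_cong, rule Less.prems(1), simp)+
  then show ?case by simp
next
  case (Mem t X)
  have "tsubst \<sigma> t = tsubst \<tau> t"
    by (rule tsubst_cong, rule Mem.prems(1), simp)
  moreover have "\<rho> X = \<pi> X" by (rule Mem.prems(2)) simp
  ultimately show ?case by simp
qed simp_all

lemma fvt_tsubst: "fvt (tsubst \<sigma> t) = (\<Union>i\<in>fvt t. fvt (\<sigma> i))"
  by (induction t) auto

lemma fvt_tlift [simp]: "fvt (tlift t) = Suc ` fvt t"
  by (auto simp: tlift_def fvt_tsubst)

lemma fv_subst: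
  "fvN (subst \<sigma> \<rho> p) = (\<Union>i\<in>fvN p. fvt (\<sigma> i))" "fvS (subst \<sigma> \<rho> p) = \<rho> ` fvS p"
proof -
  show "fvN (subst \<sigma> \<rho> p) = (\<Union>i\<in>fvN p. fvt (\<sigma> i))"
  proof (induction p arbitrary: \<sigma> \<rho>)
    case (All p)
    have "Suc x \<in> fvt (up \<sigma> i) \<longleftrightarrow> (\<exists>j. i = Suc j \<and> x \<in> fvt (\<sigma> j))" for x i
      by (cases i) auto
    then show ?case by (auto simp only: All fvN.simps subst.simps UN_iff mem_Collect_eq)
  qed (auto simp: fvt_tsubst)
  show "fvS (subst \<sigma> \<rho> p) = \<rho> ` fvS p"
  proof (induction p arbitrary: \<sigma> \<rho>)
    case (AllS p)
    have "Suc x = upS \<rho> i \<longleftrightarrow> (\<exists>j. i = Suc j \<and> x = \<rho> j)" for x i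
      by (cases i) auto
    then show ?case by (auto simp only: AllS fvS.simps subst.simps image_iff mem_Collect_eq)
  qed auto
qed

section \<open>Semantics of substitution\<close>

text \<open>\<open>sat\<close> also accepts assignments with values outside the structure. The rules
  \<open>AllE\<close> and \<open>AllSE\<close> are sound only for assignments that stay
  inside.\<close>

definition env :: "'a L2_struct \<Rightarrow> (nat \<Rightarrow> 'a) \<Rightarrow> bool" where
  "env M e \<longleftrightarrow> (\<forall>i. e i \<in> num_dom M)"

definition senv :: "'a L2_struct \<Rightarrow> (nat \<Rightarrow> 'a set) \<Rightarrow> bool" where
  "senv M s \<longleftrightarrow> (\<forall>i. s i \<in> set_dom M)"

lemma tval_tsubst: "tval M e (tsubst \<sigma> t) = tval M (\<lambda>i. tval M e (\<sigma> i)) t"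
  by (induction t) auto

lemma tval_tlift [simp]: "tval M (case_nat a e) (tlift t) = tval M e t"
  by (simp add: tlift_def tval_tsubst)

lemma tval_up: "(\<lambda>i. tval M (case_nat a e) (up \<sigma> i)) = case_nat a (\<lambda>i. tval M e (\<sigma> i))"
  by (auto simp: fun_eq_iff split: nat.split)

lemma senv_upS: "(\<lambda>i. case_nat A s (upS \<rho> i)) = case_nat A (\<lambda>i. s (\<rho> i))"
  by (auto simp: fun_eq_iff split: nat.split)

lemma sat_subst:
  "sat M e s (subst \<sigma> \<rho> p) = sat M (\<lambda>i. tval M e (\<sigma> i)) (\<lambda>i. s (\<rho> i)) p"
proof (induction p arbitrary: e s \<sigma> \<rho>)
  case (All p)
  then show ?case by (simp only: subst.simps sat.simps tval_up)
next
  case (AllS p)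
  then show ?case by (simp only: subst.simps sat.simps senv_upS)
qed (auto simp: tval_tsubst)

lemma sat_simps [simp]:
  "sat M e s (Neg p) = (\<not> sat M e s p)"
  "sat M e s (Conj p q) = (sat M e s p \<and> sat M e s q)"
  "sat M e s (Disj p q) = (sat M e s p \<or> sat M e s q)"
  "sat M e s (Iff p q) = (sat M e s p = sat M e s q)"
  "sat M e s (ExN p) = (\<exists>a\<in>num_dom M. sat M (case_nat a e) s p)"
  "sat M e s (ExS p) = (\<exists>A\<in>set_dom M. sat M e (case_nat A s) p)"
  "sat M e s (BAll t p) = (\<forall>a\<in>num_dom M. lessM M a (tval M e t) \<longrightarrow> sat M (case_nat a e) s p)"
  "sat M e s (BEx t p) = (\<exists>a\<in>num_dom M. lessM M a (tval M e t) \<and> sat M (case_nat a e) s p)"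
  by (auto simp: Neg_def Conj_def Disj_def Iff_def ExN_def ExS_def BAll_def BEx_def)

lemma sat_lift [simp]: "sat M (case_nat a e) s (lift p) = sat M e s p"
  by (simp add: lift_def sat_subst)

lemma sat_liftS [simp]: "sat M e (case_nat A s) (liftS p) = sat M e s p"
  by (simp add: liftS_def sat_subst)

lemma sat_inst [simp]: "sat M e s (inst t p) = sat M (case_nat (tval M e t) e) s p"
proof -
  have "(\<lambda>i. tval M e (case_nat t Var i)) = case_nat (tval M e t) e"
    by (auto simp: fun_eq_iff split: nat.split)
  then show ?thesis by (simp add: inst_def sat_subst)
qed

lemma sat_instS [simp]: "sat M e s (instS X p) = sat M e (case_nat (s X) s) p"
proof -
  have "(\<lambda>i. s (case_nat X id i)) = case_nat (s X) s"
    by (auto simp: fun_eq_iff split: nat.split)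
  then show ?thesis by (simp add: instS_def sat_subst)
qed

lemma tval_cong: "(\<And>i. i \<in> fvt t \<Longrightarrow> e i = e' i) \<Longrightarrow> tval M e t = tval M e' t"
  by (induction t) auto

lemma sat_cong:
  "(\<And>i. i \<in> fvN p \<Longrightarrow> e i = e' i) \<Longrightarrow> (\<And>i. i \<in> fvS p \<Longrightarrow> s i = s' i) \<Longrightarrow> sat M e s p = sat M e' s' p"
proof (induction p arbitrary: e e' s s')
  case (All p)
  have "sat M (case_nat a e) s p = sat M (case_nat a e') s' p" for a
    by (rule All.IH) (use All.prems in \<open>auto split: nat.split\<close>)
  then show ?case by simp
next
  case (AllS p)
  have "sat M e (case_nat A s) p = sat M e' (case_nat A s') p" for A
    by (rule AllS.IH) (use AllS.prems in \<open>auto split: nat.split\<close>)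
  then show ?case by simp
next
  case (Eq t u)
  then have "tval M e t = tval M e' t" "tval M e u = tval M e' u" by (auto intro!: tval_cong)
  then show ?case by simp
next
  case (Less t u)
  then have "tval M e t = tval M e' t" "tval M e u = tval M e' u" by (auto intro!: tval_cong)
  then show ?case by simp
next
  case (Mem t X)
  then have "tval M e t = tval M e' t" by (auto intro!: tval_cong)
  with Mem show ?case by simp
next
  case (Imp p q)
  have "sat M e s p = sat M e' s' p" "sat M e s q = sat M e' s' q"
    by (rule Imp.IH; use Imp.prems in auto)+
  then show ?case by simp
qed auto

lemma env_case_nat [simp]: "env M (case_nat a e) \<longleftrightarrow> a \<in> num_dom M \<and> env M e"
  by (auto simp: env_def split: nat.split)

lemma senv_case_nat [simp]: "senv M (case_nat a e) \<longleftrightarrow> a \<in> set_dom M \<and> senv M e"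
  by (auto simp: senv_def split: nat.split)

lemma tval_dom: "L2_structure M \<Longrightarrow> env M e \<Longrightarrow> tval M e t \<in> num_dom M"
  by (induction t) (auto simp: L2_structure_def env_def)

section \<open>Metatheory of the calculus\<close>

lemma prv_mono: "\<Gamma> \<turnstile> p \<Longrightarrow> \<Gamma> \<subseteq> \<Gamma>' \<Longrightarrow> \<Gamma>' \<turnstile> p"
proof (induction arbitrary: \<Gamma>' rule: prv.induct)
  case (ImpI p \<Gamma> q)
  then show ?case by (meson insert_mono prv.ImpI)
next
  case (Contr p \<Gamma>)
  then show ?case by (meson insert_mono prv.Contr)
next
  case (AllI \<Gamma> p)
  then show ?case by (meson image_mono prv.AllI)
next
  case (AllSI \<Gamma> p)
  then show ?case by (meson image_mono prv.AllSI)
next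
  case (Leibniz \<Gamma> t u p)
  then show ?case by (meson prv.Leibniz)
qed (auto intro: prv.intros)

text \<open>Discharging a hypothesis removes it from the finite set, and at a quantifier rule a
  finite part of an image is the image of a finite part.\<close>

lemma prv_finite: "\<Gamma> \<turnstile> p \<Longrightarrow> \<exists>F. finite F \<and> F \<subseteq> \<Gamma> \<and> F \<turnstile> p"
proof (induction rule: prv.induct)
  case (Assm p \<Gamma>)
  then show ?case by (intro exI[of _ "{p}"]) (auto intro: prv.Assm)
next
  case (ImpI p \<Gamma> q)
  then obtain F where F: "finite F" "F \<subseteq> insert p \<Gamma>" "F \<turnstile> q" by blast
  have "F - {p} \<turnstile> Imp p q" by (rule prv.ImpI, rule prv_mono[OF F(3)]) blast
  with F show ?case by (intro exI[of _ "F - {p}"]) auto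
next
  case (Contr p \<Gamma>)
  then obtain F where F: "finite F" "F \<subseteq> insert (Neg p) \<Gamma>" "F \<turnstile> Fls" by blast
  have "F - {Neg p} \<turnstile> p" by (rule prv.Contr, rule prv_mono[OF F(3)]) blast
  with F show ?case by (intro exI[of _ "F - {Neg p}"]) auto
next
  case (ImpE \<Gamma> p q)
  then obtain F G where "finite F" "F \<subseteq> \<Gamma>" "F \<turnstile> Imp p q" "finite G" "G \<subseteq> \<Gamma>" "G \<turnstile> p" by blast
  moreover from this have "F \<union> G \<turnstile> q"
    by (meson prv.ImpE prv_mono Un_upper1 Un_upper2)
  ultimately show ?case by (meson finite_Un le_sup_iff)
next
  case (AllI \<Gamma> p)
  then obtain F where "finite F" "F \<subseteq> lift ` \<Gamma>" "F \<turnstile> p" by blast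
  moreover from this obtain G where "G \<subseteq> \<Gamma>" "finite G" "F = lift ` G"
    by (meson finite_subset_image)
  ultimately show ?case by (auto intro: prv.AllI)
next
  case (AllSI \<Gamma> p)
  then obtain F where "finite F" "F \<subseteq> liftS ` \<Gamma>" "F \<turnstile> p" by blast
  moreover from this obtain G where "G \<subseteq> \<Gamma>" "finite G" "F = liftS ` G"
    by (meson finite_subset_image)
  ultimately show ?case by (auto intro: prv.AllSI)
next
  case (Leibniz \<Gamma> t u p)
  then obtain F G where "finite F" "F \<subseteq> \<Gamma>" "F \<turnstile> Eq t u" "finite G" "G \<subseteq> \<Gamma>" "G \<turnstile> inst t p" by blast
  moreover from this have "F \<union> G \<turnstile> inst u p"
    by (meson prv.Leibniz prv_mono Un_upper1 Un_upper2)
  ultimately show ?case by (meson finite_Un le_sup_iff)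
next
  case (Refl \<Gamma> t)
  then show ?case by (intro exI[of _ "{}"]) (auto intro: prv.Refl)
qed (meson prv.intros)+

lemma subst_Neg [simp]: "subst \<sigma> \<rho> (Neg p) = Neg (subst \<sigma> \<rho> p)"
  by (simp add: Neg_def)

lemma subst_up_lift: "subst (up \<sigma>) \<rho> (lift p) = lift (subst \<sigma> \<rho> p)"
  by (simp add: lift_def subst_subst tlift_def)

lemma subst_upS_liftS: "subst \<sigma> (upS \<rho>) (liftS p) = liftS (subst \<sigma> \<rho> p)"
  by (simp add: liftS_def subst_subst)

lemma subst_inst: "subst \<sigma> \<rho> (inst t p) = inst (tsubst \<sigma> t) (subst (up \<sigma>) \<rho> p)"
  by (auto simp: inst_def subst_subst tlift_def tsubst_tsubst intro!: subst_cong split: nat.split)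

lemma subst_instS: "subst \<sigma> \<rho> (instS X p) = instS (\<rho> X) (subst \<sigma> (upS \<rho>) p)"
  by (auto simp: instS_def subst_subst intro!: subst_cong split: nat.split)

text \<open>The calculus has no constants, so free variables act as Henkin witnesses. Generalising
  over one of them means renaming it throughout a derivation, which this allows.\<close>

lemma prv_subst: "\<Gamma> \<turnstile> p \<Longrightarrow> subst \<sigma> \<rho> ` \<Gamma> \<turnstile> subst \<sigma> \<rho> p"
proof (induction arbitrary: \<sigma> \<rho> rule: prv.induct)
  case (AllI \<Gamma> p)
  have "subst (up \<sigma>) \<rho> ` lift ` \<Gamma> = lift ` subst \<sigma> \<rho> ` \<Gamma>"
    by (simp only: image_image subst_up_lift)
  with AllI.IH[of "up \<sigma>" \<rho>] show ?case by (auto intro: prv.AllI)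
next
  case (AllSI \<Gamma> p)
  have "subst \<sigma> (upS \<rho>) ` liftS ` \<Gamma> = liftS ` subst \<sigma> \<rho> ` \<Gamma>"
    by (simp only: image_image subst_upS_liftS)
  with AllSI.IH[of \<sigma> "upS \<rho>"] show ?case by (auto intro: prv.AllSI)
next
  case (AllE \<Gamma> p t)
  then show ?case by (auto simp: subst_inst intro: prv.AllE)
next
  case (AllSE \<Gamma> p X)
  then show ?case by (auto simp: subst_instS intro: prv.AllSE)
next
  case (Leibniz \<Gamma> t u p)
  show ?case unfolding subst_inst
    by (rule prv.Leibniz[of _ "tsubst \<sigma> t"]) (use Leibniz.IH[of \<sigma> \<rho>] in \<open>auto simp: subst_inst\<close>)
next
  case (ImpE \<Gamma> p q)
  then show ?case by (metis prv.ImpE subst.simps(5))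
qed (auto intro: prv.intros)

theorem soundness:
  assumes "\<Gamma> \<turnstile> p" "L2_structure M" "env M e" "senv M s" "\<And>q. q \<in> \<Gamma> \<Longrightarrow> sat M e s q"
  shows "sat M e s p"
  using assms
proof (induction arbitrary: e s rule: prv.induct)
  case (Contr p \<Gamma>)
  then show ?case by (metis insertE sat.simps(1) sat_simps(1))
next
  case (AllE \<Gamma> p t)
  then show ?case by (simp add: tval_dom)
next
  case (AllSE \<Gamma> p X)
  then show ?case by (simp add: senv_def)
next
  case (AllI \<Gamma> p)
  have "sat M (case_nat a e) s p" if "a \<in> num_dom M" for a
    by (rule AllI.IH) (use AllI.prems that in auto)
  then show ?case by simp
next
  case (AllSI \<Gamma> p)
  have "sat M e (case_nat A s) p" if "A \<in> set_dom M" for A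
    by (rule AllSI.IH) (use AllSI.prems that in auto)
  then show ?case by simp
qed auto

section \<open>Countability of the recursive types\<close>

text \<open>\<open>recursive_fun\<close> is a predicate on an uncountable type of functions. For
  countability it suffices to cover its instances by the values of a countable datatype, so
  \<open>reval\<close> neglects arities and the regularity of minimisation.\<close>

datatype rcode = RZero | RSucc | RProj nat | RComp rcode "rcode list" | RPrec rcode rcode | RMini rcode

instance rcode :: countable by countable_datatype

primrec reval :: "rcode \<Rightarrow> nat list \<Rightarrow> nat" where
  "reval RZero = (\<lambda>xs. 0)"
| "reval RSucc = (\<lambda>xs. Suc (hd xs))"
| "reval (RProj i) = (\<lambda>xs. xs ! i)"
| "reval (RComp f gs) = (\<lambda>xs. reval f (map (\<lambda>g. g xs) (map reval gs)))"
| "reval (RPrec f g) = (\<lambda>xs. rec_nat (reval f (tl xs)) (\<lambda>i r. reval g (i # r # tl xs)) (hd xs))"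
| "reval (RMini f) = (\<lambda>xs. LEAST i. reval f (i # xs) = 0)"

lemma recursive_fun_reval: "recursive_fun k f \<Longrightarrow> f \<in> range reval"
proof (induction rule: recursive_fun.induct)
  case (zero k)
  show ?case by (intro image_eqI[of _ _ RZero]) auto
next
  case succ
  show ?case by (intro image_eqI[of _ _ RSucc]) auto
next
  case (proj i k)
  show ?case by (intro image_eqI[of _ _ "RProj i"]) auto
next
  case (comp gs f k)
  from comp.IH obtain c where c: "f = reval c" by blast
  have "\<forall>g\<in>set gs. \<exists>d. g = reval d" using comp.IH by blast
  then obtain ds where "gs = map reval ds" using ex_map_conv[of gs reval] by blast
  with c show ?case by (intro image_eqI[of _ _ "RComp c ds"]) auto
next
  case (prec k f g)
  then obtain c d where "f = reval c" "g = reval d" by blast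
  then show ?case by (intro image_eqI[of _ _ "RPrec c d"]) auto
next
  case (mini k f)
  then obtain c where "f = reval c" by blast
  then show ?case by (intro image_eqI[of _ _ "RMini c"]) auto
qed

lemma countable_recursive_sets: "countable {A. recursive_set A}"
proof -
  have "A \<in> (\<lambda>c. {x. reval c [x] = 1}) ` UNIV" if A: "recursive_set A" for A
  proof -
    obtain f where f: "recursive_fun 1 f" "\<forall>x. f [x] = (if x \<in> A then 1 else 0)"
      using A unfolding recursive_set_def by blast
    obtain c where "f = reval c" using recursive_fun_reval[OF f(1)] by blast
    with f(2) have "A = {x. reval c [x] = 1}" by auto
    then show ?thesis by blast
  qed
  then have "{A. recursive_set A} \<subseteq> (\<lambda>c. {x. reval c [x] = 1}) ` UNIV" by blast
  then show ?thesis by (rule countable_subset) simp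
qed

lemma inj_tcode: "tcode t = tcode u \<Longrightarrow> t = u"
  by (induction t arbitrary: u) (case_tac u; auto simp: prod_encode_eq)+

lemma inj_code: "code p = code q \<Longrightarrow> p = q"
proof (induction p arbitrary: q)
  case (Imp p1 p2)
  then show ?case by (cases q) (auto simp: prod_encode_eq)
next
  case (All p)
  then show ?case by (cases q) (auto simp: prod_encode_eq)
next
  case (AllS p)
  then show ?case by (cases q) (auto simp: prod_encode_eq)
next
  case Fls
  then show ?case by (cases q) (auto simp: prod_encode_eq)
qed (case_tac q; auto simp: prod_encode_eq dest: inj_tcode)+

section \<open>Completeness with recursively saturated models\<close>

definition con :: "fm set \<Rightarrow> bool" where "con \<Gamma> \<longleftrightarrow> \<not> \<Gamma> \<turnstile> Fls"

lemma prv_Fls: "\<Gamma> \<turnstile> Fls \<Longrightarrow> \<Gamma> \<turnstile> p"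
  by (rule Contr, erule prv_mono) blast

lemma prv_cut: "insert p \<Gamma> \<turnstile> q \<Longrightarrow> \<Gamma> \<turnstile> p \<Longrightarrow> \<Gamma> \<turnstile> q"
  by (meson ImpI ImpE)

text \<open>One fresh index \<open>c\<close> serves as number witness and as set witness at the same
  time, so that number quantifiers, set quantifiers and recursive types are handled by a single kind
  of task.\<close>

definition inst2 :: "nat \<Rightarrow> fm \<Rightarrow> fm" where
  "inst2 c = subst (case_nat (Var c) Var) (case_nat c (\<lambda>i. i))"

definition fresh :: "nat \<Rightarrow> fm set \<Rightarrow> fm set \<Rightarrow> bool" where
  "fresh c \<Gamma> P \<longleftrightarrow> (\<forall>p\<in>\<Gamma>. c \<notin> fvN p \<and> c \<notin> fvS p) \<and> (\<forall>p\<in>P. fv_below c c p)"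

text \<open>A member \<open>P\<close> of the family is a type in the number variable 0 and the set variable 0.\<close>

locale henkin =
  fixes \<Delta> :: "fm set" and \<F> :: "fm set set"
  assumes con: "con \<Delta>"
    and even: "p \<in> \<Delta> \<Longrightarrow> fvN p \<subseteq> Collect even" "p \<in> \<Delta> \<Longrightarrow> fvS p \<subseteq> Collect even"
    and countable: "countable \<F>"
    and bounded: "P \<in> \<F> \<Longrightarrow> \<exists>N. \<forall>p\<in>P. fv_below N N p"
    and singleton: "{p} \<in> \<F>"
begin

text \<open>The same operation does three things: a singleton that ignores its two variables decides
  a formula, the singleton of a negated matrix supplies a Henkin witness, and a recursive type
  becomes realized.\<close>

definition next_stage :: "fm set \<Rightarrow> fm set \<Rightarrow> fm set" where
  "next_stage \<Gamma> P = (let \<Gamma>' = \<Gamma> \<union> inst2 (SOME c. fresh c \<Gamma> P) ` P in if con \<Gamma>' then \<Gamma>' else \<Gamma>)"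

primrec stage :: "nat \<Rightarrow> fm set" where
  "stage 0 = \<Delta>"
| "stage (Suc k) = next_stage (stage k) (from_nat_into \<F> k)"

definition limit :: "fm set" where "limit = (\<Union>k. stage k)"

text \<open>The even variables may all occur in the initial theory. Of the odd ones a stage uses
  only a bounded part, so a fresh odd variable is always left.\<close>

definition bounded_odd :: "fm set \<Rightarrow> bool" where
  "bounded_odd \<Gamma> \<longleftrightarrow> (\<exists>N. \<forall>p\<in>\<Gamma>. fvN p \<subseteq> {i. even i \<or> i < N} \<and> fvS p \<subseteq> {i. even i \<or> i < N})"

lemma ex_fresh:
  assumes "bounded_odd \<Gamma>" "P \<in> \<F>"
  shows "\<exists>c. fresh c \<Gamma> P"
proof -
  obtain N where N: "\<forall>p\<in>\<Gamma>. fvN p \<subseteq> {i. even i \<or> i < N} \<and> fvS p \<subseteq> {i. even i \<or> i < N}"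
    using assms(1) unfolding bounded_odd_def by blast
  obtain N' where N': "\<forall>p\<in>P. fv_below N' N' p" using bounded[OF assms(2)] by blast
  \<comment> \<open>Odd and above both bounds.\<close>
  let ?c = "2 * (N + N') + 1"
  have "?c \<notin> {i. even i \<or> i < N}" by auto
  moreover have "{..<N'} \<subseteq> {..<?c}" by auto
  ultimately have "fresh ?c \<Gamma> P" using N N' unfolding fresh_def fv_below_iff
    by (intro conjI ballI) (meson subsetD subset_trans)+
  then show ?thesis ..
qed

lemma fv_inst2:
  assumes "fv_below c c p"
  shows "fvN (inst2 c p) \<subseteq> {..c}" "fvS (inst2 c p) \<subseteq> {..c}"
  using assms unfolding inst2_def fv_subst fv_below_iff by (force split: nat.splits)+

lemma bounded_odd_stage: "bounded_odd (stage k)"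
proof (induction k)
  case 0
  then show ?case using even unfolding bounded_odd_def by fastforce
next
  case (Suc k)
  let ?P = "from_nat_into \<F> k"
  let ?c = "SOME c. fresh c (stage k) ?P"
  have "?P \<in> \<F>" by (rule from_nat_into) (use singleton in auto)
  then have c: "fresh ?c (stage k) ?P" using ex_fresh[OF Suc] by (metis someI)
  obtain N where N: "\<forall>p\<in>stage k. fvN p \<subseteq> {i. even i \<or> i < N} \<and> fvS p \<subseteq> {i. even i \<or> i < N}"
    using Suc unfolding bounded_odd_def by blast
  have "fvN p \<subseteq> {i. even i \<or> i < N + Suc ?c} \<and> fvS p \<subseteq> {i. even i \<or> i < N + Suc ?c}"
    if "p \<in> stage k \<union> inst2 ?c ` ?P" for p
    using that
  proof
    assume "p \<in> stage k"
    with N show ?thesis by fastforce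
  next
    assume "p \<in> inst2 ?c ` ?P"
    then obtain q where "p = inst2 ?c q" "fv_below ?c ?c q" using c unfolding fresh_def by blast
    with fv_inst2[of ?c q] show ?thesis by fastforce
  qed
  moreover have "stage (Suc k) \<subseteq> stage k \<union> inst2 ?c ` ?P"
    by (auto simp: next_stage_def Let_def)
  ultimately show ?case unfolding bounded_odd_def by (intro exI[of _ "N + Suc ?c"] ballI) (meson subsetD)
qed

lemma con_stage: "con (stage k)"
  by (induction k) (auto simp: con next_stage_def Let_def)

lemma stage_mono: "i \<le> j \<Longrightarrow> stage i \<subseteq> stage j"
  by (rule lift_Suc_mono_le[of stage]) (auto simp: next_stage_def Let_def)

lemma finite_limit: "finite F \<Longrightarrow> F \<subseteq> limit \<Longrightarrow> \<exists>k. F \<subseteq> stage k"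
proof (induction rule: finite_induct)
  case (insert p F)
  then obtain i j where "F \<subseteq> stage i" "p \<in> stage j" by (auto simp: limit_def)
  then have "insert p F \<subseteq> stage (max i j)"
    using stage_mono[of i "max i j"] stage_mono[of j "max i j"] by auto
  then show ?case ..
qed simp

lemma con_limit: "con limit"
  unfolding con_def
proof
  assume "limit \<turnstile> Fls"
  then obtain F where "finite F" "F \<subseteq> limit" "F \<turnstile> Fls" using prv_finite by blast
  then show False using finite_limit con_stage prv_mono unfolding con_def by metis
qed

lemma stage_subset_limit: "stage k \<subseteq> limit"
  by (auto simp: limit_def)

text \<open>The form in which later arguments use the stage that treats \<open>P\<close>:
  consistency has to be checked only over an earlier part \<open>\<Gamma>\<close> of the limit, in
  which \<open>c\<close> does not occur.\<close>

lemma task: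
  assumes "P \<in> \<F>"
  obtains c \<Gamma> where "\<Gamma> \<subseteq> limit" "fresh c \<Gamma> P" "con (\<Gamma> \<union> inst2 c ` P) \<Longrightarrow> inst2 c ` P \<subseteq> limit"
proof -
  obtain k where k: "P = from_nat_into \<F> k" using from_nat_into_surj[OF countable assms] by blast
  let ?c = "SOME c. fresh c (stage k) P"
  have "fresh ?c (stage k) P" using ex_fresh[OF bounded_odd_stage assms] by (metis someI)
  moreover have "inst2 ?c ` P \<subseteq> limit" if "con (stage k \<union> inst2 ?c ` P)"
  proof -
    have "inst2 ?c ` P \<subseteq> stage (Suc k)" using that by (auto simp: next_stage_def k)
    then show ?thesis using stage_subset_limit by blast
  qed
  ultimately show ?thesis by (rule that[OF stage_subset_limit])
qed

lemma inst2_shift [simp]: "inst2 c (subst (\<lambda>i. Var (Suc i)) Suc p) = p"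
  by (simp add: inst2_def subst_subst)

lemma limit_max:
  assumes "con (insert p limit)"
  shows "p \<in> limit"
proof -
  \<comment> \<open>The shift makes room for the two variables of a type, and \<open>inst2\<close>
    undoes it.\<close>
  let ?P = "{subst (\<lambda>i. Var (Suc i)) Suc p}"
  obtain c \<Gamma> where "\<Gamma> \<subseteq> limit" "con (\<Gamma> \<union> inst2 c ` ?P) \<Longrightarrow> inst2 c ` ?P \<subseteq> limit"
    using task[OF singleton] by metis
  moreover have "con (\<Gamma> \<union> {p})"
    using assms \<open>\<Gamma> \<subseteq> limit\<close> prv_mono[of "\<Gamma> \<union> {p}" Fls "insert p limit"] unfolding con_def by blast
  ultimately show ?thesis by simp
qed

lemma limit_closed: "limit \<turnstile> p \<Longrightarrow> p \<in> limit"
  using con_limit limit_max prv_cut unfolding con_def by blast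

lemma limit_iff: "p \<in> limit \<longleftrightarrow> limit \<turnstile> p"
  using limit_closed Assm by blast

lemma limit_Fls: "Fls \<notin> limit"
  using con_limit by (simp add: con_def limit_iff)

lemma limit_Imp: "Imp p q \<in> limit \<longleftrightarrow> (p \<in> limit \<longrightarrow> q \<in> limit)"
proof
  assume "Imp p q \<in> limit"
  then show "p \<in> limit \<longrightarrow> q \<in> limit" using ImpE unfolding limit_iff by blast
next
  assume *: "p \<in> limit \<longrightarrow> q \<in> limit"
  have "insert p limit \<turnstile> q"
  proof (cases "p \<in> limit")
    case True
    with * show ?thesis by (auto intro: Assm)
  next
    case False
    then show ?thesis using limit_max con_def prv_Fls by blast
  qed
  then show "Imp p q \<in> limit" using ImpI limit_iff by blast
qed

lemma limit_Neg: "Neg p \<in> limit \<longleftrightarrow> p \<notin> limit"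
  by (simp add: Neg_def limit_Imp limit_Fls)

lemma limit_All: "All q \<in> limit \<longleftrightarrow> (\<forall>t. inst t q \<in> limit)"
proof
  assume "All q \<in> limit"
  then show "\<forall>t. inst t q \<in> limit" using AllE limit_iff by blast
next
  assume *: "\<forall>t. inst t q \<in> limit"
  show "All q \<in> limit"
  proof (rule ccontr)
    assume nq: "All q \<notin> limit"
    \<comment> \<open>Number variable 0 of \<open>q\<close> is already the variable of the type;
      only a dummy set variable 0 is inserted.\<close>
    let ?P = "{Neg (liftS q)}"
    obtain c \<Gamma> where c: "\<Gamma> \<subseteq> limit" "fresh c \<Gamma> ?P" "con (\<Gamma> \<union> inst2 c ` ?P) \<Longrightarrow> inst2 c ` ?P \<subseteq> limit"
      using task[OF singleton] by metis
    have i: "inst2 c (Neg (liftS q)) = Neg (inst (Var c) q)"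
      by (simp add: inst2_def liftS_def inst_def subst_subst id_def)
    have "con (\<Gamma> \<union> {Neg (inst (Var c) q)})"
      unfolding con_def
    proof
      assume f: "\<Gamma> \<union> {Neg (inst (Var c) q)} \<turnstile> Fls"
      \<comment> \<open>Turns \<open>c\<close> into the variable to be bound and shifts all others:
        the refutation becomes the premise of \<open>AllI\<close>.\<close>
      let ?\<sigma> = "\<lambda>i. if i = c then Var 0 else Var (Suc i)"
      have "subst ?\<sigma> (\<lambda>i. i) p = lift p" if "p \<in> \<Gamma>" for p
        unfolding lift_def id_def by (rule subst_cong) (use c(2) that in \<open>auto simp: fresh_def\<close>)
      moreover have "subst ?\<sigma> (\<lambda>i. i) (inst (Var c) q) = subst Var (\<lambda>i. i) q"
      proof -
        have "fvN q \<subseteq> {..<c}" using c(2)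
          by (simp add: fresh_def fv_below_iff Neg_def liftS_def fv_subst)
        then show ?thesis unfolding inst_def id_def subst_subst
          by (intro subst_cong) (auto split: nat.split)
      qed
      ultimately have "subst ?\<sigma> (\<lambda>i. i) ` (\<Gamma> \<union> {Neg (inst (Var c) q)}) = insert (Neg q) (lift ` \<Gamma>)"
        by auto
      with prv_subst[OF f, of ?\<sigma> "\<lambda>i. i"] have "insert (Neg q) (lift ` \<Gamma>) \<turnstile> Fls" by simp
      then have "\<Gamma> \<turnstile> All q" by (rule AllI[OF Contr])
      then show False using nq c(1) prv_mono limit_iff by blast
    qed
    then have "Neg (inst (Var c) q) \<in> limit" using c(3) i by simp
    with * limit_Neg show False by blast
  qed
qed

lemma limit_AllS: "AllS q \<in> limit \<longleftrightarrow> (\<forall>X. instS X q \<in> limit)"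
proof
  assume "AllS q \<in> limit"
  then show "\<forall>X. instS X q \<in> limit" using AllSE limit_iff by blast
next
  assume *: "\<forall>X. instS X q \<in> limit"
  show "AllS q \<in> limit"
  proof (rule ccontr)
    assume nq: "AllS q \<notin> limit"
    let ?P = "{Neg (lift q)}"
    obtain c \<Gamma> where c: "\<Gamma> \<subseteq> limit" "fresh c \<Gamma> ?P" "con (\<Gamma> \<union> inst2 c ` ?P) \<Longrightarrow> inst2 c ` ?P \<subseteq> limit"
      using task[OF singleton] by metis
    have i: "inst2 c (Neg (lift q)) = Neg (instS c q)"
      by (simp add: inst2_def lift_def instS_def subst_subst id_def)
    have "con (\<Gamma> \<union> {Neg (instS c q)})"
      unfolding con_def
    proof
      assume f: "\<Gamma> \<union> {Neg (instS c q)} \<turnstile> Fls"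
      let ?\<rho> = "\<lambda>i. if i = c then 0 else Suc i"
      have "subst Var ?\<rho> p = liftS p" if "p \<in> \<Gamma>" for p
        unfolding liftS_def id_def by (rule subst_cong) (use c(2) that in \<open>auto simp: fresh_def\<close>)
      moreover have "subst Var ?\<rho> (instS c q) = subst Var (\<lambda>i. i) q"
      proof -
        have "fvS q \<subseteq> {..<c}" using c(2)
          by (simp add: fresh_def fv_below_iff Neg_def lift_def fv_subst)
        then show ?thesis unfolding instS_def id_def subst_subst
          by (intro subst_cong) (auto split: nat.split)
      qed
      ultimately have "subst Var ?\<rho> ` (\<Gamma> \<union> {Neg (instS c q)}) = insert (Neg q) (liftS ` \<Gamma>)"
        by auto
      with prv_subst[OF f, of Var ?\<rho>] have "insert (Neg q) (liftS ` \<Gamma>) \<turnstile> Fls" by simp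
      then have "\<Gamma> \<turnstile> AllS q" by (rule AllSI[OF Contr])
      then show False using nq c(1) prv_mono limit_iff by blast
    qed
    then have "Neg (instS c q) \<in> limit" using c(3) i by simp
    with * limit_Neg show False by blast
  qed
qed

text \<open>A refutation at the fresh \<open>c\<close> involves finitely many members of the type.
  Putting a term and a set variable that satisfy those members in place of \<open>c\<close> turns it
  into a refutation of the limit itself.\<close>

lemma type_realized:
  assumes "P \<in> \<F>" and "\<And>F. finite F \<Longrightarrow> F \<subseteq> P \<Longrightarrow> \<exists>t X. subst (case_nat t Var) (case_nat X (\<lambda>i. i)) ` F \<subseteq> limit"
  shows "\<exists>c. inst2 c ` P \<subseteq> limit"
proof -
  obtain c \<Gamma> where c: "\<Gamma> \<subseteq> limit" "fresh c \<Gamma> P" "con (\<Gamma> \<union> inst2 c ` P) \<Longrightarrow> inst2 c ` P \<subseteq> limit"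
    using task[OF assms(1)] by metis
  have "con (\<Gamma> \<union> inst2 c ` P)"
    unfolding con_def
  proof
    assume "\<Gamma> \<union> inst2 c ` P \<turnstile> Fls"
    then obtain G where G: "finite G" "G \<subseteq> \<Gamma> \<union> inst2 c ` P" "G \<turnstile> Fls" using prv_finite by blast
    then have "finite (G - \<Gamma>)" "G - \<Gamma> \<subseteq> inst2 c ` P" by auto
    then obtain F where F: "F \<subseteq> P" "finite F" "G - \<Gamma> = inst2 c ` F"
      by (meson finite_subset_image)
    obtain t X where tX: "subst (case_nat t Var) (case_nat X (\<lambda>i. i)) ` F \<subseteq> limit"
      using assms(2) F by metis
    let ?\<sigma> = "\<lambda>i. if i = c then t else Var i" and ?\<rho> = "\<lambda>i. if i = c then X else i"
    have 1: "subst ?\<sigma> ?\<rho> p = subst Var (\<lambda>i. i) p" if "p \<in> \<Gamma>" for p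
      by (rule subst_cong) (use c(2) that in \<open>auto simp: fresh_def\<close>)
    have 2: "subst ?\<sigma> ?\<rho> (inst2 c p) = subst (case_nat t Var) (case_nat X (\<lambda>i. i)) p" if "p \<in> F" for p
    proof -
      have "fvN p \<subseteq> {..<c}" "fvS p \<subseteq> {..<c}"
        using that F(1) c(2) by (auto simp: fresh_def fv_below_iff)
      then show ?thesis unfolding inst2_def subst_subst
        by (intro subst_cong) (auto split: nat.split)
    qed
    have "subst ?\<sigma> ?\<rho> ` G \<subseteq> limit"
    proof (rule image_subsetI)
      fix p assume "p \<in> G"
      then consider "p \<in> \<Gamma>" | q where "q \<in> F" "p = inst2 c q" using F(3) by blast
      then show "subst ?\<sigma> ?\<rho> p \<in> limit"
        by cases (use 1 2 c(1) tX in auto)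
    qed
    then have "limit \<turnstile> Fls" using prv_subst[OF G(3), of ?\<sigma> ?\<rho>] prv_mono by auto
    then show False using con_limit con_def by blast
  qed
  with c(3) show ?thesis by blast
qed

subsection \<open>The term model\<close>

lemma inst_tlift [simp]: "tsubst (case_nat t Var) (tlift u) = u"
  by (simp add: tlift_def tsubst_tsubst)

lemma limit_refl: "Eq t t \<in> limit"
  by (simp add: limit_iff Refl)

lemma limit_Leibniz: "Eq t u \<in> limit \<Longrightarrow> inst t p \<in> limit \<Longrightarrow> inst u p \<in> limit"
  unfolding limit_iff by (rule Leibniz)

lemma limit_sym: "Eq t u \<in> limit \<Longrightarrow> Eq u t \<in> limit"
  using limit_Leibniz[of t u "Eq (Var 0) (tlift t)"] by (simp add: inst_def limit_refl)

lemma limit_trans: "Eq t u \<in> limit \<Longrightarrow> Eq u v \<in> limit \<Longrightarrow> Eq t v \<in> limit"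
  using limit_Leibniz[of u v "Eq (tlift t) (Var 0)"] by (simp add: inst_def)

text \<open>A class of provably equal terms is represented by the least number of a term in it,
  because the term model has to live on the natural numbers.\<close>

definition rep :: "tm \<Rightarrow> nat" where
  "rep t = (LEAST n. \<exists>u. n = to_nat u \<and> Eq t u \<in> limit)"

lemma rep_eq: "rep t = rep u \<longleftrightarrow> Eq t u \<in> limit"
proof
  assume r: "rep t = rep u"
  have ex: "\<exists>v. rep t = to_nat v \<and> Eq t v \<in> limit" for t
    unfolding rep_def by (rule LeastI_ex) (use limit_refl in blast)
  from ex[of t] ex[of u] r obtain v w where "rep t = to_nat v" "Eq t v \<in> limit" "rep u = to_nat w" "Eq u w \<in> limit"
    by blast
  with r show "Eq t u \<in> limit" by (metis from_nat_to_nat limit_sym limit_trans)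
next
  assume "Eq t u \<in> limit"
  then have "Eq t v \<in> limit \<longleftrightarrow> Eq u v \<in> limit" for v using limit_sym limit_trans by blast
  then show "rep t = rep u" by (simp add: rep_def)
qed

definition unrep :: "nat \<Rightarrow> tm" where "unrep a = (SOME t. rep t = a)"

lemma unrep: "Eq (unrep (rep t)) t \<in> limit"
  unfolding rep_eq[symmetric] unrep_def by (rule someI) simp

definition setof :: "nat \<Rightarrow> nat set" where "setof X = {rep t |t. Mem t X \<in> limit}"

definition model :: "nat L2_struct" where
  "model = \<lparr>num_dom = range rep, zeroM = rep Zero, oneM = rep One,
     addM = (\<lambda>a b. rep (Add (unrep a) (unrep b))), mulM = (\<lambda>a b. rep (Mul (unrep a) (unrep b))),
     lessM = (\<lambda>a b. Less (unrep a) (unrep b) \<in> limit), set_dom = range setof\<rparr>"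

lemma rep_Mem: "rep t \<in> setof X \<longleftrightarrow> Mem t X \<in> limit"
proof -
  have "Mem u X \<in> limit \<Longrightarrow> rep t = rep u \<Longrightarrow> Mem t X \<in> limit" for u
    using limit_Leibniz[of u t "Mem (Var 0) X"] by (simp add: inst_def rep_eq limit_sym)
  then show ?thesis unfolding setof_def by blast
qed

lemma cong2:
  assumes "\<And>t u. inst t (p u) = q t u" "\<And>t u. inst u (p' t) = q t u"
    and "Eq t t' \<in> limit" "Eq u u' \<in> limit" "q t u \<in> limit"
  shows "q t' u' \<in> limit"
  using limit_Leibniz[OF assms(3), of "p u"] limit_Leibniz[OF assms(4), of "p' t'"] assms by simp

lemma model_Less: "lessM model (rep t) (rep u) \<longleftrightarrow> Less t u \<in> limit"
  unfolding model_def
  using cong2[of "\<lambda>u. Less (Var 0) (tlift u)" "\<lambda>t u. Less t u" "\<lambda>t. Less (tlift t) (Var 0)"]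
    unrep limit_sym by (simp add: inst_def) blast

lemma rep_Add: "rep t = rep t' \<Longrightarrow> rep u = rep u' \<Longrightarrow> rep (Add t u) = rep (Add t' u')"
  unfolding rep_eq
  using limit_Leibniz[of t t' "Eq (Add (tlift t) (tlift u)) (Add (Var 0) (tlift u))"]
    limit_Leibniz[of u u' "Eq (Add (tlift t) (tlift u)) (Add (tlift t') (Var 0))"]
  by (simp add: inst_def limit_refl)

lemma rep_Mul: "rep t = rep t' \<Longrightarrow> rep u = rep u' \<Longrightarrow> rep (Mul t u) = rep (Mul t' u')"
  unfolding rep_eq
  using limit_Leibniz[of t t' "Eq (Mul (tlift t) (tlift u)) (Mul (Var 0) (tlift u))"]
    limit_Leibniz[of u u' "Eq (Mul (tlift t) (tlift u)) (Mul (tlift t') (Var 0))"]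
  by (simp add: inst_def limit_refl)

lemma rep_unrep: "rep (unrep (rep t)) = rep t"
  using unrep rep_eq by blast

lemma tval_model: "tval model (\<lambda>i. rep (Var i)) t = rep t"
proof (induction t)
  case (Add t u)
  then show ?case using rep_Add[OF rep_unrep rep_unrep] by (simp add: model_def)
next
  case (Mul t u)
  then show ?case using rep_Mul[OF rep_unrep rep_unrep] by (simp add: model_def)
qed (auto simp: model_def)

text \<open>\<open>inst t q\<close> is no subformula of \<open>All q\<close>, so the truth lemma
  goes by a measure that substitution leaves unchanged.\<close>

primrec depth :: "fm \<Rightarrow> nat" where
  "depth Fls = 0" | "depth (Eq t u) = 0" | "depth (Less t u) = 0" | "depth (Mem t X) = 0"
| "depth (Imp p q) = Suc (depth p + depth q)" | "depth (All p) = Suc (depth p)" | "depth (AllS p) = Suc (depth p)"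

lemma depth_subst [simp]: "depth (subst \<sigma> \<rho> p) = depth p"
  by (induction p arbitrary: \<sigma> \<rho>) auto

lemma sat_model: "sat model (\<lambda>i. rep (Var i)) setof p \<longleftrightarrow> p \<in> limit"
proof (induction p rule: measure_induct_rule[of depth])
  case (less p)
  have dom: "num_dom model = range rep" "set_dom model = range setof" by (simp_all add: model_def)
  show ?case
  proof (cases p)
    case (All q)
    have "sat model (case_nat (rep t) (\<lambda>i. rep (Var i))) setof q \<longleftrightarrow> inst t q \<in> limit" for t
      using less[of "inst t q"] All by (simp add: tval_model) (simp add: inst_def)
    then show ?thesis by (simp add: All limit_All dom)
  next
    case (AllS q)
    have "sat model (\<lambda>i. rep (Var i)) (case_nat (setof X) setof) q \<longleftrightarrow> instS X q \<in> limit" for X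
      using less[of "instS X q"] AllS by simp (simp add: instS_def)
    then show ?thesis by (simp add: AllS limit_AllS dom)
  qed (use less in \<open>auto simp: limit_Fls limit_Imp tval_model rep_eq model_Less rep_Mem\<close>)
qed

lemma L2_structure_model: "L2_structure model"
  by (auto simp: L2_structure_def model_def setof_def)

end

text \<open>A parameter in the term model is given by a term or a set variable. A type with
  parameters is thus determined by a recursive set and two finite lists, which leaves only countably
  many.\<close>

definition type_inst :: "tm list \<Rightarrow> nat list \<Rightarrow> fm \<Rightarrow> fm" where
  "type_inst L R = subst (case_nat (Var 0) (\<lambda>i. if i < length L then tlift (L ! i) else Zero))
     (\<lambda>i. if i < length R then Suc (R ! i) else 0)"

definition recursive_types :: "fm set set" where
  "recursive_types = (\<lambda>(A, L, R). type_inst L R ` {p. code p \<in> A \<and> fv_below (Suc (length L)) (length R) p}) `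
     ({A. recursive_set A} \<times> UNIV \<times> UNIV)"

text \<open>The term model of the limit does it. Its elements and sets all have names, so finite
  satisfiability of a type in the model is the membership of instances in the limit that
  \<open>type_realized\<close> asks for.\<close>

theorem model_existence:
  assumes "con \<Delta>" "\<forall>p\<in>\<Delta>. fvN p \<subseteq> Collect even \<and> fvS p \<subseteq> Collect even"
  shows "\<exists>(M :: nat L2_struct) e s. L2_structure M \<and> recursively_saturated M \<and> env M e \<and> senv M s \<and>
    (\<forall>p\<in>\<Delta>. sat M e s p)"
proof -
  let ?F = "range (\<lambda>p. {p}) \<union> recursive_types"
  interpret henkin \<Delta> ?F
  proof
    show "countable ?F"
      unfolding recursive_types_def
      by (intro countable_Un countable_image countable_SIGMA countable_recursive_sets) auto
  next
    fix P assume "P \<in> ?F"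
    then consider p where "P = {p}" |
      A L R where "P = type_inst L R ` {p. code p \<in> A \<and> fv_below (Suc (length L)) (length R) p}"
      unfolding recursive_types_def by auto
    then show "\<exists>N. \<forall>p\<in>P. fv_below N N p"
    proof cases
      case 1
      then show ?thesis using ex_fv_below by auto
    next
      case 2
      let ?\<sigma> = "case_nat (Var 0) (\<lambda>i. if i < length L then tlift (L ! i) else Zero)"
      let ?\<rho> = "\<lambda>i. if i < length R then Suc (R ! i) else 0"
      have "finite (fvt t)" for t by (induction t) auto
      then have "finite ((\<Union>i<Suc (length L). fvt (?\<sigma> i)) \<union> ?\<rho> ` {..<length R})" by auto
      then obtain N where "(\<Union>i<Suc (length L). fvt (?\<sigma> i)) \<union> ?\<rho> ` {..<length R} \<subseteq> {..<N}"
        unfolding finite_nat_iff_bounded by (rule exE)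
      then show ?thesis unfolding 2 fv_below_iff type_inst_def ball_simps
        by (intro exI[of _ N]) (auto simp: fv_subst simp del: lessThan_Suc; blast)
    qed
  qed (use assms in auto)
  have sat_model': "sat model (\<lambda>i. rep (Var i)) setof p \<longleftrightarrow> p \<in> limit" for p by (rule sat_model)
  have "recursively_saturated model"
    unfolding recursively_saturated_def
  proof (intro allI impI)
    fix k m p e s
    assume p: "\<forall>\<phi>\<in>p. arithmetical \<phi> \<and> fv_below (Suc k) m \<phi>" "recursive_set (code ` p)"
      and e: "\<forall>i<k. e i \<in> num_dom model" and s: "\<forall>i<m. s i \<in> set_dom model"
      and sat: "\<forall>F. finite F \<and> F \<subseteq> p \<longrightarrow> (\<exists>a\<in>num_dom model. \<forall>\<phi>\<in>F. sat model (case_nat a e) s \<phi>)"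
    have "\<forall>i<k. \<exists>t. e i = rep t" "\<forall>i<m. \<exists>X. s i = setof X"
      using e s by (simp_all add: model_def image_iff)
    then obtain f g where f: "\<forall>i<k. e i = rep (f i)" and g: "\<forall>i<m. s i = setof (g i)" by metis
    let ?L = "map f [0..<k]" and ?R = "map g [0..<m]"
    let ?P = "type_inst ?L ?R ` {q. code q \<in> code ` p \<and> fv_below (Suc (length ?L)) (length ?R) q}"
    \<comment> \<open>Since \<open>code\<close> is injective, the set of codes determines the
      type.\<close>
    have "{q. code q \<in> code ` p \<and> fv_below (Suc (length ?L)) (length ?R) q} = p"
      using p(1) by (auto dest: inj_code)
    then have P: "?P = type_inst ?L ?R ` p" by simp
    have "?P \<in> recursive_types" unfolding recursive_types_def
      by (rule image_eqI[of _ _ "(code ` p, ?L, ?R)"]) (use p(2) in auto)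
    then have PF: "type_inst ?L ?R ` p \<in> ?F" using P by auto
    have key: "subst (case_nat t Var) (case_nat X (\<lambda>i. i)) (type_inst ?L ?R \<phi>) \<in> limit
        \<longleftrightarrow> sat model (case_nat (rep t) e) s \<phi>" if "\<phi> \<in> p" for t X \<phi>
    proof -
      have fv: "fvN \<phi> \<subseteq> {..<Suc k}" "fvS \<phi> \<subseteq> {..<m}" using p(1) that by (auto simp: fv_below_iff)
      with f g show ?thesis
        unfolding sat_model'[symmetric] type_inst_def subst_subst
        by (subst sat_subst, intro sat_cong) (auto simp: tval_model split: nat.split)
    qed
    have "\<exists>c. inst2 c ` type_inst ?L ?R ` p \<subseteq> limit"
    proof (rule type_realized[OF PF])
      fix F assume "finite F" "F \<subseteq> type_inst ?L ?R ` p"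
      then obtain G where G: "finite G" "G \<subseteq> p" "F = type_inst ?L ?R ` G" by (meson finite_subset_image)
      then obtain a where "a \<in> num_dom model" "\<forall>\<phi>\<in>G. sat model (case_nat a e) s \<phi>" using sat by blast
      then obtain t where "\<forall>\<phi>\<in>G. sat model (case_nat (rep t) e) s \<phi>" by (auto simp: model_def)
      then have "subst (case_nat t Var) (case_nat 0 (\<lambda>i. i)) ` F \<subseteq> limit" using key G by auto
      then show "\<exists>t X. subst (case_nat t Var) (case_nat X (\<lambda>i. i)) ` F \<subseteq> limit" by blast
    qed
    then obtain c where "inst2 c ` type_inst ?L ?R ` p \<subseteq> limit" by blast
    then have "\<forall>\<phi>\<in>p. sat model (case_nat (rep (Var c)) e) s \<phi>"
      unfolding inst2_def using key[of _ "Var c" c] by blast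
    moreover have "rep (Var c) \<in> num_dom model" by (simp add: model_def)
    ultimately show "\<exists>a\<in>num_dom model. \<forall>\<phi>\<in>p. sat model (case_nat a e) s \<phi>" by blast
  qed
  moreover have "env model (\<lambda>i. rep (Var i))" "senv model setof"
    by (auto simp: env_def senv_def model_def)
  moreover have "\<Delta> \<subseteq> limit" using stage_subset_limit[of 0] by simp
  ultimately show ?thesis using L2_structure_model sat_model by blast
qed

section \<open>Definability up to equivalence\<close>

text \<open>The hierarchy is defined by a mutual induction over all levels; here the level is fixed
  and only the leading block of quantifiers grows.\<close>

lemma Sigma_Suc_induct [consumes 1, case_names Pi ExN]:
  assumes "is_Sigma (Suc k) p" "\<And>p. is_Pi k p \<Longrightarrow> P p"
    "\<And>p. is_Sigma (Suc k) p \<Longrightarrow> P p \<Longrightarrow> P (ExN p)"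
  shows "P p"
proof -
  have "is_Sigma n p \<Longrightarrow> n = Suc k \<longrightarrow> P p" "is_Pi m q \<Longrightarrow> True" for n m q
    by (induction rule: is_Sigma_is_Pi.inducts) (use assms(2,3) in auto)
  with assms(1) show ?thesis by blast
qed

lemma Pi_Suc_induct [consumes 1, case_names Sigma All]:
  assumes "is_Pi (Suc k) p" "\<And>p. is_Sigma k p \<Longrightarrow> P p"
    "\<And>p. is_Pi (Suc k) p \<Longrightarrow> P p \<Longrightarrow> P (All p)"
  shows "P p"
proof -
  have "is_Sigma m q \<Longrightarrow> True" "is_Pi n p \<Longrightarrow> n = Suc k \<longrightarrow> P p" for n m q
    by (induction rule: is_Sigma_is_Pi.inducts) (use assms(2,3) in auto)
  with assms(1) show ?thesis by blast
qed

lemma is_Sigma_0: "is_Sigma 0 p \<longleftrightarrow> is_Delta0 p" and is_Pi_0: "is_Pi 0 p \<longleftrightarrow> is_Delta0 p"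
  by (auto intro: is_Sigma_is_Pi.intros elim: is_Sigma.cases is_Pi.cases)

lemma is_Sigma_Suc: "is_Sigma k p \<Longrightarrow> is_Sigma (Suc k) p"
  and is_Pi_Suc: "is_Pi k p \<Longrightarrow> is_Pi (Suc k) p"
  by (induction rule: is_Sigma_is_Pi.inducts) (auto intro: is_Sigma_is_Pi.intros)

lemma is_Sigma_mono: "is_Sigma k p \<Longrightarrow> k \<le> n \<Longrightarrow> is_Sigma n p"
  by (rule dec_induct[of k n "\<lambda>n. is_Sigma n p"]) (auto intro: is_Sigma_Suc)

lemma is_Pi_mono: "is_Pi k p \<Longrightarrow> k \<le> n \<Longrightarrow> is_Pi n p"
  by (rule dec_induct[of k n "\<lambda>n. is_Pi n p"]) (auto intro: is_Pi_Suc)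

lemma is_Delta0_connectives:
  "is_Delta0 p \<Longrightarrow> is_Delta0 (Neg p)"
  "is_Delta0 p \<Longrightarrow> is_Delta0 q \<Longrightarrow> is_Delta0 (Conj p q)"
  "is_Delta0 p \<Longrightarrow> is_Delta0 q \<Longrightarrow> is_Delta0 (Disj p q)"
  "is_Delta0 p \<Longrightarrow> is_Delta0 (BEx t p)"
  by (auto simp: Neg_def Conj_def Disj_def BEx_def intro!: is_Delta0.intros)

lemma subst_BAll: "subst \<sigma> \<rho> (BAll t p) = BAll (tsubst \<sigma> t) (subst (up \<sigma>) \<rho> p)"
  by (simp add: BAll_def)

lemma subst_ExN: "subst \<sigma> \<rho> (ExN p) = ExN (subst (up \<sigma>) \<rho> p)"
  by (simp add: ExN_def)

lemma is_Delta0_subst: "is_Delta0 p \<Longrightarrow> is_Delta0 (subst \<sigma> \<rho> p)"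
proof (induction arbitrary: \<sigma> rule: is_Delta0.induct)
  case (6 p t)
  then show ?case by (simp only: subst_BAll is_Delta0.intros)
qed (auto intro: is_Delta0.intros)

lemma is_Sigma_subst: "is_Sigma k p \<Longrightarrow> is_Sigma k (subst \<sigma> \<rho> p)"
  and is_Pi_subst: "is_Pi k p \<Longrightarrow> is_Pi k (subst \<sigma> \<rho> p)"
proof (induction arbitrary: \<sigma> and \<sigma> rule: is_Sigma_is_Pi.inducts)
  case (4 n p)
  then show ?case by (simp only: subst_ExN is_Sigma_is_Pi.intros)
qed (auto intro: is_Sigma_is_Pi.intros is_Delta0_subst)

lemma arithmetical_Neg [simp]: "arithmetical (Neg p) = arithmetical p"
  by (simp add: Neg_def)

lemma arithmetical_ExN [simp]: "arithmetical (ExN p) = arithmetical p"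
  by (simp add: ExN_def)

lemma arithmetical_BAll [simp]: "arithmetical (BAll t p) = arithmetical p"
  by (simp add: BAll_def)

lemma arithmetical_BEx [simp]: "arithmetical (BEx t p) = arithmetical p"
  by (simp add: BEx_def)

lemma arithmetical_subst [simp]: "arithmetical (subst \<sigma> \<rho> p) = arithmetical p"
  by (induction p arbitrary: \<sigma> \<rho>) auto

lemma arithmetical_Delta0: "is_Delta0 p \<Longrightarrow> arithmetical p"
  by (induction rule: is_Delta0.induct) auto

lemma arithmetical_Sigma: "is_Sigma k p \<Longrightarrow> arithmetical p"
  and arithmetical_Pi: "is_Pi k p \<Longrightarrow> arithmetical p"
  by (induction rule: is_Sigma_is_Pi.inducts) (auto intro: arithmetical_Delta0)

lemma sat_set_dom: "arithmetical p \<Longrightarrow> sat (M\<lparr>set_dom := S\<rparr>) e s p = sat M e s p"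
proof (induction p arbitrary: e)
  have t: "tval (M\<lparr>set_dom := S\<rparr>) e t = tval M e t" for e t by (induction t) auto
  case (Eq t u) then show ?case by (simp add: t)
next
  have t: "tval (M\<lparr>set_dom := S\<rparr>) e t = tval M e t" for e t by (induction t) auto
  case (Less t u) then show ?case by (simp add: t)
next
  have t: "tval (M\<lparr>set_dom := S\<rparr>) e t = tval M e t" for e t by (induction t) auto
  case (Mem t u) then show ?case by (simp add: t)
qed auto

text \<open>Equivalence is relative to a class \<open>C\<close>, because quantifiers can be
  rearranged only in models of enough induction. One formula has to serve all of \<open>C\<close>,
  because truth in different members of \<open>C\<close>, two models or a whole chain, is compared
  through it.\<close>

definition eqv :: "'a L2_struct set \<Rightarrow> fm \<Rightarrow> fm \<Rightarrow> bool" where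
  "eqv C p q \<longleftrightarrow> (\<forall>M\<in>C. L2_structure M \<longrightarrow> (\<forall>e s. env M e \<longrightarrow> senv M s \<longrightarrow> sat M e s p = sat M e s q))"

definition isS :: "'a L2_struct set \<Rightarrow> nat \<Rightarrow> fm \<Rightarrow> bool" where
  "isS C k p \<longleftrightarrow> (\<exists>q. is_Sigma k q \<and> eqv C p q)"

definition isP :: "'a L2_struct set \<Rightarrow> nat \<Rightarrow> fm \<Rightarrow> bool" where
  "isP C k p \<longleftrightarrow> (\<exists>q. is_Pi k q \<and> eqv C p q)"

lemma eqv_refl: "eqv C p p" by (simp add: eqv_def)
lemma eqv_trans: "eqv C p q \<Longrightarrow> eqv C q r \<Longrightarrow> eqv C p r" by (simp add: eqv_def)

lemma isS_eqv: "isS C k q \<Longrightarrow> eqv C p q \<Longrightarrow> isS C k p" unfolding isS_def using eqv_trans by blast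
lemma isP_eqv: "isP C k q \<Longrightarrow> eqv C p q \<Longrightarrow> isP C k p" unfolding isP_def using eqv_trans by blast

lemma isS_Sigma: "is_Sigma k p \<Longrightarrow> isS C k p" unfolding isS_def using eqv_refl by blast
lemma isP_Pi: "is_Pi k p \<Longrightarrow> isP C k p" unfolding isP_def using eqv_refl by blast

lemma isP_Suc_isS: "isS C k p \<Longrightarrow> isP C (Suc k) p"
  unfolding isS_def isP_def using is_Sigma_is_Pi.intros by blast
lemma isS_Suc_isP: "isP C k p \<Longrightarrow> isS C (Suc k) p"
  unfolding isS_def isP_def using is_Sigma_is_Pi.intros by blast
lemma isS_mono: "isS C k p \<Longrightarrow> k \<le> n \<Longrightarrow> isS C n p"
  unfolding isS_def using is_Sigma_mono by blast
lemma isP_mono: "isP C k p \<Longrightarrow> k \<le> n \<Longrightarrow> isP C n p"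
  unfolding isP_def using is_Pi_mono by blast

lemma isS_Delta0: "is_Delta0 p \<Longrightarrow> isS C k p"
  by (rule isS_mono[of C 0]) (auto intro: isS_Sigma is_Sigma_is_Pi.intros)
lemma isP_Delta0: "is_Delta0 p \<Longrightarrow> isP C k p"
  by (rule isP_mono[of C 0]) (auto intro: isP_Pi is_Sigma_is_Pi.intros)

lemma isS_ExN: "isS C (Suc k) p \<Longrightarrow> isS C (Suc k) (ExN p)"
proof -
  assume "isS C (Suc k) p"
  then obtain q where "is_Sigma (Suc k) q" "eqv C p q" unfolding isS_def by blast
  then have "is_Sigma (Suc k) (ExN q)" "eqv C (ExN p) (ExN q)"
    by (auto intro: is_Sigma_is_Pi.intros simp: eqv_def)
  then show ?thesis unfolding isS_def by blast
qed

lemma isP_All: "isP C (Suc k) p \<Longrightarrow> isP C (Suc k) (All p)"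
proof -
  assume "isP C (Suc k) p"
  then obtain q where "is_Pi (Suc k) q" "eqv C p q" unfolding isP_def by blast
  then have "is_Pi (Suc k) (All q)" "eqv C (All p) (All q)"
    by (auto intro: is_Sigma_is_Pi.intros simp: eqv_def)
  then show ?thesis unfolding isP_def by blast
qed

lemma isP_Neg_Sigma: "is_Sigma k p \<Longrightarrow> isP C k (Neg p)"
  and isS_Neg_Pi: "is_Pi k p \<Longrightarrow> isS C k (Neg p)"
proof (induction rule: is_Sigma_is_Pi.inducts)
  case (4 n p)
  then have "isP C (Suc n) (All (Neg p))" by (intro isP_All)
  then show ?case by (rule isP_eqv) (auto simp: eqv_def)
next
  case (6 n p)
  then have "isS C (Suc n) (ExN (Neg p))" by (intro isS_ExN)
  then show ?case by (rule isS_eqv) (auto simp: eqv_def)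
qed (auto intro: isS_Delta0 isP_Delta0 is_Delta0_connectives isS_Suc_isP isP_Suc_isS)

lemma isP_Neg: "isS C k p \<Longrightarrow> isP C k (Neg p)"
proof -
  assume "isS C k p"
  then obtain q where "is_Sigma k q" "eqv C p q" unfolding isS_def by blast
  then show ?thesis using isP_Neg_Sigma[of k q C] by (auto elim!: isP_eqv simp: eqv_def)
qed

lemma isS_Neg: "isP C k p \<Longrightarrow> isS C k (Neg p)"
proof -
  assume "isP C k p"
  then obtain q where "is_Pi k q" "eqv C p q" unfolding isP_def by blast
  then show ?thesis using isS_Neg_Pi[of k q C] by (auto elim!: isS_eqv simp: eqv_def)
qed

lemma L2_nonempty: "L2_structure M \<Longrightarrow> \<exists>a. a \<in> num_dom M"
  by (auto simp: L2_structure_def)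

lemma is_Sigma_lift: "is_Sigma k p \<Longrightarrow> is_Sigma k (lift p)" and is_Pi_lift: "is_Pi k p \<Longrightarrow> is_Pi k (lift p)"
  by (simp_all add: lift_def is_Sigma_subst is_Pi_subst)

text \<open>The quantifiers are pulled out one at a time, first from the left formula while the
  right one is Pi_k, then from the right one. The Pi_k case comes from the induction hypothesis by
  negation.\<close>

lemma isS_Conj_Disj_Sigma:
  "is_Sigma k p \<Longrightarrow> is_Sigma k q \<Longrightarrow> isS C k (Conj p q) \<and> isS C k (Disj p q)"
proof (induction k arbitrary: p q)
  case 0
  then show ?case by (simp add: is_Sigma_0 isS_Delta0 is_Delta0_connectives)
next
  case (Suc k)
  have pi: "isP C k (Conj p q)" "isP C k (Disj p q)" if pq: "is_Pi k p" "is_Pi k q" for p q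
  proof -
    obtain p' q' where *: "is_Sigma k p'" "eqv C (Neg p) p'" "is_Sigma k q'" "eqv C (Neg q) q'"
      using isS_Neg_Pi[OF pq(1)] isS_Neg_Pi[OF pq(2)] unfolding isS_def by metis
    then have n: "isP C k (Neg (Disj p' q'))" "isP C k (Neg (Conj p' q'))"
      using Suc.IH isP_Neg by blast+
    show "isP C k (Conj p q)"
      by (rule isP_eqv[OF n(1)]) (use *(2,4) in \<open>simp add: eqv_def; blast\<close>)
    show "isP C k (Disj p q)"
      by (rule isP_eqv[OF n(2)]) (use *(2,4) in \<open>simp add: eqv_def; blast\<close>)
  qed
  have *: "isS C (Suc k) (Conj p q) \<and> isS C (Suc k) (Disj p q)"
    if "is_Sigma (Suc k) p" "is_Pi k q" for p q
    using that
  proof (induction arbitrary: q rule: Sigma_Suc_induct)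
    case (Pi p)
    then show ?case using pi isS_Suc_isP by blast
  next
    case (ExN p)
    have "isS C (Suc k) (ExN (Conj p (lift q)))" "isS C (Suc k) (ExN (Disj p (lift q)))"
      using ExN.IH[OF is_Pi_lift[OF ExN.prems]] isS_ExN by blast+
    \<comment> \<open>Pulling a quantifier out of a disjunction needs a nonempty domain.\<close>
    then show ?case
      by (intro conjI; elim isS_eqv) (use L2_nonempty in \<open>fastforce simp: eqv_def\<close>)+
  qed
  from Suc.prems(2) Suc.prems(1) show ?case
  proof (induction arbitrary: p rule: Sigma_Suc_induct)
    case (Pi q)
    then show ?case using * by blast
  next
    case (ExN q)
    have "isS C (Suc k) (ExN (Conj (lift p) q))" "isS C (Suc k) (ExN (Disj (lift p) q))"
      using ExN.IH[OF is_Sigma_lift[OF ExN.prems]] isS_ExN by blast+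
    then show ?case
      by (intro conjI; elim isS_eqv) (use L2_nonempty in \<open>fastforce simp: eqv_def\<close>)+
  qed
qed

lemma isS_Conj: "isS C k p \<Longrightarrow> isS C k q \<Longrightarrow> isS C k (Conj p q)"
proof -
  assume "isS C k p" "isS C k q"
  then obtain p' q' where *: "is_Sigma k p'" "eqv C p p'" "is_Sigma k q'" "eqv C q q'"
    unfolding isS_def by metis
  then have "isS C k (Conj p' q')" using isS_Conj_Disj_Sigma by blast
  then show ?thesis by (rule isS_eqv) (use *(2,4) in \<open>simp add: eqv_def\<close>)
qed

lemma isS_Disj: "isS C k p \<Longrightarrow> isS C k q \<Longrightarrow> isS C k (Disj p q)"
proof -
  assume "isS C k p" "isS C k q"
  then obtain p' q' where *: "is_Sigma k p'" "eqv C p p'" "is_Sigma k q'" "eqv C q q'"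
    unfolding isS_def by metis
  then have "isS C k (Disj p' q')" using isS_Conj_Disj_Sigma by blast
  then show ?thesis by (rule isS_eqv) (use *(2,4) in \<open>simp add: eqv_def\<close>)
qed

lemma isS_Imp: "isP C k p \<Longrightarrow> isS C k q \<Longrightarrow> isS C k (Imp p q)"
  by (rule isS_eqv[OF isS_Disj[OF isS_Neg]]) (auto simp: eqv_def)

lemma isP_Conj: "isP C k p \<Longrightarrow> isP C k q \<Longrightarrow> isP C k (Conj p q)"
  by (rule isP_eqv[of _ _ "Neg (Disj (Neg p) (Neg q))"]) (auto simp: eqv_def intro: isP_Neg isS_Disj isS_Neg)

lemma isP_Disj: "isP C k p \<Longrightarrow> isP C k q \<Longrightarrow> isP C k (Disj p q)"
  by (rule isP_eqv[of _ _ "Neg (Conj (Neg p) (Neg q))"]) (auto simp: eqv_def intro: isP_Neg isS_Conj isS_Neg)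

lemma isP_Imp: "isS C k p \<Longrightarrow> isP C k q \<Longrightarrow> isP C k (Imp p q)"
  by (rule isP_eqv[of _ _ "Disj (Neg p) q"]) (auto simp: eqv_def intro: isP_Neg isP_Disj)

text \<open>Above level 0 the bounded quantifier just joins the leading universal block. In front of
  a Sigma formula it needs collection and has to wait for \<open>isS_BAll\<close>.\<close>

lemma isP_BAll: "isP C k p \<Longrightarrow> isP C k (BAll t p)"
proof (cases k)
  case 0
  assume "isP C k p"
  then obtain q where "is_Delta0 q" "eqv C p q" unfolding isP_def 0 is_Pi_0 by blast
  then have "is_Delta0 (BAll t q)" "eqv C (BAll t p) (BAll t q)"
    by (auto intro: is_Delta0.intros simp: eqv_def)
  then show ?thesis unfolding isP_def 0 is_Pi_0 by blast
next
  case (Suc n)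
  assume "isP C k p"
  then show ?thesis unfolding BAll_def Suc
    by (intro isP_All isP_Imp isS_Delta0 is_Delta0.intros)
qed

lemma isS_BEx: "isS C k p \<Longrightarrow> isS C k (BEx t p)"
  unfolding BEx_def by (intro isS_Neg isP_BAll isP_Neg)

lemma eqv_subst: "eqv C p q \<Longrightarrow> eqv C (subst \<sigma> \<rho> p) (subst \<sigma> \<rho> q)"
  using tval_dom by (fastforce simp: eqv_def sat_subst env_def senv_def)

lemma isS_subst: "isS C k p \<Longrightarrow> isS C k (subst \<sigma> \<rho> p)"
  unfolding isS_def using eqv_subst is_Sigma_subst by blast

lemma isP_subst: "isP C k p \<Longrightarrow> isP C k (subst \<sigma> \<rho> p)"
  unfolding isP_def using eqv_subst is_Pi_subst by blast

definition ren :: "(nat \<Rightarrow> nat) \<Rightarrow> fm \<Rightarrow> fm" where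
  "ren f = subst (\<lambda>i. Var (f i)) (\<lambda>i. i)"

lemma sat_ren [simp]: "sat M e s (ren f p) = sat M (e \<circ> f) s p"
  by (simp add: ren_def sat_subst comp_def)

lemma comp_case_nat [simp]: "g \<circ> case_nat a f = case_nat (g a) (g \<circ> f)"
  by (auto simp: fun_eq_iff split: nat.split)

lemma case_nat_comp_Suc [simp]:
  "case_nat a g \<circ> (\<lambda>i. Suc (f i)) = g \<circ> f" "case_nat a g \<circ> Suc = g" "g \<circ> (\<lambda>i. i) = g"
  by (auto simp: fun_eq_iff)

lemma isS_ren: "isS C k p \<Longrightarrow> isS C k (ren f p)" and isP_ren: "isP C k p \<Longrightarrow> isP C k (ren f p)"
  by (simp_all add: ren_def isS_subst isP_subst)

section \<open>Axioms and their closures\<close>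

lemma case_nat_shift:
  "(\<lambda>i. if i < k then f i else case_nat a e (i - k)) =
   (\<lambda>i. if i < Suc k then (f(k := a)) i else e (i - Suc k))"
proof
  fix i
  consider "i < k" | "i = k" | j where "i = Suc (k + j)"
    by (metis less_imp_Suc_add linorder_neqE_nat)
  then show "(if i < k then f i else case_nat a e (i - k)) =
      (if i < Suc k then (f(k := a)) i else e (i - Suc k))"
    by cases (auto simp: Suc_diff_le)
qed

lemma all_fun_Suc:
  "(\<forall>a\<in>A. \<forall>f. (\<forall>i<k. f i \<in> A) \<longrightarrow> Q (f(k := a))) \<longleftrightarrow> (\<forall>f. (\<forall>i<Suc k. f i \<in> A) \<longrightarrow> Q f)"
proof (intro iffI allI impI ballI)
  fix f assume "\<forall>a\<in>A. \<forall>f. (\<forall>i<k. f i \<in> A) \<longrightarrow> Q (f(k := a))" "\<forall>i<Suc k. f i \<in> A"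
  then have "Q (f(k := f k))" by (meson lessI less_SucI)
  then show "Q f" by simp
qed (auto simp: less_Suc_eq)

lemma sat_All_pow:
  "sat M e s ((All ^^ k) p) \<longleftrightarrow>
     (\<forall>f. (\<forall>i<k. f i \<in> num_dom M) \<longrightarrow> sat M (\<lambda>i. if i < k then f i else e (i - k)) s p)"
proof (induction k arbitrary: e)
  case (Suc k)
  show ?case
    unfolding all_fun_Suc[where Q = "\<lambda>f. sat M (\<lambda>i. if i < Suc k then f i else e (i - Suc k)) s p", symmetric]
      case_nat_shift[symmetric] by (simp add: Suc)
qed simp

lemma sat_AllS_pow:
  "sat M e s ((AllS ^^ k) p) \<longleftrightarrow>
     (\<forall>f. (\<forall>i<k. f i \<in> set_dom M) \<longrightarrow> sat M e (\<lambda>i. if i < k then f i else s (i - k)) p)"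
proof (induction k arbitrary: s)
  case (Suc k)
  show ?case
    unfolding all_fun_Suc[where Q = "\<lambda>f. sat M e (\<lambda>i. if i < Suc k then f i else s (i - Suc k)) p", symmetric]
      case_nat_shift[symmetric] by (simp add: Suc)
qed simp

lemma fv_below_pow:
  "fv_below a b ((All ^^ k) p) = fv_below (a + k) b p"
  "fv_below a b ((AllS ^^ k) p) = fv_below a (b + k) p"
  by (induction k arbitrary: a b) auto

lemma sentence_cong: "sentence p \<Longrightarrow> sat M e s p = sat M e' s' p"
  by (rule sat_cong) (auto simp: sentence_def fv_below_iff)

text \<open>Reduces axioms to their open forms under all assignments. A nonempty set domain
  guarantees an assignment at which the closed form can be evaluated.\<close>

lemma models_closures:
  assumes "L2_structure M" "set_dom M \<noteq> {}"
  shows "models M (closures p) \<longleftrightarrow> (\<forall>e s. env M e \<longrightarrow> senv M s \<longrightarrow> sat M e s p)"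
proof
  assume m: "models M (closures p)"
  show "\<forall>e s. env M e \<longrightarrow> senv M s \<longrightarrow> sat M e s p"
  proof (intro allI impI)
    fix e s assume e: "env M e" "senv M s"
    obtain k where k: "fv_below k k p" using ex_fv_below by blast
    then have "(AllS ^^ k) ((All ^^ k) p) \<in> closures p"
      by (auto simp: closures_def sentence_def fv_below_pow)
    then have "sat M e s ((AllS ^^ k) ((All ^^ k) p))" using m unfolding models_def by blast
    then have "sat M (\<lambda>i. if i < k then e i else e (i - k)) (\<lambda>i. if i < k then s i else s (i - k)) p"
      unfolding sat_AllS_pow sat_All_pow using e by (auto simp: env_def senv_def)
    then show "sat M e s p"
      by (rule iffD1[OF sat_cong, rotated 2]) (use k in \<open>auto simp: fv_below_iff\<close>)
  qed
next
  assume *: "\<forall>e s. env M e \<longrightarrow> senv M s \<longrightarrow> sat M e s p"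
  obtain a A where a: "a \<in> num_dom M" "A \<in> set_dom M" using assms L2_nonempty by blast
  show "models M (closures p)"
    unfolding models_def
  proof (intro ballI allI)
    fix q e s assume "q \<in> closures p"
    then obtain k m where q: "sentence q" "q = (AllS ^^ m) ((All ^^ k) p)" unfolding closures_def by blast
    have "sat M (\<lambda>_. a) (\<lambda>_. A) q"
      unfolding q(2) sat_AllS_pow sat_All_pow using * a by (auto simp: env_def senv_def)
    then show "sat M e s q" using sentence_cong[OF q(1)] by blast
  qed
qed

lemma models_Un: "models M (A \<union> B) \<longleftrightarrow> models M A \<and> models M B"
  by (auto simp: models_def)

lemma models_Union: "models M (\<Union> F) \<longleftrightarrow> (\<forall>A\<in>F. models M A)"
  by (auto simp: models_def)

section \<open>Axiom schemes as properties of a structure\<close>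

definition induct_at :: "'a L2_struct \<Rightarrow> (nat \<Rightarrow> 'a) \<Rightarrow> (nat \<Rightarrow> 'a set) \<Rightarrow> fm \<Rightarrow> bool" where
  "induct_at M e s p \<longleftrightarrow> (sat M (case_nat (zeroM M) e) s p \<longrightarrow>
     (\<forall>x\<in>num_dom M. sat M (case_nat x e) s p \<longrightarrow> sat M (case_nat (addM M x (oneM M)) e) s p) \<longrightarrow>
     (\<forall>x\<in>num_dom M. sat M (case_nat x e) s p))"

lemma sat_induction_ax: "sat M e s (induction_ax p) \<longleftrightarrow> induct_at M e s p"
proof -
  have "(\<lambda>i. tval M (case_nat a e) (case_nat (Add (Var 0) One) (\<lambda>i. Var (Suc i)) i))
      = case_nat (addM M a (oneM M)) e" for a
    by (auto simp: fun_eq_iff split: nat.split)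
  then show ?thesis by (auto simp: induction_ax_def induct_at_def sat_subst)
qed

lemma models_ISigma:
  assumes "L2_structure M" "set_dom M \<noteq> {}"
  shows "models M (ISigma n) \<longleftrightarrow> models M PA_minus \<and>
    (\<forall>p e s. is_Sigma n p \<longrightarrow> env M e \<longrightarrow> senv M s \<longrightarrow> induct_at M e s p)"
  unfolding ISigma_def models_Un models_Union using models_closures[OF assms] sat_induction_ax[of M]
  by auto

definition bound_at :: "'a L2_struct \<Rightarrow> (nat \<Rightarrow> 'a) \<Rightarrow> (nat \<Rightarrow> 'a set) \<Rightarrow> fm \<Rightarrow> bool" where
  "bound_at M e s p \<longleftrightarrow> (\<forall>a\<in>num_dom M.
     (\<forall>x\<in>num_dom M. lessM M x a \<longrightarrow> (\<exists>y\<in>num_dom M. sat M (case_nat y (case_nat x e)) s p)) \<longrightarrow>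
     (\<exists>b\<in>num_dom M. \<forall>x\<in>num_dom M. lessM M x a \<longrightarrow>
        (\<exists>y\<in>num_dom M. lessM M y b \<and> sat M (case_nat y (case_nat x e)) s p)))"

lemma sat_bounding_ax: "sat M e s (bounding_ax p) \<longleftrightarrow> bound_at M e s p"
proof -
  have "(\<lambda>i. case_nat y (case_nat x (case_nat a e)) (if i < 2 then i else i + 1)) = case_nat y (case_nat x e)" for y x a
    by (auto simp: fun_eq_iff numeral_2_eq_2 less_Suc_eq split: nat.split)
  moreover have "(\<lambda>i. case_nat y (case_nat x (case_nat b (case_nat a e))) (if i < 2 then i else i + 2)) = case_nat y (case_nat x e)" for y x a b
    by (auto simp: fun_eq_iff numeral_2_eq_2 less_Suc_eq split: nat.split)
  ultimately show ?thesis by (simp add: bounding_ax_def bound_at_def sat_subst)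
qed

lemma models_BSigma:
  assumes "L2_structure M" "set_dom M \<noteq> {}"
  shows "models M (BSigma n) \<longleftrightarrow> models M (ISigma 0) \<and>
    (\<forall>p e s. is_Sigma n p \<longrightarrow> env M e \<longrightarrow> senv M s \<longrightarrow> bound_at M e s p)"
  unfolding BSigma_def models_Un models_Union using models_closures[OF assms] sat_bounding_ax[of M]
  by auto

definition pam :: "'a L2_struct \<Rightarrow> bool" where
  "pam M \<longleftrightarrow> (\<forall>x\<in>num_dom M. \<forall>y\<in>num_dom M. \<forall>z\<in>num_dom M.
     addM M (addM M x y) z = addM M x (addM M y z) \<and>
     addM M x y = addM M y x \<and>
     mulM M (mulM M x y) z = mulM M x (mulM M y z) \<and>
     mulM M x y = mulM M y x \<and>
     mulM M x (addM M y z) = addM M (mulM M x y) (mulM M x z) \<and>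
     addM M x (zeroM M) = x \<and> mulM M x (zeroM M) = zeroM M \<and> mulM M x (oneM M) = x \<and>
     \<not> lessM M x x \<and>
     (lessM M x y \<longrightarrow> lessM M y z \<longrightarrow> lessM M x z) \<and>
     (lessM M x y \<or> x = y \<or> lessM M y x) \<and>
     (lessM M x y \<longrightarrow> lessM M (addM M x z) (addM M y z)) \<and>
     (lessM M (zeroM M) z \<longrightarrow> lessM M x y \<longrightarrow> lessM M (mulM M x z) (mulM M y z)) \<and>
     (lessM M x y \<longrightarrow> (\<exists>d\<in>num_dom M. addM M x d = y)) \<and>
     lessM M (zeroM M) (oneM M) \<and>
     (lessM M (zeroM M) x \<longrightarrow> lessM M (oneM M) x \<or> oneM M = x) \<and>
     (lessM M (zeroM M) x \<or> zeroM M = x))"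

lemma models_PA_minus:
  assumes "L2_structure M" "set_dom M \<noteq> {}"
  shows "models M PA_minus \<longleftrightarrow> pam M"
proof -
  obtain A where A: "A \<in> set_dom M" using assms(2) by blast
  let ?e = "\<lambda>x y z. case_nat x (case_nat y (\<lambda>_. z))"
  have cl: "models M (closures p) \<longleftrightarrow> (\<forall>x\<in>num_dom M. \<forall>y\<in>num_dom M. \<forall>z\<in>num_dom M. sat M (?e x y z) (\<lambda>_. A) p)"
    if p: "fv_below 3 0 p" for p
    unfolding models_closures[OF assms]
  proof
    assume L: "\<forall>e s. env M e \<longrightarrow> senv M s \<longrightarrow> sat M e s p"
    show "\<forall>x\<in>num_dom M. \<forall>y\<in>num_dom M. \<forall>z\<in>num_dom M. sat M (?e x y z) (\<lambda>_. A) p"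
    proof (intro ballI)
      fix x y z assume "x \<in> num_dom M" "y \<in> num_dom M" "z \<in> num_dom M"
      then have "env M (?e x y z)" by (auto simp: env_def split: nat.split)
      with L A show "sat M (?e x y z) (\<lambda>_. A) p" by (simp add: senv_def)
    qed
  next
    assume R: "\<forall>x\<in>num_dom M. \<forall>y\<in>num_dom M. \<forall>z\<in>num_dom M. sat M (?e x y z) (\<lambda>_. A) p"
    show "\<forall>e s. env M e \<longrightarrow> senv M s \<longrightarrow> sat M e s p"
    proof (intro allI impI)
      fix e s assume "env M e"
      then have "sat M (?e (e 0) (e 1) (e 2)) (\<lambda>_. A) p" using R by (simp add: env_def)
      moreover have "?e (e 0) (e 1) (e 2) i = e i" if "i < 3" for i
        using that by (auto simp: numeral_3_eq_3 numeral_2_eq_2 less_Suc_eq split: nat.split)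
      ultimately show "sat M e s p"
        by (subst sat_cong[of p e "?e (e 0) (e 1) (e 2)" s "\<lambda>_. A"]) (use p in \<open>auto simp: fv_below_iff\<close>)
    qed
  qed
  have fvb: "fv_below a b (Neg p) = fv_below a b p" "fv_below a b (Disj p q) = (fv_below a b p \<and> fv_below a b q)"
    "fv_below a b (ExN p) = fv_below (Suc a) b p" for a b p q
    by (simp_all add: Neg_def Disj_def ExN_def)
  show ?thesis
    unfolding PA_minus_def Let_def models_Union ball_simps image_insert image_empty pam_def
    by (simp add: cl fvb ball_conj_distrib L2_nonempty[OF assms(1)])
qed

section \<open>Arithmetic in discrete ordered semirings\<close>

locale pa =
  fixes M :: "'a L2_struct" (structure)
  assumes L2: "L2_structure M" and pam: "pam M"
begin

abbreviation D :: "'a set" where "D \<equiv> num_dom M"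
abbreviation plus (infixl "\<oplus>" 65) where "x \<oplus> y \<equiv> addM M x y"
abbreviation times (infixl "\<otimes>" 70) where "x \<otimes> y \<equiv> mulM M x y"
abbreviation less (infix "\<prec>" 50) where "x \<prec> y \<equiv> lessM M x y"
abbreviation zero ("\<zero>") where "\<zero> \<equiv> zeroM M"
abbreviation one ("\<one>") where "\<one> \<equiv> oneM M"

lemma closed [simp]: "\<zero> \<in> D" "\<one> \<in> D" "x \<in> D \<Longrightarrow> y \<in> D \<Longrightarrow> x \<oplus> y \<in> D" "x \<in> D \<Longrightarrow> y \<in> D \<Longrightarrow> x \<otimes> y \<in> D"
  using L2 by (auto simp: L2_structure_def)

lemma ax:
  assumes "x \<in> D" "y \<in> D" "z \<in> D"
  shows add_assoc: "x \<oplus> y \<oplus> z = x \<oplus> (y \<oplus> z)" and add_comm: "x \<oplus> y = y \<oplus> x"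
    and mul_assoc: "x \<otimes> y \<otimes> z = x \<otimes> (y \<otimes> z)" and mul_comm: "x \<otimes> y = y \<otimes> x"
    and distrib: "x \<otimes> (y \<oplus> z) = x \<otimes> y \<oplus> x \<otimes> z"
    and add_0: "x \<oplus> \<zero> = x" and mul_0: "x \<otimes> \<zero> = \<zero>" and mul_1: "x \<otimes> \<one> = x"
    and less_irrefl: "\<not> x \<prec> x" and less_trans: "x \<prec> y \<Longrightarrow> y \<prec> z \<Longrightarrow> x \<prec> z"
    and less_linear: "x \<prec> y \<or> x = y \<or> y \<prec> x"
    and add_less: "x \<prec> y \<Longrightarrow> x \<oplus> z \<prec> y \<oplus> z"
    and mul_less: "\<zero> \<prec> z \<Longrightarrow> x \<prec> y \<Longrightarrow> x \<otimes> z \<prec> y \<otimes> z"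
    and less_sub: "x \<prec> y \<Longrightarrow> \<exists>d\<in>D. x \<oplus> d = y"
    and zero_less_one: "\<zero> \<prec> \<one>" and discrete: "\<zero> \<prec> x \<Longrightarrow> \<one> \<prec> x \<or> \<one> = x"
    and pos: "\<zero> \<prec> x \<or> \<zero> = x"
  using pam assms unfolding pam_def by (meson)+

lemmas [simp] = ax(6,7,8)[OF _ closed(1) closed(1)] ax(9)[OF _ closed(1) closed(1)]

lemma zero_add [simp]: "x \<in> D \<Longrightarrow> \<zero> \<oplus> x = x"
  using add_comm[of "\<zero>" x "\<zero>"] by simp

lemma zero_mul [simp]: "x \<in> D \<Longrightarrow> \<zero> \<otimes> x = \<zero>"
  using mul_comm[of "\<zero>" x "\<zero>"] by simp

lemma one_mul [simp]: "x \<in> D \<Longrightarrow> \<one> \<otimes> x = x"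
  using mul_comm[of "\<one>" x "\<zero>"] by simp

lemma one_nonzero [simp]: "\<one> \<noteq> \<zero>"
  using zero_less_one[of "\<zero>" "\<zero>" "\<zero>"] less_irrefl[of "\<zero>" "\<zero>" "\<zero>"] by auto

lemma comm: "x \<in> D \<Longrightarrow> y \<in> D \<Longrightarrow> x \<oplus> y = y \<oplus> x" "x \<in> D \<Longrightarrow> y \<in> D \<Longrightarrow> x \<otimes> y = y \<otimes> x"
  using add_comm mul_comm by blast+

lemma left_comm: "x \<in> D \<Longrightarrow> y \<in> D \<Longrightarrow> z \<in> D \<Longrightarrow> x \<oplus> (y \<oplus> z) = y \<oplus> (x \<oplus> z)"
  "x \<in> D \<Longrightarrow> y \<in> D \<Longrightarrow> z \<in> D \<Longrightarrow> x \<otimes> (y \<otimes> z) = y \<otimes> (x \<otimes> z)"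
  by (metis add_assoc comm(1)) (metis mul_assoc comm(2))

lemma distrib': "x \<in> D \<Longrightarrow> y \<in> D \<Longrightarrow> z \<in> D \<Longrightarrow> (y \<oplus> z) \<otimes> x = y \<otimes> x \<oplus> z \<otimes> x"
  using distrib comm(2) by (metis closed(3))

lemmas ring = add_assoc mul_assoc comm left_comm distrib distrib'

lemma less_linear': "x \<in> D \<Longrightarrow> y \<in> D \<Longrightarrow> x \<noteq> y \<Longrightarrow> x \<prec> y \<or> y \<prec> x"
  using less_linear by blast

lemma less_asym: "x \<in> D \<Longrightarrow> y \<in> D \<Longrightarrow> x \<prec> y \<Longrightarrow> \<not> y \<prec> x"
  using less_trans less_irrefl by blast

lemma not_less_zero [simp]: "x \<in> D \<Longrightarrow> \<not> x \<prec> \<zero>"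
  using pos less_asym less_irrefl by (metis closed(1))

lemma zero_less: "x \<in> D \<Longrightarrow> \<zero> \<prec> x \<longleftrightarrow> x \<noteq> \<zero>"
  using pos less_irrefl by (metis closed(1))

lemma add_cancel: "x \<in> D \<Longrightarrow> y \<in> D \<Longrightarrow> z \<in> D \<Longrightarrow> x \<oplus> z = y \<oplus> z \<longleftrightarrow> x = y"
  by (metis add_less less_irrefl less_linear' closed(3))

lemma add_cancel': "x \<in> D \<Longrightarrow> y \<in> D \<Longrightarrow> z \<in> D \<Longrightarrow> z \<oplus> x = z \<oplus> y \<longleftrightarrow> x = y"
  using add_cancel comm(1) by metis

lemma less_suc: "x \<in> D \<Longrightarrow> x \<prec> x \<oplus> \<one>"
  using add_less[of "\<zero>" "\<one>" x] zero_less_one comm(1)[of "\<one>" x] by simp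

lemma le_add: "x \<in> D \<Longrightarrow> y \<in> D \<Longrightarrow> x \<prec> x \<oplus> y \<or> x = x \<oplus> y"
  using add_less[of "\<zero>" y x] pos[of y y y] comm(1)[of y x] by auto

lemma less_suc_iff: "x \<in> D \<Longrightarrow> y \<in> D \<Longrightarrow> x \<prec> y \<oplus> \<one> \<longleftrightarrow> x \<prec> y \<or> x = y"
proof
  assume D: "x \<in> D" "y \<in> D" and l: "x \<prec> y \<oplus> \<one>"
  show "x \<prec> y \<or> x = y"
  proof (rule ccontr)
    assume "\<not> (x \<prec> y \<or> x = y)"
    then have "y \<prec> x" using less_linear' D by blast
    then obtain d where d: "d \<in> D" "y \<oplus> d = x" using less_sub D by blast
    then have "d \<noteq> \<zero>" using \<open>y \<prec> x\<close> D less_irrefl by force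
    then have "\<one> \<prec> d \<or> \<one> = d" using discrete zero_less d by blast
    then have "\<one> \<oplus> y \<prec> d \<oplus> y \<or> x = y \<oplus> \<one>" using add_less d D by auto
    then have "y \<oplus> \<one> \<prec> x \<or> x = y \<oplus> \<one>" using d D comm(1)[of y d] comm(1)[of y "\<one>"] by auto
    then show False using l D less_asym[of x "y \<oplus> \<one>"] less_irrefl[of x x x] by auto
  qed
next
  assume "x \<in> D" "y \<in> D" "x \<prec> y \<or> x = y"
  then show "x \<prec> y \<oplus> \<one>" using less_suc less_trans by (metis closed(2,3))
qed

lemma pred: "x \<in> D \<Longrightarrow> x \<noteq> \<zero> \<Longrightarrow> \<exists>y\<in>D. x = y \<oplus> \<one>"
proof -
  assume x: "x \<in> D" "x \<noteq> \<zero>"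
  then have "\<one> \<prec> x \<or> \<one> = x" using discrete zero_less by blast
  then show ?thesis using less_sub[of "\<one>" x] x comm(1) by (metis closed(1,2) zero_add)
qed

lemma le_less_trans: "x \<in> D \<Longrightarrow> y \<in> D \<Longrightarrow> z \<in> D \<Longrightarrow> x \<prec> y \<or> x = y \<Longrightarrow> y \<prec> z \<Longrightarrow> x \<prec> z"
  using less_trans by blast

lemma less_le_trans: "x \<in> D \<Longrightarrow> y \<in> D \<Longrightarrow> z \<in> D \<Longrightarrow> x \<prec> y \<Longrightarrow> y \<prec> z \<or> y = z \<Longrightarrow> x \<prec> z"
  using less_trans by blast

lemma less_add: "x \<in> D \<Longrightarrow> y \<in> D \<Longrightarrow> z \<in> D \<Longrightarrow> x \<prec> y \<Longrightarrow> x \<prec> y \<oplus> z \<and> x \<prec> z \<oplus> y"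
  using less_le_trans[of x y "y \<oplus> z"] le_add[of y z] comm(1)[of y z] by auto

lemma less_add_suc: "x \<in> D \<Longrightarrow> y \<in> D \<Longrightarrow> x \<prec> x \<oplus> y \<oplus> \<one> \<and> x \<prec> y \<oplus> x \<oplus> \<one>"
  using le_add[of x y] less_suc_iff[of x "x \<oplus> y"] comm(1)[of x y] by auto

lemma add_less_mono: "x \<in> D \<Longrightarrow> y \<in> D \<Longrightarrow> x' \<in> D \<Longrightarrow> y' \<in> D \<Longrightarrow> x \<prec> x' \<Longrightarrow> y \<prec> y' \<Longrightarrow> x \<oplus> y \<prec> x' \<oplus> y'"
  using add_less[of x x' y] add_less[of y y' x'] comm(1) less_trans by (metis closed(3))

lemma mul_less_mono:
  assumes "x \<in> D" "y \<in> D" "x' \<in> D" "y' \<in> D" "x \<prec> x'" "y \<prec> y'"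
  shows "x \<otimes> y \<prec> x' \<otimes> y'"
proof -
  have "\<zero> \<prec> x'" "\<zero> \<prec> y'" using assms by (metis not_less_zero zero_less)+
  then have 1: "y \<otimes> x' \<prec> y' \<otimes> x'" using mul_less assms by blast
  have 2: "x \<otimes> y \<prec> x' \<otimes> y \<or> x \<otimes> y = x' \<otimes> y"
    using mul_less[of x x' y] assms pos[of y] by (metis closed(1) ax(7))
  show ?thesis using le_less_trans[OF _ _ _ 2, of "x' \<otimes> y'"] 1 assms comm(2) by (metis closed(4))
qed

lemma mul_cancel: "q \<in> D \<Longrightarrow> x \<in> D \<Longrightarrow> y \<in> D \<Longrightarrow> q \<noteq> \<zero> \<Longrightarrow> q \<otimes> x = q \<otimes> y \<Longrightarrow> x = y"
  using mul_less[of x y q] mul_less[of y x q] less_linear'[of x y] zero_less comm(2) less_irrefl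
  by (metis closed(4))

lemma mul_nonzero: "q \<in> D \<Longrightarrow> x \<in> D \<Longrightarrow> q \<noteq> \<zero> \<Longrightarrow> x \<noteq> \<zero> \<Longrightarrow> q \<otimes> x \<noteq> \<zero>"
  using mul_cancel[of q x "\<zero>"] by auto

text \<open>Bounds the quotient, so that divisibility by \<open>q\<close> becomes a Delta_0
  property.\<close>

lemma le_mul: "q \<in> D \<Longrightarrow> v \<in> D \<Longrightarrow> q \<noteq> \<zero> \<Longrightarrow> v \<prec> q \<otimes> v \<oplus> \<one>"
proof -
  assume a: "q \<in> D" "v \<in> D" "q \<noteq> \<zero>"
  then obtain r where "r \<in> D" "q = r \<oplus> \<one>" using pred by blast
  then have "q \<otimes> v = v \<oplus> r \<otimes> v" using a by (simp add: distrib' comm(1))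
  then show ?thesis using le_add[of v "r \<otimes> v"] a \<open>r \<in> D\<close> less_suc_iff by auto
qed

lemma suc_nonzero [simp]: "x \<in> D \<Longrightarrow> x \<oplus> \<one> \<noteq> \<zero>" "x \<in> D \<Longrightarrow> \<one> \<oplus> x \<noteq> \<zero>"
  using less_suc[of x] comm(1)[of x "\<one>"] by (metis not_less_zero closed(2))+

section \<open>Divisibility, Goedel moduli and pairing\<close>

definition dvd (infix "\<bar>" 50) where "q \<bar> u \<longleftrightarrow> (\<exists>v\<in>D. q \<otimes> v = u)"

text \<open>Without subtraction, the difference of two multiples of \<open>q\<close> appears as the
  summand \<open>r\<close>.\<close>

lemma dvd_diff:
  assumes "q \<in> D" "A \<in> D" "B \<in> D" "r \<in> D" "q \<noteq> \<zero>" "q \<otimes> A = q \<otimes> B \<oplus> r"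
  shows "q \<bar> r"
proof -
  have "\<not> A \<prec> B"
  proof
    assume "A \<prec> B"
    then have "A \<otimes> q \<prec> B \<otimes> q" using mul_less assms zero_less by blast
    then have "q \<otimes> A \<prec> q \<otimes> A" using less_add[of "q \<otimes> A" "q \<otimes> B" r] assms comm(2) by (metis closed(4))
    then show False using assms by simp
  qed
  then obtain E where E: "E \<in> D" "A = B \<oplus> E"
    using less_linear'[of A B] less_sub[of B A] assms ax(6) by (metis closed(1))
  then have "q \<otimes> B \<oplus> q \<otimes> E = q \<otimes> B \<oplus> r" using assms distrib by metis
  then have "q \<otimes> E = r" using add_cancel' assms E by (metis closed(4))
  then show ?thesis using E unfolding dvd_def by blast
qed

text \<open>The moduli of Goedel's beta function.\<close>

definition modulus :: "'a \<Rightarrow> 'a \<Rightarrow> 'a" where "modulus w x = \<one> \<oplus> (x \<oplus> \<one>) \<otimes> w"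

lemma modulus_closed [simp]: "w \<in> D \<Longrightarrow> x \<in> D \<Longrightarrow> modulus w x \<in> D"
  by (simp add: modulus_def)

lemma modulus_nonzero [simp]: "w \<in> D \<Longrightarrow> x \<in> D \<Longrightarrow> modulus w x \<noteq> \<zero>"
  by (simp add: modulus_def)

text \<open>Euclid's lemma for the moduli. With \<open>a = x + 1\<close> and
  \<open>b = y + 1\<close>, the moduli p = 1 + a w and q = 1 + b w satisfy b p - a q = b - a, so q
  divides \<delta> d for the distance \<delta> of \<open>x\<close> and \<open>y\<close>. As \<delta>
  divides \<open>w\<close>, q also divides b w d = (q - 1) d, hence \<open>d\<close>.\<close>

lemma modulus_coprime:
  assumes D: "w \<in> D" "x \<in> D" "y \<in> D" "d \<in> D"
    and w: "\<And>i. i \<in> D \<Longrightarrow> i \<noteq> \<zero> \<Longrightarrow> i \<prec> m \<Longrightarrow> i \<bar> w"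
    and xy: "x \<prec> m" "y \<prec> m" "x \<noteq> y" "m \<in> D"
    and dvd: "modulus w y \<bar> modulus w x \<otimes> d"
  shows "modulus w y \<bar> d"
proof -
  define a b where "a = x \<oplus> \<one>" and "b = y \<oplus> \<one>"
  have ab: "a \<in> D" "b \<in> D" using D by (simp_all add: a_def b_def)
  let ?p = "modulus w x" and ?q = "modulus w y"
  have pq: "?p = \<one> \<oplus> a \<otimes> w" "?q = \<one> \<oplus> b \<otimes> w" by (simp_all add: modulus_def a_def b_def)
  obtain u where u: "u \<in> D" "?q \<otimes> u = ?p \<otimes> d" using dvd unfolding dvd_def by blast
  obtain \<delta> where \<delta>: "\<delta> \<in> D" "\<delta> \<noteq> \<zero>" "\<delta> \<prec> m" "x \<oplus> \<delta> = y \<or> y \<oplus> \<delta> = x"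
  proof -
    have lt: "\<delta> \<noteq> \<zero> \<and> \<delta> \<prec> m" if "\<delta> \<in> D" "s \<in> D" "t \<in> D" "s \<oplus> \<delta> = t" "t \<prec> m" "s \<noteq> t" for s t \<delta>
      using that le_add[of \<delta> s] comm(1)[of s \<delta>] xy less_trans by (metis ax(6) closed(1))
    show ?thesis using less_linear'[of x y] D xy less_sub lt that by metis
  qed
  obtain v where v: "v \<in> D" "\<delta> \<otimes> v = w" using w[OF \<delta>(1-3)] unfolding dvd_def by blast
  have "?q \<bar> \<delta> \<otimes> d"
  proof (rule disjE[OF \<delta>(4)])
    assume "x \<oplus> \<delta> = y"
    then have b: "b = a \<oplus> \<delta>" using D \<delta> by (auto simp: a_def b_def ring)
    have "?q \<otimes> (b \<otimes> u) = b \<otimes> (?p \<otimes> d)" using u D ab by (simp add: left_comm(2) flip: u(2))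
    also have "\<dots> = ?q \<otimes> (a \<otimes> d) \<oplus> \<delta> \<otimes> d"
      unfolding pq b using D ab \<delta> by (simp add: ring)
    finally show ?thesis using dvd_diff[of ?q "b \<otimes> u" "a \<otimes> d" "\<delta> \<otimes> d"] D ab u \<delta> by simp
  next
    assume "y \<oplus> \<delta> = x"
    then have a: "a = b \<oplus> \<delta>" using D \<delta> by (auto simp: a_def b_def ring)
    have "?q \<otimes> (a \<otimes> d) = b \<otimes> (?p \<otimes> d) \<oplus> \<delta> \<otimes> d"
      unfolding pq a using D ab \<delta> by (simp add: ring)
    also have "b \<otimes> (?p \<otimes> d) = ?q \<otimes> (b \<otimes> u)" using u D ab by (simp add: left_comm(2) flip: u(2))
    finally show ?thesis using dvd_diff[of ?q "a \<otimes> d" "b \<otimes> u" "\<delta> \<otimes> d"] D ab u \<delta> by simp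
  qed
  then obtain e where e: "e \<in> D" "?q \<otimes> e = \<delta> \<otimes> d" unfolding dvd_def by blast
  have "?q \<otimes> d = ?q \<otimes> (b \<otimes> v \<otimes> e) \<oplus> d"
  proof -
    have "?q \<otimes> (b \<otimes> v \<otimes> e) = b \<otimes> v \<otimes> (\<delta> \<otimes> d)" using e ab D v by (simp add: left_comm(2) flip: e(2))
    moreover have "?q \<otimes> d = b \<otimes> v \<otimes> (\<delta> \<otimes> d) \<oplus> d"
      unfolding pq(2) unfolding v(2)[symmetric] using ab D v(1) \<delta>(1) by (simp add: ring)
    ultimately show ?thesis by simp
  qed
  then show ?thesis using dvd_diff[of ?q d "b \<otimes> v \<otimes> e" d] D ab v e by simp
qed

text \<open>A relative of Cantor's pairing that needs no halving and so is a plain term of the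
  language.\<close>

definition pair :: "'a \<Rightarrow> 'a \<Rightarrow> 'a" where "pair x y = (x \<oplus> y) \<otimes> (x \<oplus> y) \<oplus> x"

text \<open>For s = x + y the value lies between s s and s s + s, below the square of s + 1. So the
  sum can be read off, and then \<open>x\<close>.\<close>

lemma pair_inj:
  assumes D: "x \<in> D" "y \<in> D" "x' \<in> D" "y' \<in> D" and eq: "pair x y = pair x' y'"
  shows "x = x' \<and> y = y'"
proof -
  have *: "pair x y \<prec> pair x' y'"
    if D: "x \<in> D" "y \<in> D" "x' \<in> D" "y' \<in> D" and l: "x \<oplus> y \<prec> x' \<oplus> y'" for x y x' y'
  proof -
    define s t where "s = x \<oplus> y" and "t = x' \<oplus> y'"
    have st: "s \<in> D" "t \<in> D" "s \<prec> t" using D l by (simp_all add: s_def t_def)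
    then obtain d where d: "d \<in> D" "s \<oplus> d = t" using less_sub by blast
    have "d \<noteq> \<zero>" using d st less_irrefl[of s s s] by auto
    then obtain c where c: "c \<in> D" "d = c \<oplus> \<one>" using pred d by blast
    \<comment> \<open>The excess is written out explicitly: \<open>t\<close> is s + c + 1, and one
      of the two copies of \<open>s\<close> in its square is x + y, which pays for
      \<open>x\<close>.\<close>
    have "t \<otimes> t \<oplus> x' = (s \<otimes> s \<oplus> x) \<oplus> \<one> \<oplus> (y \<oplus> s \<oplus> c \<oplus> c \<oplus> s \<otimes> c \<oplus> s \<otimes> c \<oplus> c \<otimes> c \<oplus> x')"
    proof -
      have "t \<otimes> t \<oplus> x' = s \<otimes> s \<oplus> s \<oplus> \<one> \<oplus> (s \<oplus> c \<oplus> c \<oplus> s \<otimes> c \<oplus> s \<otimes> c \<oplus> c \<otimes> c \<oplus> x')"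
        unfolding d(2)[symmetric] c(2) using st c D by (simp add: ring)
      also have "s \<otimes> s \<oplus> s \<oplus> \<one> = s \<otimes> s \<oplus> x \<oplus> y \<oplus> \<one>"
        using D st by (simp add: s_def add_assoc)
      finally show ?thesis using st c D by (simp add: ring)
    qed
    moreover have "s \<otimes> s \<oplus> x \<prec> (s \<otimes> s \<oplus> x) \<oplus> \<one> \<oplus> (y \<oplus> s \<oplus> c \<oplus> c \<oplus> s \<otimes> c \<oplus> s \<otimes> c \<oplus> c \<otimes> c \<oplus> x')"
      using st c D less_suc less_add by simp
    ultimately show ?thesis by (simp add: pair_def s_def t_def)
  qed
  have s: "x \<oplus> y = x' \<oplus> y'"
    using *[of x y x' y'] *[of x' y' x y] less_linear'[of "x \<oplus> y" "x' \<oplus> y'"] D eq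
    by (metis closed(3,4) less_irrefl pair_def)
  then have "x = x'" using eq add_cancel'[of x x' "(x \<oplus> y) \<otimes> (x \<oplus> y)"] D by (simp add: pair_def)
  then show ?thesis using s add_cancel' D by blast
qed

end

section \<open>Bounded quantifiers, collection and strong collection\<close>

definition isigma_model :: "nat \<Rightarrow> 'a L2_struct \<Rightarrow> bool" where
  "isigma_model n M \<longleftrightarrow> L2_structure M \<and> set_dom M \<noteq> {} \<and> models M (ISigma n)"

lemma isigma_pa: "isigma_model n M \<Longrightarrow> pa M"
  unfolding isigma_model_def using models_ISigma models_PA_minus by unfold_locales blast+

lemma eqv_subset: "eqv C p q \<Longrightarrow> C' \<subseteq> C \<Longrightarrow> eqv C' p q" unfolding eqv_def by blast
lemma isS_subset: "isS C k p \<Longrightarrow> C' \<subseteq> C \<Longrightarrow> isS C' k p" unfolding isS_def using eqv_subset by blast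
lemma isP_subset: "isP C k p \<Longrightarrow> C' \<subseteq> C \<Longrightarrow> isP C' k p" unfolding isP_def using eqv_subset by blast

lemma isigma_induct:
  assumes M: "isigma_model n M" and p: "isS {M} n p" and e: "env M e" "senv M s"
    and "sat M (case_nat (zeroM M) e) s p"
    and "\<And>x. x \<in> num_dom M \<Longrightarrow> sat M (case_nat x e) s p \<Longrightarrow> sat M (case_nat (addM M x (oneM M)) e) s p"
    and "x \<in> num_dom M"
  shows "sat M (case_nat x e) s p"
proof -
  interpret pa M using M by (rule isigma_pa)
  obtain q where q: "is_Sigma n q" "eqv {M} p q" using p unfolding isS_def by blast
  have eq: "sat M (case_nat x e) s p = sat M (case_nat x e) s q" if "x \<in> num_dom M" for x
    using q(2) e that L2 by (simp add: eqv_def)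
  have "induct_at M e s q"
    using M q(1) e models_ISigma unfolding isigma_model_def by blast
  then show ?thesis using assms(5-7) unfolding induct_at_def by (simp add: eq)
qed

text \<open>\<open>ren (case_nat 0 (case_nat 1 drop3))\<close> keeps the variables 0 and 1 and moves
  the parameters to the indices from 3 on, which leaves a gap for one auxiliary bound. With
  \<open>drop5\<close> they start at 5.\<close>

abbreviation drop3 :: "nat \<Rightarrow> nat" where "drop3 \<equiv> (\<lambda>i. Suc (Suc (Suc i)))"
abbreviation drop5 :: "nat \<Rightarrow> nat" where "drop5 \<equiv> (\<lambda>i. Suc (Suc (Suc (Suc (Suc i)))))"

text \<open>Two successive witnesses get a common bound, whose existence becomes the only unbounded
  quantifier. That Pi_k absorbs bounded quantifiers enters as the assumption \<open>bnd\<close>,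
  since \<open>isS_BAll\<close> uses the contraction inside its own induction on the level.\<close>

lemma contraction:
  assumes C: "\<And>M. M \<in> C \<Longrightarrow> isigma_model n M"
    and bnd: "\<And>p t. isP C k p \<Longrightarrow> isP C k (BEx t p)"
    and q: "is_Sigma (Suc k) q"
  shows "\<exists>T. isP C k T \<and> eqv C q (ExN T)"
  using q
proof (induction rule: Sigma_Suc_induct)
  case (Pi p)
  have "isP C k (lift p)" using is_Pi_lift[OF Pi] by (rule isP_Pi)
  moreover have "eqv C p (ExN (lift p))" using L2_nonempty by (fastforce simp: eqv_def)
  ultimately show ?case by blast
next
  case (ExN p)
  then obtain T where T: "isP C k T" "eqv C p (ExN T)" by blast
  let ?T = "BEx (Var 0) (BEx (Var 1) (ren (case_nat 0 (case_nat 1 drop3)) T))"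
  have "isP C k ?T" by (intro bnd isP_ren T(1))
  moreover have "eqv C (ExN p) (ExN ?T)"
    unfolding eqv_def
  proof (intro ballI impI allI)
    fix M e s assume M: "M \<in> C" "L2_structure M" "env M e" "senv M s"
    interpret pa M using C[OF M(1)] by (rule isigma_pa)
    have p: "sat M (case_nat y e) s p \<longleftrightarrow> (\<exists>z\<in>D. sat M (case_nat z (case_nat y e)) s T)" if "y \<in> D" for y
      using T(2) M that by (simp add: eqv_def)
    have "(\<exists>y\<in>D. \<exists>z\<in>D. P y z) \<longleftrightarrow> (\<exists>b\<in>D. \<exists>y\<in>D. lessM M y b \<and> (\<exists>z\<in>D. lessM M z b \<and> P y z))" for P
    proof
      assume "\<exists>y\<in>D. \<exists>z\<in>D. P y z"
      then obtain y z where yz: "y \<in> D" "z \<in> D" "P y z" by blast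
      \<comment> \<open>The sum of the witnesses plus one exceeds both.\<close>
      let ?b = "addM M (addM M y z) (oneM M)"
      have "lessM M y ?b" "lessM M z ?b" "?b \<in> D" using yz less_add_suc by simp_all
      with yz show "\<exists>b\<in>D. \<exists>y\<in>D. lessM M y b \<and> (\<exists>z\<in>D. lessM M z b \<and> P y z)" by blast
    qed blast
    then show "sat M e s (ExN p) = sat M e s (ExN ?T)" by (simp add: p)
  qed
  ultimately show ?case by blast
qed

text \<open>Induction on \<open>j\<close> for a common bound of witnesses for all \<open>x\<close>
  below \<open>j\<close>. As \<open>hyp\<close> gives witnesses only below \<open>a\<close>, the
  alternative that \<open>j\<close> exceeds \<open>a\<close> keeps the step valid throughout. The
  complexity \<open>F\<close> is an assumption because it is justified differently at the two
  uses.\<close>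

lemma collection_aux:
  assumes M: "isigma_model n M" and e: "env M e" "senv M s" and a: "a \<in> num_dom M"
    and F: "isS {M} n (ExN (BAll (Var 1) (BEx (Var 1) (ren (case_nat 0 (case_nat 1 drop5)) p))))"
    and hyp: "\<And>x. x \<in> num_dom M \<Longrightarrow> lessM M x a \<Longrightarrow> \<exists>y\<in>num_dom M. sat M (case_nat y (case_nat x e)) s p"
  shows "\<exists>b\<in>num_dom M. \<forall>x\<in>num_dom M. lessM M x a \<longrightarrow>
    (\<exists>y\<in>num_dom M. lessM M y b \<and> sat M (case_nat y (case_nat x e)) s p)"
proof -
  interpret pa M using M by (rule isigma_pa)
  let ?F = "Disj (Less (Var 1) (Var 0)) (ExN (BAll (Var 1) (BEx (Var 1) (ren (case_nat 0 (case_nat 1 drop5)) p))))"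
  have satF: "sat M (case_nat j (case_nat a e)) s ?F \<longleftrightarrow> a \<prec> j \<or>
      (\<exists>b\<in>D. \<forall>x\<in>D. x \<prec> j \<longrightarrow> (\<exists>y\<in>D. y \<prec> b \<and> sat M (case_nat y (case_nat x e)) s p))" for j
    by simp
  have "sat M (case_nat a (case_nat a e)) s ?F"
  proof (rule isigma_induct[OF M])
    show "isS {M} n ?F" by (rule isS_Disj[OF isS_Delta0 F]) (rule is_Delta0.intros)
    show "sat M (case_nat \<zero> (case_nat a e)) s ?F" unfolding satF by (intro disjI2 bexI[of _ "\<zero>"]) auto
    fix j assume j: "j \<in> D" and "sat M (case_nat j (case_nat a e)) s ?F"
    then consider "a \<prec> j" | b where "b \<in> D"
        "\<forall>x\<in>D. x \<prec> j \<longrightarrow> (\<exists>y\<in>D. y \<prec> b \<and> sat M (case_nat y (case_nat x e)) s p)" unfolding satF by blast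
    then show "sat M (case_nat (j \<oplus> \<one>) (case_nat a e)) s ?F"
    proof cases
      case 1
      then show ?thesis unfolding satF using less_add j a by simp
    next
      case b: 2
      show ?thesis
      proof (cases "j \<prec> a")
        case True
        then obtain y where y: "y \<in> D" "sat M (case_nat y (case_nat j e)) s p" using hyp j by blast
        have l: "y \<prec> b \<oplus> y \<oplus> \<one>" using less_add_suc y b by simp
        have "z \<prec> b \<oplus> y \<oplus> \<one>" if "z \<in> D" "z \<prec> b" for z
          using that y b less_add[of z b y] less_add[of z "b \<oplus> y" "\<one>"] by simp
        then have "\<forall>x\<in>D. x \<prec> j \<oplus> \<one> \<longrightarrow> (\<exists>z\<in>D. z \<prec> b \<oplus> y \<oplus> \<one> \<and> sat M (case_nat z (case_nat x e)) s p)"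
          using b(2) y l j less_suc_iff by blast
        moreover have "b \<oplus> y \<oplus> \<one> \<in> D" using b y by simp
        ultimately show ?thesis unfolding satF by blast
      next
        case False
        then have "a \<prec> j \<oplus> \<one>" using less_linear'[of j a] less_suc_iff j a by blast
        then show ?thesis unfolding satF by blast
      qed
    qed
  qed (use e a in auto)
  then show ?thesis unfolding satF using less_irrefl a by blast
qed

text \<open>In the step from \<open>k\<close> to k + 1, Pi_k absorbs bounded existential quantifiers
  by the induction hypothesis. So the Sigma_(k+1) formula contracts to one existential quantifier,
  which collection exchanges with the bounded universal one. The induction used for this is of level
  k + 1, at most \<open>n\<close>.\<close>

lemma isS_BAll:
  assumes C: "\<And>M. M \<in> C \<Longrightarrow> isigma_model n M" and "k \<le> n" "isS C k p"
  shows "isS C k (BAll t p)"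
  using assms(2,3)
proof (induction k arbitrary: p t)
  case 0
  then obtain q where "is_Delta0 q" "eqv C p q" unfolding isS_def is_Sigma_0 by blast
  then have "is_Delta0 (BAll t q)" "eqv C (BAll t p) (BAll t q)"
    by (auto intro: is_Delta0.intros simp: eqv_def)
  then show ?case unfolding isS_def is_Sigma_0 by blast
next
  case (Suc k)
  have bnd: "isP C k (BEx t p)" if "isP C k p" for t p
    unfolding BEx_def by (intro isP_Neg Suc.IH isS_Neg that) (use Suc in simp)
  obtain q where q: "is_Sigma (Suc k) q" "eqv C p q" using Suc.prems(2) unfolding isS_def by blast
  obtain T where T: "isP C k T" "eqv C q (ExN T)" using contraction[OF C bnd q(1)] by blast
  have eq: "eqv C p (ExN T)" using eqv_trans q T by blast
  let ?R = "ExN (BAll (tlift t) (BEx (Var 1) (ren (case_nat 0 (case_nat 1 drop3)) T)))"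
  have F: "isS C (Suc k) (ExN (BAll u (BEx v (ren f T))))" for u v f
    by (intro isS_ExN isS_Suc_isP isP_BAll bnd isP_ren T)
  have "eqv C (BAll t p) ?R"
    unfolding eqv_def
  proof (intro ballI impI allI)
    fix M e s assume M: "M \<in> C" "L2_structure M" "env M e" "senv M s"
    interpret pa M using C[OF M(1)] by (rule isigma_pa)
    have p: "sat M (case_nat x e) s p \<longleftrightarrow> (\<exists>y\<in>D. sat M (case_nat y (case_nat x e)) s T)" if "x \<in> D" for x
      using eq M that by (simp add: eqv_def)
    have S: "isS {M} n (ExN (BAll (Var 1) (BEx (Var 1) (ren (case_nat 0 (case_nat 1 drop5)) T))))"
      using isS_mono[OF isS_subset[OF F]] M(1) Suc.prems(1) by blast
    have "sat M e s (BAll t p) \<Longrightarrow> sat M e s ?R"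
      using collection_aux[OF C[OF M(1)] M(3,4) tval_dom[OF M(2,3)] S, of t] by (simp add: p)
    then show "sat M e s (BAll t p) = sat M e s ?R" by (auto simp: p)
  qed
  with F show ?case by (rule isS_eqv)
qed

lemma isP_BEx:
  assumes C: "\<And>M. M \<in> C \<Longrightarrow> isigma_model n M" and "k \<le> n" "isP C k p"
  shows "isP C k (BEx t p)"
  unfolding BEx_def by (intro isP_Neg isS_BAll[OF C assms(2)] isS_Neg assms(3))

text \<open>Pi_n still absorbs bounded quantifiers in models of Sigma_n induction, so the
  contraction reaches one level above the available induction.\<close>

lemma contract:
  assumes C: "\<And>M. M \<in> C \<Longrightarrow> isigma_model n M" and "is_Sigma (Suc n) q"
  shows "\<exists>T. is_Pi n T \<and> eqv C q (ExN T)"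
proof -
  obtain T where T: "isP C n T" "eqv C q (ExN T)"
    using contraction[OF C isP_BEx[OF C] assms(2)] by blast
  then obtain T' where "is_Pi n T'" "eqv C T T'" unfolding isP_def by blast
  moreover from this T(2) have "eqv C q (ExN T')" by (simp add: eqv_def)
  ultimately show ?thesis by blast
qed

text \<open>Were there no least element, induction would show that \<open>p\<close> fails below
  every \<open>j\<close>; this is Sigma_n because the bounded universal quantifier is
  absorbed.\<close>

lemma least_Pi:
  assumes M: "isigma_model n M" and e: "env M e" "senv M s" and p: "isP {M} n p"
    and a: "a \<in> num_dom M" "sat M (case_nat a e) s p"
  obtains x where "x \<in> num_dom M" "sat M (case_nat x e) s p"
    "\<And>y. y \<in> num_dom M \<Longrightarrow> lessM M y x \<Longrightarrow> \<not> sat M (case_nat y e) s p"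
proof (rule ccontr)
  assume no: "\<not> thesis"
  interpret pa M using M by (rule isigma_pa)
  let ?F = "BAll (Var 0) (Neg (ren (case_nat 0 (\<lambda>i. Suc (Suc i))) p))"
  have satF: "sat M (case_nat j e) s ?F \<longleftrightarrow> (\<forall>x\<in>D. x \<prec> j \<longrightarrow> \<not> sat M (case_nat x e) s p)" for j
    by simp
  have "sat M (case_nat (a \<oplus> \<one>) e) s ?F"
  proof (rule isigma_induct[OF M])
    show "isS {M} n ?F" by (rule isS_BAll[of _ n]) (use M p in \<open>auto intro: isS_Neg isP_ren\<close>)
    show "sat M (case_nat \<zero> e) s ?F" unfolding satF by simp
    fix j assume j: "j \<in> D" "sat M (case_nat j e) s ?F"
    then have "\<not> sat M (case_nat j e) s p" using no that unfolding satF by blast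
    then show "sat M (case_nat (j \<oplus> \<one>) e) s ?F" using j less_suc_iff unfolding satF by blast
  qed (use e a in auto)
  then show False using a less_suc unfolding satF by blast
qed

text \<open>As soon as \<open>n\<close> is at least 1, Sigma_n has room for the quantifier over the
  common bound, so the induction formula of \<open>collection_aux\<close> stays at level
  \<open>n\<close>.\<close>

lemma collection:
  assumes M: "isigma_model n M" and "n \<ge> 1" and p: "isS {M} n p"
    and e: "env M e" "senv M s" and a: "a \<in> num_dom M"
    and hyp: "\<And>x. x \<in> num_dom M \<Longrightarrow> lessM M x a \<Longrightarrow> \<exists>y\<in>num_dom M. sat M (case_nat y (case_nat x e)) s p"
  shows "\<exists>b\<in>num_dom M. \<forall>x\<in>num_dom M. lessM M x a \<longrightarrow>
    (\<exists>y\<in>num_dom M. lessM M y b \<and> sat M (case_nat y (case_nat x e)) s p)"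
proof (rule collection_aux[OF M e a _ hyp])
  obtain k where k: "n = Suc k" using \<open>n \<ge> 1\<close> by (cases n) auto
  show "isS {M} n (ExN (BAll (Var 1) (BEx (Var 1) (ren (case_nat 0 (case_nat 1 drop5)) p))))"
    unfolding k by (rule isS_ExN, rule isS_BAll[of _ n]) (use k M p in \<open>auto intro: isS_BEx isS_ren\<close>)
qed auto

text \<open>Whether \<open>x\<close> has a witness is a Sigma_n question, so ordinary collection
  does not apply to "if \<open>x\<close> has a witness". The set of those \<open>x\<close> below
  \<open>m\<close> is therefore coded by a number \<open>c\<close>; with \<open>c\<close> as a
  parameter membership is Delta_0, and collection becomes applicable.\<close>

lemma strong_collection_1:
  assumes M: "isigma_model n M" and n: "n \<ge> 1" and p: "isS {M} n p"
    and e: "env M e" "senv M s" and m: "m \<in> num_dom M"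
  shows "\<exists>b\<in>num_dom M. \<forall>x\<in>num_dom M. lessM M x m \<longrightarrow>
    (\<exists>y\<in>num_dom M. sat M (case_nat y (case_nat x e)) s p) \<longrightarrow>
    (\<exists>y\<in>num_dom M. lessM M y b \<and> sat M (case_nat y (case_nat x e)) s p)"
proof -
  interpret pa M using M by (rule isigma_pa)
  obtain k where k: "n = Suc k" using n by (cases n) auto
  have S: "isS {M} n (BAll t p)" if "isS {M} n p" for t p
    by (rule isS_BAll[of _ n]) (use M that in auto)
  have E: "isS {M} n (ExN p)" if "isS {M} n p" for p
    using that isS_ExN k by blast
  have D0: "isS {M} n p" "isP {M} n p" if "is_Delta0 p" for p
    using that isS_Delta0 isP_Delta0 by blast+
  \<comment> \<open>\<open>w\<close> stands in for a factorial: every nonzero number below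
    \<open>m\<close>, and so every difference of two of them, divides it, as
    \<open>modulus_coprime\<close> requires.\<close>
  have ex_w: "\<exists>w\<in>D. w \<noteq> \<zero> \<and> (\<forall>i\<in>D. i \<prec> m \<longrightarrow> i \<noteq> \<zero> \<longrightarrow> i \<bar> w)"
  proof -
    let ?F = "ExN (Conj (Neg (Eq (Var 0) Zero)) (BAll (Var 1) (Imp (Neg (Eq (Var 0) Zero))
       (ExN (Eq (Mul (Var 1) (Var 0)) (Var 2))))))"
    have satF: "sat M (case_nat j e) s ?F \<longleftrightarrow> (\<exists>w\<in>D. w \<noteq> \<zero> \<and> (\<forall>i\<in>D. i \<prec> j \<longrightarrow> i \<noteq> \<zero> \<longrightarrow> i \<bar> w))" for j
      by (simp add: dvd_def)
    have "sat M (case_nat m e) s ?F"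
    proof (rule isigma_induct[OF M])
      show "isS {M} n ?F" by (intro E isS_Conj S isS_Imp D0 is_Delta0.intros is_Delta0_connectives)
      show "sat M (case_nat \<zero> e) s ?F" unfolding satF
        using zero_less_one less_irrefl by (intro bexI[of _ "\<one>"]) auto
      fix j assume j: "j \<in> D" "sat M (case_nat j e) s ?F"
      then obtain w where w: "w \<in> D" "w \<noteq> \<zero>" "\<And>i. i \<in> D \<Longrightarrow> i \<prec> j \<Longrightarrow> i \<noteq> \<zero> \<Longrightarrow> i \<bar> w"
        unfolding satF by blast
      show "sat M (case_nat (j \<oplus> \<one>) e) s ?F"
      \<comment> \<open>A factor \<open>j\<close> equal to zero would make the product zero.\<close>
      proof (cases "j = \<zero>")
        case True
        have "i = \<zero>" if "i \<in> D" "i \<prec> \<one>" for i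
          using less_suc_iff[of i "\<zero>"] that by simp
        then show ?thesis unfolding satF using w True by (intro bexI[of _ w]) auto
      next
        case False
        have "i \<bar> w \<otimes> j" if i: "i \<in> D" "i \<prec> j \<oplus> \<one>" "i \<noteq> \<zero>" for i
        proof (cases "i = j")
          case True
          then show ?thesis unfolding dvd_def using w j comm(2) by blast
        next
          case False
          then have "i \<bar> w" using i w less_suc_iff j by blast
          then obtain v where "v \<in> D" "i \<otimes> v = w" unfolding dvd_def by blast
          then show ?thesis unfolding dvd_def using i j by (intro bexI[of _ "v \<otimes> j"]) (auto simp: mul_assoc)
        qed
        then show ?thesis unfolding satF using w j mul_nonzero False by (intro bexI[of _ "w \<otimes> j"]) auto
      qed
    qed (use e m in auto)
    then show ?thesis unfolding satF .
  qed
  then obtain w where w: "w \<in> D" "w \<noteq> \<zero>" "\<And>i. i \<in> D \<Longrightarrow> i \<noteq> \<zero> \<Longrightarrow> i \<prec> m \<Longrightarrow> i \<bar> w" by blast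
  have dvd_bound: "modulus w x \<bar> c \<longleftrightarrow> (\<exists>v\<in>D. v \<prec> c \<oplus> \<one> \<and> modulus w x \<otimes> v = c)" if "x \<in> D" "c \<in> D" for x c
    unfolding dvd_def using le_mul[of "modulus w x"] w(1) that by (metis modulus_closed modulus_nonzero)
  \<comment> \<open>Under the quotient quantifier of \<open>?dvd\<close> the indices 1 to 4 are
    \<open>x\<close>, \<open>c\<close>, the bound on \<open>x\<close> and \<open>w\<close>; in the
    bound of that quantifier they are one lower.\<close>
  let ?q = "Add One (Mul (Add (Var 1) One) (Var 4))"
  let ?dvd = "BEx (Add (Var 1) One) (Eq (Mul ?q (Var 0)) (Var 2))"
  have sat_dvd: "sat M (case_nat x (case_nat c (case_nat j (case_nat w e')))) s ?dvd \<longleftrightarrow> modulus w x \<bar> c"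
    if "x \<in> D" "c \<in> D" for x c j e'
    using that by (simp add: dvd_bound) (simp add: modulus_def)
  \<comment> \<open>The product of the moduli below \<open>m\<close> shows that there is a common
    multiple at all.\<close>
  have ex_c: "\<exists>c\<in>D. c \<noteq> \<zero> \<and> (\<forall>x\<in>D. x \<prec> m \<longrightarrow> modulus w x \<bar> c)"
  proof -
    let ?F = "ExN (Conj (Neg (Eq (Var 0) Zero)) (BAll (Var 1) ?dvd))"
    have satF: "sat M (case_nat j (case_nat w e)) s ?F \<longleftrightarrow> (\<exists>c\<in>D. c \<noteq> \<zero> \<and> (\<forall>x\<in>D. x \<prec> j \<longrightarrow> modulus w x \<bar> c))" for j
      using sat_dvd by (simp del: sat_simps(8))
    have "sat M (case_nat m (case_nat w e)) s ?F"
    proof (rule isigma_induct[OF M])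
      show "isS {M} n ?F" by (intro E isS_Conj S D0 is_Delta0.intros is_Delta0_connectives)
      show "sat M (case_nat \<zero> (case_nat w e)) s ?F" unfolding satF
        using zero_less_one less_irrefl by (intro bexI[of _ "\<one>"]) auto
      fix j assume j: "j \<in> D" "sat M (case_nat j (case_nat w e)) s ?F"
      then obtain c where c: "c \<in> D" "c \<noteq> \<zero>" "\<And>x. x \<in> D \<Longrightarrow> x \<prec> j \<Longrightarrow> modulus w x \<bar> c"
        unfolding satF by blast
      have "modulus w x \<bar> c \<otimes> modulus w j" if x: "x \<in> D" "x \<prec> j \<oplus> \<one>" for x
      proof (cases "x = j")
        case True
        then show ?thesis unfolding dvd_def using c j w comm(2) by (metis modulus_closed)
      next
        case False
        then have "modulus w x \<bar> c" using x c less_suc_iff j by blast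
        then obtain v where "v \<in> D" "modulus w x \<otimes> v = c" unfolding dvd_def by blast
        then show ?thesis unfolding dvd_def using x j w
          by (intro bexI[of _ "v \<otimes> modulus w j"]) (auto simp: mul_assoc)
      qed
      then show "sat M (case_nat (j \<oplus> \<one>) (case_nat w e)) s ?F"
        unfolding satF using c j w mul_nonzero by (intro bexI[of _ "c \<otimes> modulus w j"]) auto
    qed (use e m w in auto)
    then show ?thesis unfolding satF .
  qed
  txt \<open>The least common multiple of the moduli of the \<open>x < m\<close> with \<open>\<exists>y. p(y, x)\<close> is divisible by no
    other modulus, hence codes the set of these \<open>x\<close>.\<close>
  let ?E = "ren (case_nat 0 (case_nat 1 drop5)) p"
  let ?G = "Conj (Neg (Eq (Var 0) Zero)) (BAll (Var 1) (Imp (ExN ?E) ?dvd))"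
  let ?e = "case_nat m (case_nat w e)"
  let ?ex = "\<lambda>x. \<exists>y\<in>D. sat M (case_nat y (case_nat x e)) s p"
  have satG: "sat M (case_nat c ?e) s ?G \<longleftrightarrow> c \<noteq> \<zero> \<and> (\<forall>x\<in>D. x \<prec> m \<longrightarrow> ?ex x \<longrightarrow> modulus w x \<bar> c)"
    if "c \<in> D" for c
    using sat_dvd that by (simp del: sat_simps(8))
  obtain c0 where c0: "c0 \<in> D" "sat M (case_nat c0 ?e) s ?G" using ex_c satG by blast
  \<comment> \<open>The witness quantifier stands in a premise, so \<open>?G\<close> is Pi_n and has
    a least solution.\<close>
  have "isP {M} n ?G"
    by (intro isP_Conj isP_BAll isP_Imp E isS_ren p D0 is_Delta0.intros is_Delta0_connectives)
  then obtain c where c: "c \<in> D" "sat M (case_nat c ?e) s ?G"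
      and least: "\<And>d. d \<in> D \<Longrightarrow> d \<prec> c \<Longrightarrow> \<not> sat M (case_nat d ?e) s ?G"
    using least_Pi[OF M _ e(2) _ c0] e m w by (metis env_case_nat)
  have code: "?ex x" if x: "x \<in> D" "x \<prec> m" "modulus w x \<bar> c" for x
  proof (rule ccontr)
    assume nex: "\<not> ?ex x"
    obtain d where d: "d \<in> D" "modulus w x \<otimes> d = c" using x(3) unfolding dvd_def by blast
    have "d \<noteq> \<zero>" using c satG[OF c(1)] d w x by auto
    moreover have "modulus w y \<bar> d" if y: "y \<in> D" "y \<prec> m" "?ex y" for y
      by (rule modulus_coprime[OF w(1) x(1) y(1) d(1) w(3), of m])
        (use x y nex m c satG[OF c(1)] d(2) in auto)
    ultimately have G: "sat M (case_nat d ?e) s ?G" unfolding satG[OF d(1)] by blast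
    have "d \<prec> c"
    proof -
      have "d \<prec> c \<or> d = c"
        using le_mul[of "modulus w x" d] less_suc_iff[OF d(1) c(1)] d w x by (metis modulus_closed modulus_nonzero)
      moreover have "d \<noteq> c"
      proof
        assume "d = c"
        then have "c \<otimes> modulus w x = c \<otimes> \<one>" using d c w x comm(2) by (metis modulus_closed ax(8))
        then have "modulus w x = \<one>" using mul_cancel[of c "modulus w x" "\<one>"] c satG[OF c(1)] w x by auto
        then have "\<one> \<oplus> (x \<oplus> \<one>) \<otimes> w = \<one> \<oplus> \<zero>" unfolding modulus_def by simp
        then have "(x \<oplus> \<one>) \<otimes> w = \<zero>" using add_cancel'[of _ "\<zero>" "\<one>"] w x by (metis closed)
        then show False using mul_nonzero[of "x \<oplus> \<one>" w] w x by auto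
      qed
      ultimately show ?thesis by blast
    qed
    with least G d show False by blast
  qed
  \<comment> \<open>Satisfiable for every \<open>x\<close> below \<open>m\<close>: where the modulus
    does not divide \<open>c\<close>, any \<open>y\<close> will do.\<close>
  let ?H = "Imp (BEx (Add (Var 2) One) (Eq (Mul (Add One (Mul (Add (Var 2) One) (Var 5))) (Var 0)) (Var 3)))
     (ren (case_nat 0 (case_nat 1 drop5)) p)"
  let ?e' = "case_nat c ?e"
  have satH: "sat M (case_nat y (case_nat x ?e')) s ?H \<longleftrightarrow>
      (modulus w x \<bar> c \<longrightarrow> sat M (case_nat y (case_nat x e)) s p)" if "x \<in> D" for x y
    using that c(1) by (simp add: dvd_bound) (simp add: modulus_def)
  have "\<exists>b\<in>D. \<forall>x\<in>D. x \<prec> m \<longrightarrow> (\<exists>y\<in>D. y \<prec> b \<and> sat M (case_nat y (case_nat x ?e')) s ?H)"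
  proof (rule collection[OF M n])
    show "isS {M} n ?H"
      by (intro isS_Imp isS_ren p D0 is_Delta0.intros is_Delta0_connectives)
    fix x assume x: "x \<in> D" "x \<prec> m"
    then show "\<exists>y\<in>D. sat M (case_nat y (case_nat x ?e')) s ?H"
      unfolding satH[OF x(1)] using code closed(1) by blast
  qed (use e m w c in auto)
  then obtain b where b: "b \<in> D"
      "\<And>x. x \<in> D \<Longrightarrow> x \<prec> m \<Longrightarrow> \<exists>y\<in>D. y \<prec> b \<and> sat M (case_nat y (case_nat x ?e')) s ?H" by blast
  show ?thesis
  proof (rule bexI[OF _ b(1)], intro ballI impI)
    fix x assume x: "x \<in> D" "x \<prec> m" "?ex x"
    then have "modulus w x \<bar> c" using c satG[OF c(1)] by blast
    with b(2)[OF x(1,2)] satH[OF x(1)] show "\<exists>y\<in>D. y \<prec> b \<and> sat M (case_nat y (case_nat x e)) s p" by blast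
  qed
qed

text \<open>In \<open>absolute_ExN\<close> all parameters of a formula have to be bounded at once.
  Two of them are merged by \<open>pair\<close>, which lowers their number by one.\<close>

lemma strong_collection:
  assumes M: "isigma_model n M" and n: "n \<ge> 1" and p: "isS {M} n p"
    and e: "env M e" "senv M s" and m: "m \<in> num_dom M"
  shows "\<exists>b\<in>num_dom M. \<forall>e'. env M e' \<longrightarrow> (\<forall>i<r. lessM M (e' i) m) \<longrightarrow> (\<forall>i\<ge>r. e' i = e i) \<longrightarrow>
    (\<exists>y\<in>num_dom M. sat M (case_nat y e') s p) \<longrightarrow>
    (\<exists>y\<in>num_dom M. lessM M y b \<and> sat M (case_nat y e') s p)"
  using p e(1) m
proof (induction r arbitrary: p e m)
  case 0
  interpret pa M using M by (rule isigma_pa)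
  have e': "e' = e" if "\<forall>i\<ge>0. e' i = e i" for e' using that by auto
  show ?case
  proof (cases "\<exists>y\<in>D. sat M (case_nat y e) s p")
    case True
    then obtain y where "y \<in> D" "sat M (case_nat y e) s p" by blast
    moreover from this have "y \<prec> y \<oplus> \<one>" "y \<oplus> \<one> \<in> D" using less_suc by simp_all
    ultimately show ?thesis using e' by metis
  next
    case False
    then show ?thesis using e' closed(1) by metis
  qed
next
  case (Suc r)
  interpret pa M using M by (rule isigma_pa)
  obtain k where k: "n = Suc k" using n by (cases n) auto
  show ?case
  proof (cases r)
    case 0
    have ee: "env M (\<lambda>i. e (Suc i))" using Suc.prems by (simp add: env_def)
    obtain b where b: "b \<in> D" "\<And>x. x \<in> D \<Longrightarrow> x \<prec> m \<Longrightarrow> \<exists>y\<in>D. sat M (case_nat y (case_nat x (\<lambda>i. e (Suc i)))) s p \<Longrightarrow>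
        \<exists>y\<in>D. y \<prec> b \<and> sat M (case_nat y (case_nat x (\<lambda>i. e (Suc i)))) s p"
      using strong_collection_1[OF M n Suc.prems(1) ee e(2) Suc.prems(3)] by blast
    show ?thesis
    proof (rule bexI[OF _ b(1)], intro allI impI)
      fix e' assume e': "env M e'" "\<forall>i<Suc r. e' i \<prec> m" "\<forall>i\<ge>Suc r. e' i = e i"
        and ex: "\<exists>y\<in>D. sat M (case_nat y e') s p"
      have "e' = case_nat (e' 0) (\<lambda>i. e (Suc i))"
        using e'(3) 0 by (auto simp: fun_eq_iff split: nat.split)
      then show "\<exists>y\<in>D. y \<prec> b \<and> sat M (case_nat y e') s p"
        using b(2)[of "e' 0"] ex e' by (metis env_def zero_less_Suc)
    qed
  next
    case r: (Suc r')
    \<comment> \<open>The quantified components have the indices 1 and 0, \<open>y\<close> has 2 and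
      the pair 3.\<close>
    let ?pair = "Add (Mul (Add (Var 1) (Var 0)) (Add (Var 1) (Var 0))) (Var 1)"
    let ?p = "ExN (ExN (Conj (Eq (Var 3) ?pair)
      (ren (case_nat 2 (case_nat 1 (case_nat 0 (\<lambda>i. Suc (Suc (Suc (Suc i))))))) p)))"
    have satp: "sat M (case_nat y (case_nat z g)) s ?p \<longleftrightarrow>
        (\<exists>x1\<in>D. \<exists>x2\<in>D. z = pair x1 x2 \<and> sat M (case_nat y (case_nat x1 (case_nat x2 g))) s p)" for y z g
      by (simp add: pair_def)
    have sp: "isS {M} n ?p"
      unfolding k by (intro isS_ExN isS_Conj isS_Delta0 is_Delta0.intros isS_ren Suc.prems(1)[unfolded k])
    \<comment> \<open>This is \<open>pair m m\<close>; it bounds the pairs and also the parameters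
      left unpaired.\<close>
    let ?m = "(m \<oplus> m) \<otimes> (m \<oplus> m) \<oplus> m"
    have m: "m \<in> D" "?m \<in> D" using Suc.prems by auto
    have lt: "pair x y \<prec> ?m" if "x \<in> D" "y \<in> D" "x \<prec> m" "y \<prec> m" for x y
      unfolding pair_def using that m by (intro add_less_mono mul_less_mono closed)
    have le: "x \<prec> ?m" if "x \<in> D" "x \<prec> m" for x
      using that m less_add by simp
    have "env M (\<lambda>i. e (Suc i))" using Suc.prems by (simp add: env_def)
    from Suc.IH[OF sp this m(2)] obtain b where b: "b \<in> D"
      "\<And>e'. env M e' \<Longrightarrow> \<forall>i<r. e' i \<prec> ?m \<Longrightarrow> \<forall>i\<ge>r. e' i = e (Suc i) \<Longrightarrow>
        \<exists>y\<in>D. sat M (case_nat y e') s ?p \<Longrightarrow> \<exists>y\<in>D. y \<prec> b \<and> sat M (case_nat y e') s ?p" by blast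
    show ?thesis
    proof (rule bexI[OF _ b(1)], intro allI impI)
      fix e' assume e': "env M e'" "\<forall>i<Suc r. e' i \<prec> m" "\<forall>i\<ge>Suc r. e' i = e i"
        and ex: "\<exists>y\<in>D. sat M (case_nat y e') s p"
      let ?g = "\<lambda>i. e' (Suc (Suc i))"
      let ?e = "case_nat (pair (e' 0) (e' 1)) ?g"
      have D: "e' i \<in> D" for i using e' by (simp add: env_def)
      have split: "e' = case_nat (e' 0) (case_nat (e' 1) ?g)"
        by (auto simp: fun_eq_iff split: nat.split)
      have "pair (e' 0) (e' 1) \<in> D" using D by (simp add: pair_def)
      moreover have "env M ?g" using D by (simp add: env_def)
      ultimately have 1: "env M ?e" by simp
      have 2: "\<forall>i<r. ?e i \<prec> ?m"
      proof (intro allI impI)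
        fix i assume "i < r"
        then show "?e i \<prec> ?m" using e'(2) r D lt le by (cases i) auto
      qed
      have 3: "\<forall>i\<ge>r. ?e i = e (Suc i)"
        using e'(3) r by (auto split: nat.split)
      have 4: "\<exists>y\<in>D. sat M (case_nat y ?e) s ?p"
        unfolding satp using ex split D by metis
      obtain y where y: "y \<in> D" "y \<prec> b" "sat M (case_nat y ?e) s ?p" using b(2)[OF 1 2 3 4] by blast
      then obtain x1 x2 where x: "x1 \<in> D" "x2 \<in> D" "pair (e' 0) (e' 1) = pair x1 x2"
        "sat M (case_nat y (case_nat x1 (case_nat x2 ?g))) s p" unfolding satp by blast
      then have "e' 0 = x1 \<and> e' 1 = x2" using pair_inj D by blast
      then have "sat M (case_nat y e') s p" using x(4) split by metis
      with y show "\<exists>y\<in>D. y \<prec> b \<and> sat M (case_nat y e') s p" by blast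
    qed
  qed
qed

section \<open>Elementary extensions\<close>

lemma (in pa) finite_bound: "finite A \<Longrightarrow> A \<subseteq> D \<Longrightarrow> \<exists>d\<in>D. \<forall>a\<in>A. a \<prec> d"
proof (induction rule: finite_induct)
  case empty
  then show ?case using closed(1) by blast
next
  case (insert a A)
  then obtain d where d: "d \<in> D" "\<forall>a\<in>A. a \<prec> d" by blast
  have "a \<prec> d \<oplus> a \<oplus> \<one>" using less_add_suc d insert by simp
  moreover have "b \<prec> d \<oplus> a \<oplus> \<one>" if "b \<in> A" for b
  proof -
    have "b \<in> D" "b \<prec> d" using that insert d by auto
    then show ?thesis using less_add[of b d a] less_add[of b "d \<oplus> a" "\<one>"] d insert by simp
  qed
  ultimately show ?case using d insert by (intro bexI[of _ "d \<oplus> a \<oplus> \<one>"]) auto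
qed

text \<open>Types speak of finitely many named sets and never quantify over sets, so with fewer sets
  there are only fewer types.\<close>

lemma recursively_saturated_reduct:
  assumes "recursively_saturated M" "S \<subseteq> set_dom M"
  shows "recursively_saturated (M\<lparr>set_dom := S\<rparr>)"
  unfolding recursively_saturated_def
proof (intro allI impI)
  fix k m p e s
  assume p: "\<forall>\<phi>\<in>p. arithmetical \<phi> \<and> fv_below (Suc k) m \<phi>" "recursive_set (code ` p)"
    and e: "\<forall>i<k. e i \<in> num_dom (M\<lparr>set_dom := S\<rparr>)" and s: "\<forall>i<m. s i \<in> set_dom (M\<lparr>set_dom := S\<rparr>)"
    and F: "\<forall>F. finite F \<and> F \<subseteq> p \<longrightarrow> (\<exists>a\<in>num_dom (M\<lparr>set_dom := S\<rparr>). \<forall>\<phi>\<in>F. sat (M\<lparr>set_dom := S\<rparr>) (case_nat a e) s \<phi>)"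
  have eq: "sat (M\<lparr>set_dom := S\<rparr>) e s \<phi> = sat M e s \<phi>" if "\<phi> \<in> p" for e s \<phi>
    using sat_set_dom p(1) that by blast
  have "\<exists>a\<in>num_dom M. \<forall>\<phi>\<in>F. sat M (case_nat a e) s \<phi>" if "finite F" "F \<subseteq> p" for F
  proof -
    obtain a where "a \<in> num_dom M" "\<forall>\<phi>\<in>F. sat (M\<lparr>set_dom := S\<rparr>) (case_nat a e) s \<phi>"
      using F \<open>finite F\<close> \<open>F \<subseteq> p\<close> by auto
    then show ?thesis using eq \<open>F \<subseteq> p\<close> by (metis subsetD)
  qed
  moreover have "\<forall>i<m. s i \<in> set_dom M" using s assms(2) by auto
  moreover have "\<forall>i<k. e i \<in> num_dom M" using e by simp
  ultimately have "\<exists>a\<in>num_dom M. \<forall>\<phi>\<in>p. sat M (case_nat a e) s \<phi>"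
    using p assms(1)[unfolded recursively_saturated_def, THEN spec[of _ k], THEN spec[of _ m],
        THEN spec[of _ p], THEN spec[of _ e], THEN spec[of _ s]] by simp
  then obtain a where "a \<in> num_dom M" "\<forall>\<phi>\<in>p. sat M (case_nat a e) s \<phi>" by blast
  then show "\<exists>a\<in>num_dom (M\<lparr>set_dom := S\<rparr>). \<forall>\<phi>\<in>p. sat (M\<lparr>set_dom := S\<rparr>) (case_nat a e) s \<phi>"
    by (intro bexI[of _ a] ballI) (simp_all add: eq)
qed

text \<open>Compactness for the elementary diagram. Numbers of \<open>M\<close> are named by the
  even variables from 2 on, sets by the even set variables, and variable 0 is to lie above all
  numbers; the odd variables are left for the Henkin construction. Only the named sets are kept, so
  that \<open>t\<close> enumerates all sets of \<open>K\<close>.\<close>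

lemma elementary_extension:
  fixes M :: "nat L2_struct"
  assumes M: "L2_structure M" "pam M" and s: "senv M s"
  obtains K :: "nat L2_struct" and t j d where
    "L2_structure K" "recursively_saturated K" "set_dom K = range t"
    "\<And>a. a \<in> num_dom M \<Longrightarrow> j a \<in> num_dom K"
    "\<And>p e. arithmetical p \<Longrightarrow> env M e \<Longrightarrow> sat M e s p = sat K (j \<circ> e) t p"
    "d \<in> num_dom K" "\<And>a. a \<in> num_dom M \<Longrightarrow> lessM K (j a) d"
proof -
  interpret pa M using M by unfold_locales
  let ?e = "from_nat_into D"
  have ne: "D \<noteq> {}" using closed(1) by blast
  have range_e: "range ?e = D" using ne by (intro range_from_nat_into) auto
  have env_e: "env M ?e" using ne by (simp add: env_def from_nat_into)
  let ?nm = "subst (\<lambda>i. Var (2 * i + 2)) (\<lambda>i. 2 * i)"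
  let ?\<Delta> = "{?nm p |p. arithmetical p \<and> sat M ?e s p} \<union> {Less (Var (2 * i + 2)) (Var 0) |i. True}"
  have con: "con ?\<Delta>"
    unfolding con_def
  proof
    assume "?\<Delta> \<turnstile> Fls"
    then obtain F where F: "finite F" "F \<subseteq> ?\<Delta>" "F \<turnstile> Fls" using prv_finite by blast
    let ?A = "(\<lambda>v. ?e ((v - 2) div 2)) ` (\<Union>p\<in>F. fvN p)"
    have "finite ?A" by (intro finite_imageI finite_UN_I F(1) finite_fv)
    moreover have "?A \<subseteq> D" using from_nat_into[OF ne] by blast
    ultimately have "\<exists>d\<in>D. \<forall>a\<in>?A. a \<prec> d" by (rule finite_bound)
    then obtain d where d: "d \<in> D" "\<forall>a\<in>?A. a \<prec> d" by (rule bexE)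
    \<comment> \<open>A finite part of the diagram holds in \<open>M\<close> itself: variable
      \<open>2 * i + 2\<close> denotes the element with number \<open>i\<close>, and variable 0 a
      bound for the finitely many elements named.\<close>
    let ?e' = "\<lambda>v. if v = 0 then d else ?e ((v - 2) div 2)" and ?s' = "\<lambda>X. s (X div 2)"
    have "sat M ?e' ?s' q" if "q \<in> F" for q
    proof -
      have "q \<in> ?\<Delta>" using that F(2) by blast
      then consider p where "q = ?nm p" "sat M ?e s p" | i where "q = Less (Var (2 * i + 2)) (Var 0)" by blast
      then show ?thesis
      proof cases
        case 1
        then show ?thesis by (simp add: sat_subst)
      next
        case (2 i)
        then have "2 * i + 2 \<in> fvN q" by simp
        then have "?e ((2 * i + 2 - 2) div 2) \<in> ?A" using that by blast
        with d(2) have "?e ((2 * i + 2 - 2) div 2) \<prec> d" by (rule bspec)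
        then show ?thesis using 2 by simp
      qed
    qed
    moreover have "env M ?e'" using d(1) ne by (simp add: env_def from_nat_into)
    moreover have "senv M ?s'" using s by (simp add: senv_def)
    ultimately have "sat M ?e' ?s' Fls" using soundness[OF F(3) L2] by blast
    then show False by simp
  qed
  have even: "\<forall>p\<in>?\<Delta>. fvN p \<subseteq> Collect even \<and> fvS p \<subseteq> Collect even"
    by (auto simp: fv_subst)
  obtain K0 :: "nat L2_struct" and e' s' where K0: "L2_structure K0" "recursively_saturated K0"
      "env K0 e'" "senv K0 s'" "\<forall>p\<in>?\<Delta>. sat K0 e' s' p"
    using model_existence[OF con even] by (elim exE conjE)
  define t where "t = (\<lambda>i. s' (2 * i))"
  define e2 where "e2 = (\<lambda>i. e' (2 * i + 2))"
  define K where "K = K0\<lparr>set_dom := range t\<rparr>"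
  define ix where "ix = (\<lambda>a. SOME i. ?e i = a)"
  define j where "j = (\<lambda>a. e2 (ix a))"
  have ix: "?e (ix a) = a" if "a \<in> D" for a
    using that range_e unfolding ix_def by (metis (mono_tags, lifting) imageE someI_ex)
  have nm: "sat K0 e' s' (?nm p) = sat K0 e2 t p" for p
    by (simp add: sat_subst t_def e2_def)
  have 1: "sat K0 e2 t p" if "arithmetical p" "sat M ?e s p" for p
    using that K0(5) nm by blast
  have 2: "sat M ?e s p = sat K0 e2 t p" if "arithmetical p" for p
    using that 1[of p] 1[of "Neg p"] by auto
  have t: "range t \<subseteq> set_dom K0" using K0(4) by (auto simp: t_def senv_def)
  show thesis
  proof
    show "L2_structure K" using K0(1) subset_trans[OF t] by (simp add: L2_structure_def K_def)
    show "recursively_saturated K" unfolding K_def by (rule recursively_saturated_reduct[OF K0(2) t])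
    show "set_dom K = range t" by (simp add: K_def)
    show "j a \<in> num_dom K" if "a \<in> num_dom M" for a
      using K0(3) by (simp add: j_def e2_def K_def env_def)
    show "sat M e s p = sat K (j \<circ> e) t p" if p: "arithmetical p" and e: "env M e" for p e
    proof -
      have "e = ?e \<circ> (\<lambda>i. ix (e i))" using e ix by (auto simp: env_def fun_eq_iff)
      then have "sat M e s p = sat M ?e s (ren (\<lambda>i. ix (e i)) p)" by simp
      also have "\<dots> = sat K0 e2 t (ren (\<lambda>i. ix (e i)) p)" by (rule 2) (simp add: ren_def p)
      also have "\<dots> = sat K (j \<circ> e) t p" by (simp add: K_def sat_set_dom p j_def comp_def)
      finally show ?thesis .
    qed
    show "e' 0 \<in> num_dom K" using K0(3) by (simp add: K_def env_def)
    show "lessM K (j a) (e' 0)" if "a \<in> num_dom M" for a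
    proof -
      have "sat K0 e' s' (Less (Var (2 * ix a + 2)) (Var 0))" using K0(5) by blast
      then show ?thesis by (simp add: j_def e2_def K_def)
    qed
  qed
qed

text \<open>An axiom has to hold in \<open>K\<close> also at elements outside the image of
  \<open>j\<close>, so its number variables are quantified before the transfer. Set parameters need
  no quantifier, as \<open>t\<close> names them all.\<close>

lemma models_closures_transfer:
  fixes M :: "'a L2_struct" and K :: "'b L2_struct"
  assumes M: "L2_structure M" "set_dom M = range s" and K: "L2_structure K" "set_dom K = range t"
    and elem: "\<And>p e. arithmetical p \<Longrightarrow> env M e \<Longrightarrow> sat M e s p = sat K (j \<circ> e) t p"
    and p: "arithmetical p" and m: "models M (closures p)"
  shows "models K (closures p)"
proof -
  have "sat K e \<sigma> p" if e: "env K e" and \<sigma>: "senv K \<sigma>" for e \<sigma>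
  proof -
    have "\<forall>i. \<exists>k. \<sigma> i = t k" using \<sigma> K(2) by (simp add: senv_def image_iff)
    then obtain \<rho> where \<rho>: "\<And>i. \<sigma> i = t (\<rho> i)" by metis
    obtain k where k: "fv_below k k p" using ex_fv_below by blast
    let ?q = "(All ^^ k) (subst Var \<rho> p)"
    obtain a where a: "a \<in> num_dom M" using L2_nonempty[OF M(1)] by blast
    have "senv M (\<lambda>i. s (\<rho> i))" using M(2) by (simp add: senv_def)
    moreover have "env M (\<lambda>i. if i < k then f i else a)" if "\<forall>i<k. f i \<in> num_dom M" for f
      using that a by (simp add: env_def)
    moreover have "\<forall>e s. env M e \<longrightarrow> senv M s \<longrightarrow> sat M e s p" using m models_closures[OF M(1)] M(2) by blast
    ultimately have "sat M (\<lambda>_. a) s ?q"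
      unfolding sat_All_pow sat_subst by simp
    moreover have "arithmetical ((All ^^ k) q)" if "arithmetical q" for q k
      using that by (induction k) auto
    ultimately have "sat K (j \<circ> (\<lambda>_. a)) t ?q" using elem p a by (simp add: env_def)
    then have "sat K (\<lambda>i. if i < k then e i else (j \<circ> (\<lambda>_. a)) (i - k)) (\<lambda>i. t (\<rho> i)) p"
      unfolding sat_All_pow sat_subst tval.simps using e by (simp add: env_def)
    then show "sat K e \<sigma> p"
      by (rule iffD1[OF sat_cong, rotated 2]) (use k \<rho> in \<open>auto simp: fv_below_iff\<close>)
  qed
  then show ?thesis using models_closures[OF K(1)] K(2) by blast
qed

lemma arithmetical_connectives [simp]:
  "arithmetical (Conj p q) = (arithmetical p \<and> arithmetical q)"
  "arithmetical (Disj p q) = (arithmetical p \<and> arithmetical q)"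
  by (auto simp: Conj_def Disj_def)

lemma models_transfer:
  fixes M :: "'a L2_struct" and K :: "'b L2_struct"
  assumes M: "L2_structure M" "set_dom M = range s" and K: "L2_structure K" "set_dom K = range t"
    and elem: "\<And>p e. arithmetical p \<Longrightarrow> env M e \<Longrightarrow> sat M e s p = sat K (j \<circ> e) t p"
  shows "models M (ISigma n) \<Longrightarrow> models K (ISigma n)" "models M (BSigma n) \<Longrightarrow> models K (BSigma n)"
proof -
  note * = models_closures_transfer[OF M K elem]
  have PA: "models M PA_minus \<Longrightarrow> models K PA_minus"
    unfolding PA_minus_def Let_def models_Union ball_simps image_insert image_empty
    by (intro conjI; elim conjE) (rule *; simp)+
  have "arithmetical (induction_ax p)" if "is_Sigma n p" for p n
    using arithmetical_Sigma[OF that] by (simp add: induction_ax_def inst_def)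
  then show I: "models M (ISigma n) \<Longrightarrow> models K (ISigma n)" for n
    unfolding ISigma_def models_Un models_Union using PA * by auto
  have "arithmetical (bounding_ax p)" if "is_Sigma n p" for p
    using arithmetical_Sigma[OF that] by (simp add: bounding_ax_def)
  then show "models M (BSigma n) \<Longrightarrow> models K (BSigma n)"
    unfolding BSigma_def models_Un models_Union using I * by auto
qed

section \<open>The cut generated by a submodel\<close>

primrec all_less :: "nat \<Rightarrow> nat \<Rightarrow> fm" where
  "all_less 0 m = Imp Fls Fls"
| "all_less (Suc i) m = Conj (all_less i m) (Less (Var i) (Var m))"

lemma sat_all_less [simp]: "sat M e s (all_less r m) \<longleftrightarrow> (\<forall>i<r. lessM M (e i) (e m))"
  by (induction r) (auto simp: less_Suc_eq)

lemma isigma_mono: "isigma_model n M \<Longrightarrow> k \<le> n \<Longrightarrow> isigma_model k M"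
  using models_ISigma is_Sigma_mono unfolding isigma_model_def by blast

lemma tval_update [simp]: "tval (M\<lparr>num_dom := I, set_dom := S\<rparr>) e t = tval M e t"
  by (induction t) auto

locale cut_setup =
  fixes n :: nat and M :: "nat L2_struct" and s and K :: "nat L2_struct" and t j d
  assumes n: "n \<ge> 1" and M: "isigma_model n M" "set_dom M = range s"
    and K: "isigma_model n K" "set_dom K = range t"
    and j: "a \<in> num_dom M \<Longrightarrow> j a \<in> num_dom K"
    and elem: "arithmetical p \<Longrightarrow> env M e \<Longrightarrow> sat M e s p = sat K (j \<circ> e) t p"
    and d: "d \<in> num_dom K" "a \<in> num_dom M \<Longrightarrow> lessM K (j a) d"
begin

sublocale K: pa K using K(1) by (rule isigma_pa)
sublocale M: pa M using M(1) by (rule isigma_pa)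

definition I :: "nat set" where "I = {x \<in> num_dom K. \<exists>m\<in>num_dom M. lessM K x (j m)}"

text \<open>Every name keeps its index while its set is cut down to \<open>I\<close>, so that
  \<open>N\<close> and \<open>K\<close> can be compared name by name.\<close>

definition N :: "nat L2_struct" where "N = K\<lparr>num_dom := I, set_dom := range (\<lambda>i. t i \<inter> I)\<rparr>"

abbreviation u :: "nat \<Rightarrow> nat set" where "u \<equiv> (\<lambda>i. t i \<inter> I)"

lemma N_simps [simp]: "num_dom N = I" "zeroM N = zeroM K" "oneM N = oneM K" "addM N = addM K"
  "mulM N = mulM K" "lessM N = lessM K" "set_dom N = range u" "tval N e x = tval K e x"
  by (simp_all add: N_def)

lemma IK: "x \<in> I \<Longrightarrow> x \<in> num_dom K" by (simp add: I_def)

lemma env_N: "env N e \<Longrightarrow> env K e" by (simp add: env_def IK)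

lemma j_add: "a \<in> num_dom M \<Longrightarrow> b \<in> num_dom M \<Longrightarrow> j (addM M a b) = addM K (j a) (j b)"
  using elem[of "Eq (Var 0) (Add (Var 1) (Var 2))" "case_nat (addM M a b) (case_nat a (\<lambda>_. b))"]
  by (simp add: comp_def env_def split: nat.split)

lemma j_mul: "a \<in> num_dom M \<Longrightarrow> b \<in> num_dom M \<Longrightarrow> j (mulM M a b) = mulM K (j a) (j b)"
  using elem[of "Eq (Var 0) (Mul (Var 1) (Var 2))" "case_nat (mulM M a b) (case_nat a (\<lambda>_. b))"]
  by (simp add: comp_def env_def split: nat.split)

lemma j_one: "j (oneM M) = oneM K"
  using elem[of "Eq (Var 0) One" "\<lambda>_. oneM M"] by (simp add: env_def)

lemma j_less: "a \<in> num_dom M \<Longrightarrow> b \<in> num_dom M \<Longrightarrow> lessM K (j a) (j b) = lessM M a b"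
  using elem[of "Less (Var 0) (Var 1)" "case_nat a (\<lambda>_. b)"]
  by (simp add: comp_def env_def split: nat.split)

lemma j_I: "a \<in> num_dom M \<Longrightarrow> j a \<in> I"
  unfolding I_def using j M.less_suc[of a] j_less[of a "addM M a (oneM M)"] M.closed(2,3) by blast

lemma I_down: "x \<in> I \<Longrightarrow> y \<in> num_dom K \<Longrightarrow> lessM K y x \<Longrightarrow> y \<in> I"
  unfolding I_def using K.less_trans j by blast

lemma I_add: "x \<in> I \<Longrightarrow> y \<in> I \<Longrightarrow> addM K x y \<in> I"
proof -
  assume "x \<in> I" "y \<in> I"
  then obtain a b where ab: "x \<in> num_dom K" "a \<in> num_dom M" "lessM K x (j a)"
    "y \<in> num_dom K" "b \<in> num_dom M" "lessM K y (j b)" unfolding I_def by blast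
  then have "lessM K (addM K x y) (j (addM M a b))" using K.add_less_mono j j_add by simp
  then show ?thesis unfolding I_def using ab M.closed by auto
qed

lemma I_mul: "x \<in> I \<Longrightarrow> y \<in> I \<Longrightarrow> mulM K x y \<in> I"
proof -
  assume "x \<in> I" "y \<in> I"
  then obtain a b where ab: "x \<in> num_dom K" "a \<in> num_dom M" "lessM K x (j a)"
    "y \<in> num_dom K" "b \<in> num_dom M" "lessM K y (j b)" unfolding I_def by blast
  then have "lessM K (mulM K x y) (j (mulM M a b))" using K.mul_less_mono j j_mul by simp
  then show ?thesis unfolding I_def using ab M.closed by auto
qed

lemma I_one: "oneM K \<in> I" using j_I j_one M.closed(2) by metis

lemma I_zero: "zeroM K \<in> I"
  using I_down[OF I_one] K.zero_less_one K.closed by blast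

lemma above_I: "z \<in> num_dom K \<Longrightarrow> z \<notin> I \<Longrightarrow> x \<in> I \<Longrightarrow> lessM K x z"
  using K.less_linear'[of x z] I_down IK by blast

lemma d_above: "d \<notin> I"
proof
  assume "d \<in> I"
  then obtain m where "m \<in> num_dom M" "lessM K d (j m)" unfolding I_def by blast
  then show False using d K.less_asym j by blast
qed

lemma L2_N: "L2_structure N"
  unfolding L2_structure_def using I_zero I_one I_add I_mul by auto

lemma pam_N: "pam N"
proof -
  \<comment> \<open>The only existential axiom provides differences, and these do not exceed the
    minuend.\<close>
  have "d \<in> I" if "x \<in> I" "y \<in> I" "d \<in> num_dom K" "addM K x d = y" for x y d
    using that I_down K.le_add[of d x] K.comm(1)[of x d] IK by metis
  then show ?thesis
    using K.pam IK unfolding pam_def N_simps by (smt (verit, best))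
qed

lemma Delta0_absolute: "is_Delta0 p \<Longrightarrow> env N e \<Longrightarrow> sat N e u p = sat K e t p"
proof (induction arbitrary: e rule: is_Delta0.induct)
  case (4 x X)
  then have "tval N e x \<in> I" using tval_dom[OF L2_N, of e x] by simp
  then show ?case by simp
next
  case (6 p x)
  have x: "tval K e x \<in> I" using tval_dom[OF L2_N 6(3), of x] by simp
  have "sat N (case_nat a e) u p = sat K (case_nat a e) t p" if "a \<in> I" for a
    using 6 that by simp
  then show ?case using I_down[OF x] IK by auto
qed auto

text \<open>The parameters lie below \<open>j m\<close> for a single \<open>m\<close>. Strong
  collection in \<open>M\<close> yields a \<open>b\<close> that bounds witnesses for all parameters
  below \<open>m\<close> at once. This is an arithmetical fact about \<open>m\<close> and
  \<open>b\<close>, so it holds in \<open>K\<close> as well, and a witness below \<open>j b\<close>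
  belongs to the cut.\<close>

lemma absolute_ExN:
  assumes p: "isS {M} n p" "arithmetical p" and e: "env N e"
    and IH: "\<And>e. env N e \<Longrightarrow> sat N e u p = sat K e t p"
  shows "sat N e u (ExN p) = sat K e t (ExN p)"
proof
  assume "sat N e u (ExN p)"
  then show "sat K e t (ExN p)" using IH e IK by auto
next
  assume R: "sat K e t (ExN p)"
  obtain r' where "fv_below r' r' p" using ex_fv_below by blast
  \<comment> \<open>Variable 0 is the witness; the other free variables are among the
    \<open>r\<close> parameters.\<close>
  then obtain r where r: "fvN p \<subseteq> {..<Suc r}" unfolding fv_below_iff by (meson lessThan_subset_iff le_SucI order.trans order_refl)
  have "\<forall>i<r. \<exists>m\<in>num_dom M. lessM K (e i) (j m)" using e by (simp add: env_def I_def)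
  then obtain f where f: "\<And>i. i < r \<Longrightarrow> f i \<in> num_dom M \<and> lessM K (e i) (j (f i))" by metis
  obtain m where m: "m \<in> num_dom M" "\<And>i. i < r \<Longrightarrow> lessM M (f i) m"
    using M.finite_bound[of "f ` {..<r}"] f by auto
  have em: "lessM K (e i) (j m)" if "i < r" for i
    using K.less_trans[of "e i" "j (f i)" "j m"] f[OF that] m j j_less that e IK by (simp add: env_def)
  have sM: "senv M s" using M(2) by (simp add: senv_def)
  obtain b where b: "b \<in> num_dom M" "\<And>e'. env M e' \<Longrightarrow> \<forall>i<r. lessM M (e' i) m \<Longrightarrow> \<forall>i\<ge>r. e' i = m \<Longrightarrow>
      \<exists>y\<in>num_dom M. sat M (case_nat y e') s p \<Longrightarrow>
      \<exists>y\<in>num_dom M. lessM M y b \<and> sat M (case_nat y e') s p"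
    using strong_collection[OF M(1) n p(1), of "\<lambda>_. m" s m r] m sM
    by (auto simp: env_def)
  \<comment> \<open>Behind the \<open>r\<close> quantified parameters, \<open>m\<close> and
    \<open>b\<close> have the indices \<open>r\<close> and \<open>Suc r\<close>.\<close>
  let ?F = "(All ^^ r) (Imp (all_less r r) (Imp (ExN p) (BEx (Var (Suc r)) p)))"
  let ?c = "case_nat m (\<lambda>_. b)"
  have pc: "sat M' (case_nat y (\<lambda>i. if i < r then f i else g (i - r))) s' p =
      sat M' (case_nat y (\<lambda>i. if i < r then f i else h i)) s' p" for M' y f g h s'
    by (rule sat_cong) (use r in \<open>auto split: nat.split\<close>)
  have "sat M ?c s ?F"
    unfolding sat_All_pow
  proof (intro allI impI)
    fix f assume f: "\<forall>i<r. f i \<in> num_dom M"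
    let ?g = "\<lambda>i. if i < r then f i else ?c (i - r)" and ?e' = "\<lambda>i. if i < r then f i else m"
    have "env M ?e'" using f m by (simp add: env_def)
    then show "sat M ?g s (Imp (all_less r r) (Imp (ExN p) (BEx (Var (Suc r)) p)))"
      using b(2)[of ?e'] by (simp add: pc[of M _ f ?c s "\<lambda>_. m"])
  qed
  moreover have "arithmetical ((All ^^ k) q)" if "arithmetical q" for q k
    using that by (induction k) auto
  moreover have "arithmetical (all_less i k)" for i k by (induction i) auto
  moreover have "env M ?c" using m b by (simp add: env_def split: nat.split)
  ultimately have "sat K (j \<circ> ?c) t ?F"
    using elem[of ?F ?c] p(2) by simp
  then have "sat K (\<lambda>i. if i < r then e i else (j \<circ> ?c) (i - r)) t (Imp (all_less r r) (Imp (ExN p) (BEx (Var (Suc r)) p)))"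
    unfolding sat_All_pow using e IK by (simp add: env_def)
  then have "\<exists>y\<in>num_dom K. lessM K y (j b) \<and> sat K (case_nat y e) t p"
    using R em pc[of K _ e "j \<circ> ?c" t e] by simp
  then obtain y where y: "y \<in> num_dom K" "lessM K y (j b)" "sat K (case_nat y e) t p" by blast
  then have "y \<in> I" using I_down j_I b by blast
  then show "sat N e u (ExN p)" using y(3) IH e by auto
qed

text \<open>Strong collection is available for Sigma_n, so Tarski's criterion can be verified
  quantifier by quantifier up to level \<open>n\<close>.\<close>

lemma absolute:
  "is_Sigma k p \<Longrightarrow> k \<le> n \<Longrightarrow> env N e \<Longrightarrow> sat N e u p = sat K e t p"
  "is_Pi k p \<Longrightarrow> k \<le> n \<Longrightarrow> env N e \<Longrightarrow> sat N e u p = sat K e t p"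
proof (induction arbitrary: e and e rule: is_Sigma_is_Pi.inducts)
  case (4 k p)
  show ?case
    by (rule absolute_ExN) (use 4 isS_Sigma isS_mono arithmetical_Sigma in \<open>blast+\<close>)
next
  case (6 k p)
  have "sat N e u (ExN (Neg p)) = sat K e t (ExN (Neg p))"
    by (rule absolute_ExN) (use 6 isS_mono[OF isS_Neg_Pi[OF 6(1)] 6(3)] arithmetical_Pi in auto)
  then show ?case by simp blast
qed (auto simp: Delta0_absolute)

lemma absolute_ren: "is_Sigma k p \<Longrightarrow> k \<le> n \<Longrightarrow> env N e \<Longrightarrow> sat N e (\<lambda>i. u (\<rho> i)) p = sat K e (\<lambda>i. t (\<rho> i)) p"
  using absolute(1)[OF is_Sigma_subst[of k p Var \<rho>], of e] by (simp add: sat_subst)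

lemma senv_N:
  assumes "senv N \<sigma>"
  obtains \<rho> where "\<sigma> = (\<lambda>i. u (\<rho> i))"
proof -
  have "\<forall>i. \<exists>k. \<sigma> i = u k" using assms by (simp add: senv_def image_iff)
  then obtain \<rho> where "\<forall>i. \<sigma> i = u (\<rho> i)" by metis
  then show thesis using that by blast
qed

text \<open>A failure of the induction formula is a Pi_n fact and absolute. The least one in
  \<open>K\<close> is at most a failure in the cut and so lies inside it.\<close>

lemma isigma_N: "isigma_model n N"
proof -
  have "induct_at N e \<sigma> p" if p: "is_Sigma n p" and e: "env N e" and \<sigma>: "senv N \<sigma>" for p e \<sigma>
    unfolding induct_at_def
  proof (intro impI ballI, rule ccontr)
    obtain \<rho> where \<rho>: "\<sigma> = (\<lambda>i. u (\<rho> i))" using senv_N[OF \<sigma>] .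
    let ?t = "\<lambda>i. t (\<rho> i)"
    fix x0
    assume base: "sat N (case_nat (zeroM N) e) \<sigma> p"
      and step: "\<forall>x\<in>num_dom N. sat N (case_nat x e) \<sigma> p \<longrightarrow> sat N (case_nat (addM N x (oneM N)) e) \<sigma> p"
      and x0: "x0 \<in> num_dom N" "\<not> sat N (case_nat x0 e) \<sigma> p"
    have eq: "sat N (case_nat x e) \<sigma> p = sat K (case_nat x e) ?t p" if "x \<in> I" for x
      unfolding \<rho> using absolute_ren[OF p] e that by simp
    have x0K: "x0 \<in> num_dom K" "sat K (case_nat x0 e) ?t (Neg p)" using x0 eq IK by auto
    have tK: "senv K ?t" using K(2) by (simp add: senv_def)
    obtain x where x: "x \<in> num_dom K" "sat K (case_nat x e) ?t (Neg p)"
      "\<And>y. y \<in> num_dom K \<Longrightarrow> lessM K y x \<Longrightarrow> \<not> sat K (case_nat y e) ?t (Neg p)"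
      using least_Pi[OF K(1) env_N[OF e] tK isP_Neg[OF isS_Sigma[OF p]] x0K] by metis
    have xI: "x \<in> I"
      using x x0K K.less_linear'[of x x0] I_down[of x0 x] x0(1) by (metis N_simps(1))
    have "x \<noteq> zeroM K" using base eq[OF I_zero] x(2) by auto
    then obtain y where y: "y \<in> num_dom K" "x = addM K y (oneM K)" using K.pred x(1) by blast
    then have "lessM K y x" using K.less_suc by simp
    then have "y \<in> I" "sat K (case_nat y e) ?t p" using I_down xI y x(3) by auto
    then have "sat N (case_nat x e) \<sigma> p" using step eq y(2) by auto
    then show False using x(2) eq xI by simp
  qed
  moreover have "set_dom N \<noteq> {}" by simp
  ultimately show ?thesis
    using models_ISigma[OF L2_N] models_PA_minus[OF L2_N] pam_N L2_N unfolding isigma_model_def by blast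
qed

text \<open>After contraction to one quantifier over a Pi_n matrix \<open>T\<close>, any
  \<open>z\<close> above the cut bounds the witnesses, since they lie in the cut. The least
  \<open>z\<close> that bounds them must be in the cut: otherwise its predecessor, still above the
  cut, would do.\<close>

lemma BSigma_N: "models N (BSigma (Suc n))"
proof -
  have "bound_at N e \<sigma> p" if p: "is_Sigma (Suc n) p" and e: "env N e" and \<sigma>: "senv N \<sigma>" for p e \<sigma>
    unfolding bound_at_def
  proof (intro ballI impI)
    obtain \<rho> where \<rho>: "\<sigma> = (\<lambda>i. u (\<rho> i))" using senv_N[OF \<sigma>] .
    let ?p = "subst Var \<rho> p"
    have satp: "sat N e \<sigma> p = sat N e u ?p" for e by (simp add: \<rho> sat_subst)
    \<comment> \<open>One \<open>T\<close> for both models: witnesses come from \<open>N\<close>,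
      the least bound is found in \<open>K\<close>.\<close>
    obtain T where T: "is_Pi n T" "eqv {K, N} ?p (ExN T)"
      using contract[of "{K, N}" n ?p] K(1) isigma_N is_Sigma_subst[OF p] by blast
    have uN: "senv N u" and tK: "senv K t" using K(2) by (simp_all add: senv_def)
    have eqN: "sat N g u ?p \<longleftrightarrow> (\<exists>w\<in>I. sat K (case_nat w g) t T)" if "env N g" for g
    proof -
      have "sat N g u ?p = sat N g u (ExN T)" using T(2) L2_N that uN by (simp add: eqv_def)
      then show ?thesis using absolute(2)[OF T(1) order_refl] that by auto
    qed
    fix a
    assume a: "a \<in> num_dom N"
      and hyp: "\<forall>x\<in>num_dom N. lessM N x a \<longrightarrow> (\<exists>y\<in>num_dom N. sat N (case_nat y (case_nat x e)) \<sigma> p)"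
    let ?G = "BAll (Var 1) (BEx (Var 1) (BEx (Var 2) (ren (case_nat 0 (case_nat 1 (case_nat 2 drop5))) T)))"
    have satG: "sat K (case_nat z (case_nat a e)) t ?G \<longleftrightarrow> (\<forall>x\<in>num_dom K. lessM K x a \<longrightarrow>
        (\<exists>y\<in>num_dom K. lessM K y z \<and> (\<exists>w\<in>num_dom K. lessM K w z \<and>
          sat K (case_nat w (case_nat y (case_nat x e))) t T)))" for z
      by simp
    have wit: "\<exists>y\<in>I. \<exists>w\<in>I. sat K (case_nat w (case_nat y (case_nat x e))) t T"
      if x: "x \<in> num_dom K" "lessM K x a" for x
    proof -
      have "x \<in> I" using x a I_down by simp
      moreover from this obtain y where "y \<in> I" "sat N (case_nat y (case_nat x e)) \<sigma> p" using hyp x by auto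
      ultimately show ?thesis using eqN[of "case_nat y (case_nat x e)"] satp e by auto
    qed
    have G: "sat K (case_nat z (case_nat a e)) t ?G" if "z \<in> num_dom K" "z \<notin> I" for z
      unfolding satG using wit above_I[OF that] IK by meson
    have PG: "isP {K} n ?G"
      by (intro isP_BAll isP_BEx[of "{K}" n] isP_ren isP_Pi[OF T(1)]) (use K in auto)
    have ea: "env K (case_nat a e)" using a e env_N IK by simp
    obtain z where z: "z \<in> num_dom K" "sat K (case_nat z (case_nat a e)) t ?G"
      "\<And>y. y \<in> num_dom K \<Longrightarrow> lessM K y z \<Longrightarrow> \<not> sat K (case_nat y (case_nat a e)) t ?G"
      using least_Pi[OF K(1) ea tK PG d(1) G[OF d(1) d_above]] by metis
    have zI: "z \<in> I"
    proof (rule ccontr)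
      assume nz: "z \<notin> I"
      then have "z \<noteq> zeroM K" using I_zero by auto
      then obtain y where y: "y \<in> num_dom K" "z = addM K y (oneM K)" using K.pred z(1) by blast
      then have "y \<notin> I" using nz I_add I_one by blast
      then show False using z(3)[OF y(1)] G y K.less_suc by blast
    qed
    show "\<exists>b\<in>num_dom N. \<forall>x\<in>num_dom N. lessM N x a \<longrightarrow>
        (\<exists>y\<in>num_dom N. lessM N y b \<and> sat N (case_nat y (case_nat x e)) \<sigma> p)"
    proof (rule bexI[of _ z], intro ballI impI)
      fix x assume x: "x \<in> num_dom N" "lessM N x a"
      then obtain y w where yw: "y \<in> num_dom K" "lessM K y z" "w \<in> num_dom K" "lessM K w z"
        "sat K (case_nat w (case_nat y (case_nat x e))) t T"
        using z(2) IK unfolding satG by auto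
      then have "y \<in> I" "w \<in> I" using I_down zI by blast+
      then show "\<exists>y\<in>num_dom N. lessM N y z \<and> sat N (case_nat y (case_nat x e)) \<sigma> p"
        using yw eqN[of "case_nat y (case_nat x e)"] satp e x by auto
    qed (use zI in simp)
  qed
  moreover have "models N (ISigma 0)"
    using isigma_mono[OF isigma_N, of 0] unfolding isigma_model_def by simp
  moreover have "set_dom N \<noteq> {}" by simp
  ultimately show ?thesis using models_BSigma[OF L2_N] by blast
qed

text \<open>The Pi_n matrix is absolute between the cut and \<open>K\<close>. Witnesses in the cut
  are also witnesses in \<open>K\<close>, from where elementarity leads back to \<open>M\<close>;
  conversely \<open>j\<close> maps witnesses into the cut.\<close>

lemma Sigma_Suc_elementary:
  assumes p: "is_Sigma (Suc n) p" and e: "env M e"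
  shows "sat M e s p = sat N (j \<circ> e) u p"
proof
  assume "sat N (j \<circ> e) u p"
  moreover have "sat N g u p \<Longrightarrow> env N g \<Longrightarrow> sat K g t p" for g
    using p
  proof (induction arbitrary: g rule: Sigma_Suc_induct)
    case (Pi p)
    then show ?case using absolute(2) by blast
  next
    case (ExN p)
    then obtain a where "a \<in> I" "sat N (case_nat a g) u p" by auto
    then have "sat K (case_nat a g) t p" using ExN.IH[of "case_nat a g"] ExN.prems by simp
    then show ?case using IK[OF \<open>a \<in> I\<close>] by auto
  qed
  moreover have "env N (j \<circ> e)" using e j_I by (simp add: env_def)
  ultimately show "sat M e s p" using elem[OF arithmetical_Sigma[OF p] e] by blast
next
  show "sat M e s p \<Longrightarrow> sat N (j \<circ> e) u p"
    using p e
  proof (induction arbitrary: e rule: Sigma_Suc_induct)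
    case (Pi p)
    moreover have "env N (j \<circ> e)" using Pi j_I by (simp add: env_def)
    ultimately show ?case using absolute(2)[OF Pi(1) order_refl] elem[OF arithmetical_Pi[OF Pi(1)]] by blast
  next
    case (ExN p)
    then obtain a where a: "a \<in> num_dom M" "sat M (case_nat a e) s p" by auto
    then have "sat N (j \<circ> case_nat a e) u p" using ExN.IH[of "case_nat a e", unfolded env_case_nat] ExN.prems by blast
    then have "sat N (case_nat (j a) (j \<circ> e)) u p" by simp
    then show ?case unfolding sat_simps N_simps(1) using j_I[OF a(1)] by blast
  qed
qed

end

theorem BSigma_extension:
  fixes M :: "nat L2_struct"
  assumes n: "n \<ge> 1" and M: "isigma_model n M" "set_dom M = range s"
  obtains K :: "nat L2_struct" and t j where
    "isigma_model n K" "recursively_saturated K" "set_dom K = range t" "models K (BSigma (Suc n))"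
    "\<And>a. a \<in> num_dom M \<Longrightarrow> j a \<in> num_dom K"
    "\<And>p e. is_Sigma (Suc n) p \<Longrightarrow> env M e \<Longrightarrow> sat M e s p = sat K (j \<circ> e) t p"
proof -
  interpret M: pa M using M(1) by (rule isigma_pa)
  have "senv M s" using M(2) by (simp add: senv_def)
  then obtain K0 :: "nat L2_struct" and t0 j0 d where K0: "L2_structure K0" "set_dom K0 = range t0"
    "\<And>a. a \<in> num_dom M \<Longrightarrow> j0 a \<in> num_dom K0"
    "\<And>p e. arithmetical p \<Longrightarrow> env M e \<Longrightarrow> sat M e s p = sat K0 (j0 \<circ> e) t0 p"
    "d \<in> num_dom K0" "\<And>a. a \<in> num_dom M \<Longrightarrow> lessM K0 (j0 a) d"
    using elementary_extension[OF M.L2 M.pam, of s] by metis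
  have "models K0 (ISigma n)"
    using models_transfer(1)[OF M.L2 M(2) K0(1,2,4), of n] M(1) by (simp add: isigma_model_def)
  then have "isigma_model n K0" using K0(1,2) by (simp add: isigma_model_def)
  then interpret cut_setup n M s K0 t0 j0 d
    using n M K0 by unfold_locales
  have "senv N u" by (simp add: senv_def)
  then obtain K1 :: "nat L2_struct" and t1 j1 where K1: "L2_structure K1" "recursively_saturated K1" "set_dom K1 = range t1"
    "\<And>a. a \<in> num_dom N \<Longrightarrow> j1 a \<in> num_dom K1"
    "\<And>p e. arithmetical p \<Longrightarrow> env N e \<Longrightarrow> sat N e u p = sat K1 (j1 \<circ> e) t1 p"
    using elementary_extension[OF L2_N pam_N, of u] by metis
  note tr = models_transfer[OF L2_N N_simps(7) K1(1,3,5)]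
  show thesis
  proof
    show "isigma_model n K1" using tr(1)[of n] isigma_N K1(1,3) by (simp add: isigma_model_def)
    show "recursively_saturated K1" "set_dom K1 = range t1" by fact+
    show "models K1 (BSigma (Suc n))" using tr(2) BSigma_N by blast
    show "(j1 \<circ> j0) a \<in> num_dom K1" if "a \<in> num_dom M" for a using j_I[OF that] K1(4) by simp
    show "sat M e s p = sat K1 ((j1 \<circ> j0) \<circ> e) t1 p" if p: "is_Sigma (Suc n) p" and e: "env M e" for p e
    proof -
      have "env N (j0 \<circ> e)" using e j_I by (simp add: env_def)
      then show ?thesis
        using Sigma_Suc_elementary[OF p e] K1(5)[OF arithmetical_Sigma[OF p]] by (simp add: comp_assoc)
    qed
  qed
qed

section \<open>Isomorphic copies\<close>

text \<open>The extension theorem yields an embedding, whereas the union of a chain needs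
  inclusions; a copy along a renaming mediates.\<close>

definition image_struct :: "('a \<Rightarrow> 'b) \<Rightarrow> 'a L2_struct \<Rightarrow> 'b L2_struct" where
  "image_struct f K = (let g = inv_into (num_dom K) f in
     \<lparr>num_dom = f ` num_dom K, zeroM = f (zeroM K), oneM = f (oneM K),
      addM = (\<lambda>a b. f (addM K (g a) (g b))), mulM = (\<lambda>a b. f (mulM K (g a) (g b))),
      lessM = (\<lambda>a b. lessM K (g a) (g b)), set_dom = (`) f ` set_dom K\<rparr>)"

locale iso =
  fixes f :: "'a \<Rightarrow> 'b" and K :: "'a L2_struct"
  assumes K: "L2_structure K" and inj: "inj_on f (num_dom K)"
begin

abbreviation "K' \<equiv> image_struct f K"

lemma dom_simps [simp]: "num_dom K' = f ` num_dom K" "set_dom K' = (`) f ` set_dom K"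
  by (simp_all add: image_struct_def Let_def)

lemma sub_dom: "A \<in> set_dom K \<Longrightarrow> A \<subseteq> num_dom K"
  using K by (auto simp: L2_structure_def)

lemma L2': "L2_structure K'"
proof -
  have "(`) f ` set_dom K \<subseteq> Pow (f ` num_dom K)" using sub_dom by (blast intro: image_mono)
  then show ?thesis using K inj by (simp add: L2_structure_def image_struct_def Let_def)
qed

lemma tval': "env K e \<Longrightarrow> tval K' (f \<circ> e) t = f (tval K e t)"
proof (induction t)
  case (Add t u)
  then show ?case using tval_dom[OF K] inj by (simp add: image_struct_def Let_def)
next
  case (Mul t u)
  then show ?case using tval_dom[OF K] inj by (simp add: image_struct_def Let_def)
qed (simp_all add: image_struct_def Let_def)

lemma sat': "env K e \<Longrightarrow> (\<And>i. s i \<subseteq> num_dom K) \<Longrightarrow> sat K' (f \<circ> e) (\<lambda>i. f ` s i) p = sat K e s p"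
proof (induction p arbitrary: e s)
  case (Eq t u)
  then show ?case
    by (simp only: sat.simps tval'[OF Eq(1)] inj_on_eq_iff[OF inj] tval_dom[OF K Eq(1)])
next
  case (Less t u)
  have "lessM K' (f a) (f b) = lessM K a b" if "a \<in> num_dom K" "b \<in> num_dom K" for a b
    using that inj by (simp add: image_struct_def Let_def)
  then show ?case by (simp only: sat.simps tval'[OF Less(1)] tval_dom[OF K Less(1)])
next
  case (Mem t X)
  then show ?case
    by (simp only: sat.simps tval'[OF Mem(1)] inj_on_image_mem_iff[OF inj tval_dom[OF K Mem(1)] Mem(2)])
next
  case (All p)
  have "sat K' (case_nat (f a) (f \<circ> e)) (\<lambda>i. f ` s i) p = sat K (case_nat a e) s p" if "a \<in> num_dom K" for a
    using All.IH[of "case_nat a e" s] All.prems that by simp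
  then show ?case by (simp only: sat.simps dom_simps ball_simps cong: ball_cong)
next
  case (AllS p)
  have "sat K' (f \<circ> e) (case_nat (f ` A) (\<lambda>i. f ` s i)) p = sat K e (case_nat A s) p" if "A \<in> set_dom K" for A
  proof -
    have A: "A \<subseteq> num_dom K" using that K by (auto simp: L2_structure_def)
    have "case_nat A s i \<subseteq> num_dom K" for i using A AllS.prems(2) by (cases i) auto
    then have "sat K' (f \<circ> e) (\<lambda>i. f ` case_nat A s i) p = sat K e (case_nat A s) p"
      using AllS.prems(1) by (intro AllS.IH)
    moreover have "(\<lambda>i. f ` case_nat A s i) = case_nat (f ` A) (\<lambda>i. f ` s i)"
      by (auto simp: fun_eq_iff split: nat.split)
    ultimately show ?thesis by (simp only:)
  qed
  then show ?case by (simp only: sat.simps dom_simps ball_simps cong: ball_cong)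
qed auto

lemma models':
  assumes "\<And>p. p \<in> T \<Longrightarrow> sentence p" "models K T"
  shows "models K' T"
  unfolding models_def
proof (intro ballI allI)
  fix p e s assume p: "p \<in> T"
  obtain a where a: "a \<in> num_dom K" using L2_nonempty[OF K] by blast
  have "sat K' (f \<circ> (\<lambda>_. a)) (\<lambda>i. f ` {}) p = sat K (\<lambda>_. a) (\<lambda>_. {}) p"
    using a by (intro sat') (auto simp: env_def)
  then have "sat K' (f \<circ> (\<lambda>_. a)) (\<lambda>i. f ` {}) p" using assms(2) p unfolding models_def by blast
  then show "sat K' e s p" using sentence_cong[OF assms(1)[OF p]] by blast
qed

lemma recursively_saturated':
  assumes rs: "recursively_saturated K"
  shows "recursively_saturated K'"
  unfolding recursively_saturated_def
proof (intro allI impI)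
  fix k m p e s
  assume p: "\<forall>\<phi>\<in>p. arithmetical \<phi> \<and> fv_below (Suc k) m \<phi>" "recursive_set (code ` p)"
    and e: "\<forall>i<k. e i \<in> num_dom K'" and s: "\<forall>i<m. s i \<in> set_dom K'"
    and F: "\<forall>F. finite F \<and> F \<subseteq> p \<longrightarrow> (\<exists>a\<in>num_dom K'. \<forall>\<phi>\<in>F. sat K' (case_nat a e) s \<phi>)"
  obtain a0 where a0: "a0 \<in> num_dom K" using L2_nonempty[OF K] by blast
  have "\<forall>i<k. \<exists>a. a \<in> num_dom K \<and> e i = f a" using e by auto
  then obtain e1 where e1: "\<forall>i<k. e1 i \<in> num_dom K \<and> e i = f (e1 i)" by metis
  have "\<forall>i<m. \<exists>A. A \<in> set_dom K \<and> s i = f ` A" using s by auto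
  then obtain s1 where s1: "\<forall>i<m. s1 i \<in> set_dom K \<and> s i = f ` s1 i" by metis
  define e0 where "e0 = (\<lambda>i. if i < k then e1 i else a0)"
  define s0 where "s0 = (\<lambda>i. if i < m then s1 i else {})"
  have eq: "sat K' (case_nat (f a) e) s \<phi> = sat K (case_nat a e0) s0 \<phi>" if "\<phi> \<in> p" "a \<in> num_dom K" for \<phi> a
  proof -
    have fv: "fvN \<phi> \<subseteq> {..<Suc k}" "fvS \<phi> \<subseteq> {..<m}" using p(1) that(1) by (auto simp: fv_below_iff)
    have "sat K' (f \<circ> case_nat a e0) (\<lambda>i. f ` s0 i) \<phi> = sat K (case_nat a e0) s0 \<phi>"
      using that(2) e1 a0 s1 sub_dom by (intro sat') (auto simp: env_def e0_def s0_def split: nat.split)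
    moreover have "sat K' (case_nat (f a) e) s \<phi> = sat K' (f \<circ> case_nat a e0) (\<lambda>i. f ` s0 i) \<phi>"
      by (rule sat_cong) (use fv e1 s1 in \<open>auto simp: e0_def s0_def split: nat.split\<close>)
    ultimately show ?thesis by simp
  qed
  have "\<exists>a\<in>num_dom K. \<forall>\<phi>\<in>F. sat K (case_nat a e0) s0 \<phi>" if "finite F" "F \<subseteq> p" for F
  proof -
    obtain b where "b \<in> num_dom K'" "\<forall>\<phi>\<in>F. sat K' (case_nat b e) s \<phi>" using F \<open>finite F\<close> \<open>F \<subseteq> p\<close> by metis
    moreover from this obtain a where "a \<in> num_dom K" "b = f a" by auto
    ultimately show ?thesis using eq \<open>F \<subseteq> p\<close> by blast
  qed
  moreover have "\<forall>i<k. e0 i \<in> num_dom K" "\<forall>i<m. s0 i \<in> set_dom K" using e1 s1 by (simp_all add: e0_def s0_def)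
  ultimately have "\<exists>a\<in>num_dom K. \<forall>\<phi>\<in>p. sat K (case_nat a e0) s0 \<phi>"
    using p rs[unfolded recursively_saturated_def, THEN spec[of _ k], THEN spec[of _ m],
        THEN spec[of _ p], THEN spec[of _ e0], THEN spec[of _ s0]] by simp
  then obtain a where "a \<in> num_dom K" "\<forall>\<phi>\<in>p. sat K (case_nat a e0) s0 \<phi>" by blast
  then show "\<exists>a\<in>num_dom K'. \<forall>\<phi>\<in>p. sat K' (case_nat a e) s \<phi>"
    by (intro bexI[of _ "f a"] ballI) (simp_all add: eq)
qed

end

lemma sentence_ISigma: "p \<in> ISigma n \<Longrightarrow> sentence p"
  by (auto simp: ISigma_def PA_minus_def Let_def closures_def)

lemma sentence_BSigma: "p \<in> BSigma n \<Longrightarrow> sentence p"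
  using sentence_ISigma[of p 0] by (auto simp: BSigma_def closures_def)

text \<open>The elements added at step \<open>k\<close> of the chain are pairs with first component \<open>k\<close>.\<close>

definition level_below :: "nat \<Rightarrow> nat set" where
  "level_below k = {y. fst (prod_decode y) < k}"

lemma BSigma_extension_incl:
  fixes M :: "nat L2_struct"
  assumes n: "n \<ge> 1" and M: "isigma_model n M" "set_dom M = range s" "num_dom M \<subseteq> level_below k"
  obtains K :: "nat L2_struct" and t where
    "isigma_model n K" "recursively_saturated K" "set_dom K = range t" "models K (BSigma (Suc n))"
    "num_dom M \<subseteq> num_dom K" "num_dom K \<subseteq> level_below (Suc k)"
    "\<And>p e. is_Sigma (Suc n) p \<Longrightarrow> env M e \<Longrightarrow> sat M e s p = sat K e t p"
proof -
  obtain K :: "nat L2_struct" and t j where ext: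
    "isigma_model n K" "recursively_saturated K" "set_dom K = range t" "models K (BSigma (Suc n))"
    "\<And>a. a \<in> num_dom M \<Longrightarrow> j a \<in> num_dom K"
    "\<And>p e. is_Sigma (Suc n) p \<Longrightarrow> env M e \<Longrightarrow> sat M e s p = sat K (j \<circ> e) t p"
    using BSigma_extension[OF n M(1,2)] by metis
  interpret M: pa M using M(1) by (rule isigma_pa)
  \<comment> \<open>Equality is among the preserved formulas, which makes \<open>j\<close>
    injective.\<close>
  have eq: "is_Sigma (Suc n) (Eq (Var 0) (Var 1))"
    using is_Sigma_mono[OF is_Sigma_is_Pi.intros(1)[OF is_Delta0.intros(2)]] by blast
  have inj_j: "inj_on j (num_dom M)"
  proof (rule inj_onI)
    fix a b assume ab: "a \<in> num_dom M" "b \<in> num_dom M" "j a = j b"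
    then have "env M (case_nat a (\<lambda>_. b))" by (simp add: env_def split: nat.split)
    then show "a = b" using ext(6)[OF eq] ab by fastforce
  qed
  \<comment> \<open>The image of \<open>M\<close> gets its old names back. A new element is named by
    a pair with first component \<open>k\<close>, which by assumption does not occur in
    \<open>M\<close>.\<close>
  define f where "f = (\<lambda>y. if y \<in> j ` num_dom M then inv_into (num_dom M) j y else prod_encode (k, y))"
  have fj: "f (j a) = a" if "a \<in> num_dom M" for a
    using that inj_j by (simp add: f_def)
  have new: "prod_encode (k, y) \<notin> num_dom M" for y
    using M(3) by (auto simp: level_below_def)
  have inj: "inj_on f (num_dom K)"
  proof (rule inj_onI)
    fix x y assume xy: "f x = f y"
    show "x = y"
      using xy new inj_j by (auto simp: f_def prod_encode_eq split: if_splits dest: inv_into_into)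
  qed
  have L2: "L2_structure K" using ext(1) by (simp add: isigma_model_def)
  interpret iso f K using L2 inj by unfold_locales
  have sub: "t i \<subseteq> num_dom K" for i using ext(3) sub_dom by blast
  show thesis
  proof
    show "isigma_model n K'" using models'[of "ISigma n"] sentence_ISigma ext(1) L2' by (simp add: isigma_model_def)
    show "recursively_saturated K'" by (rule recursively_saturated'[OF ext(2)])
    show "set_dom K' = range (\<lambda>i. f ` t i)" by (auto simp: ext(3))
    show "models K' (BSigma (Suc n))" using models'[of "BSigma (Suc n)"] sentence_BSigma ext(4) by blast
    show "num_dom M \<subseteq> num_dom K'" using ext(5) fj by (metis dom_simps(1) imageI subsetI)
    have "f y \<in> level_below (Suc k)" for y
      using M(3) inv_into_into[of y j "num_dom M"] by (auto simp: f_def level_below_def less_Suc_eq)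
    then show "num_dom K' \<subseteq> level_below (Suc k)" by auto
    fix p e assume p: "is_Sigma (Suc n) p" and e: "env M e"
    have "env K (j \<circ> e)" using e ext(5) by (simp add: env_def)
    then have "sat K' (f \<circ> (j \<circ> e)) (\<lambda>i. f ` t i) p = sat K (j \<circ> e) t p" using sat' sub by blast
    moreover have "f \<circ> (j \<circ> e) = e" using e fj by (simp add: env_def fun_eq_iff)
    ultimately show "sat M e s p = sat K' e (\<lambda>i. f ` t i) p" using ext(6)[OF p e] by simp
  qed
qed

section \<open>Adjoining a \<open>\<Delta>\<^sup>0\<^sub>1\<close>-definable set\<close>

text \<open>The set variables in \<open>J\<close> stand for the new set, whose positive occurrences are replaced by one of
  the two definitions and the negative ones by the other. The parameters of the definitions are found
  at the number variables from \<open>d\<close> on and at the odd set variables.\<close>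

primrec eliminate :: "fm \<Rightarrow> fm \<Rightarrow> nat set \<Rightarrow> bool \<Rightarrow> nat \<Rightarrow> fm \<Rightarrow> fm" where
  "eliminate \<phi> \<psi> J b d Fls = Fls"
| "eliminate \<phi> \<psi> J b d (Eq t u) = Eq t u"
| "eliminate \<phi> \<psi> J b d (Less t u) = Less t u"
| "eliminate \<phi> \<psi> J b d (Mem t X) = (if X \<in> J
     then subst (case_nat t (\<lambda>i. Var (d + i))) (\<lambda>i. 2 * i + 1) (if b then \<phi> else \<psi>) else Mem t (2 * X))"
| "eliminate \<phi> \<psi> J b d (Imp p q) = Imp (eliminate \<phi> \<psi> J (\<not> b) d p) (eliminate \<phi> \<psi> J b d q)"
| "eliminate \<phi> \<psi> J b d (All p) = All (eliminate \<phi> \<psi> J b (Suc d) p)"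
| "eliminate \<phi> \<psi> J b d (AllS p) = AllS p"

lemma eliminate_BAll: "eliminate \<phi> \<psi> J b d (BAll t p) = BAll t (eliminate \<phi> \<psi> J b (Suc d) p)"
  by (simp add: BAll_def)

lemma eliminate_ExN: "eliminate \<phi> \<psi> J b d (ExN p) = ExN (eliminate \<phi> \<psi> J b (Suc d) p)"
  by (simp add: ExN_def Neg_def)

text \<open>Both definitions yield \<open>Y\<close> in \<open>M\<close>, so the polarity
  \<open>b\<close> does not affect the meaning. It matters for the complexity of the result.\<close>

lemma sat_eliminate:
  assumes M: "L2_structure M" and "arithmetical p" "env M e" and "\<And>i. e (d + i) = e0 i"
    and J: "\<And>X. X \<in> J \<Longrightarrow> \<sigma> X = Y" "\<And>X. X \<notin> J \<Longrightarrow> s (2 * X) = \<sigma> X" "\<And>i. s (2 * i + 1) = s0 i"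
    and Y: "\<And>x. x \<in> num_dom M \<Longrightarrow> sat M (case_nat x e0) s0 \<phi> \<longleftrightarrow> x \<in> Y"
      "\<And>x. x \<in> num_dom M \<Longrightarrow> sat M (case_nat x e0) s0 \<psi> \<longleftrightarrow> x \<in> Y"
  shows "sat M e s (eliminate \<phi> \<psi> J b d p) = sat M e \<sigma> p"
  using assms(2-4)
proof (induction p arbitrary: e d b)
  case (Mem t X)
  have "(\<lambda>i. tval M e (case_nat t (\<lambda>i. Var (d + i)) i)) = case_nat (tval M e t) e0"
    using Mem by (auto simp: fun_eq_iff split: nat.split)
  then show ?case using J Y tval_dom[OF M, of e t] Mem by (auto simp: sat_subst)
next
  case (All p)
  have "sat M (case_nat a e) s (eliminate \<phi> \<psi> J b (Suc d) p) = sat M (case_nat a e) \<sigma> p"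
    if "a \<in> num_dom M" for a by (rule All.IH) (use All.prems that in auto)
  then show ?case by simp
qed auto

text \<open>With the Sigma_1 definition at positive and the Pi_1 definition at negative places the
  result is Sigma_1; with the roles exchanged it is Pi_1. Bounded quantifiers are absorbed thanks to
  Sigma_1 induction.\<close>

lemma isSP_eliminate_Delta0:
  assumes C: "\<And>M. M \<in> C \<Longrightarrow> isigma_model n M" "n \<ge> 1" and \<phi>: "is_Sigma 1 \<phi>" "is_Pi 1 \<psi>"
    and p: "is_Delta0 p"
  shows "isS C 1 (eliminate \<phi> \<psi> J True d p) \<and> isP C 1 (eliminate \<phi> \<psi> J False d p)"
  using p
proof (induction arbitrary: d rule: is_Delta0.induct)
  case (4 t X)
  show ?case
    using isS_subst[OF isS_Sigma[OF \<phi>(1)], of C] isP_subst[OF isP_Pi[OF \<phi>(2)], of C]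
    by (simp add: isS_Delta0 isP_Delta0 is_Delta0.intros)
next
  case (5 p q)
  then show ?case by (simp add: isS_Imp isP_Imp)
next
  case (6 p t)
  then show ?case using isS_BAll[OF C(1), of C 1] C(2) by (simp add: eliminate_BAll isP_BAll)
qed (simp_all add: isS_Delta0 isP_Delta0 is_Delta0.intros)

text \<open>The parity of \<open>k\<close> decides whether the innermost block, just above the
  Delta_0 matrix, is existential or universal. The definition is chosen so that its quantifiers join
  this block.\<close>

lemma isSP_eliminate:
  assumes C: "\<And>M. M \<in> C \<Longrightarrow> isigma_model n M" "n \<ge> 1" and \<phi>: "is_Sigma 1 \<phi>" "is_Pi 1 \<psi>"
  shows "is_Sigma k p \<Longrightarrow> k \<ge> 1 \<Longrightarrow> isS C k (eliminate \<phi> \<psi> J (odd k) d p)"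
    and "is_Pi k p \<Longrightarrow> k \<ge> 1 \<Longrightarrow> isP C k (eliminate \<phi> \<psi> J (even k) d p)"
proof (induction arbitrary: d and d rule: is_Sigma_is_Pi.inducts)
  case (3 k p)
  show ?case
  proof (cases k)
    case 0
    then show ?thesis using 3(1) isSP_eliminate_Delta0[OF C \<phi>] by (simp add: is_Pi_0)
  next
    case (Suc l)
    then show ?thesis using 3(2)[of d] isS_Suc_isP by simp
  qed
next
  case (5 k p)
  show ?case
  proof (cases k)
    case 0
    then show ?thesis using 5(1) isSP_eliminate_Delta0[OF C \<phi>] by (simp add: is_Sigma_0)
  next
    case (Suc l)
    then show ?thesis using 5(2)[of d] isP_Suc_isS by simp
  qed
next
  case (4 k p)
  then show ?case by (simp add: eliminate_ExN isS_ExN)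
next
  case (6 k p)
  then show ?case by (simp add: isP_All)
qed auto

lemma pam_set_dom: "pam (M\<lparr>set_dom := S\<rparr>) = pam M"
proof -
  have "num_dom (M\<lparr>set_dom := S\<rparr>) = num_dom M" "zeroM (M\<lparr>set_dom := S\<rparr>) = zeroM M" "oneM (M\<lparr>set_dom := S\<rparr>) = oneM M"
    "addM (M\<lparr>set_dom := S\<rparr>) = addM M" "mulM (M\<lparr>set_dom := S\<rparr>) = mulM M" "lessM (M\<lparr>set_dom := S\<rparr>) = lessM M"
    by simp_all
  then show ?thesis by (simp only: pam_def)
qed

text \<open>An induction axiom of the enlarged structure turns into one of \<open>M\<close> for the
  formula with the new set eliminated, which is equivalent to a Sigma_n formula.\<close>

lemma add_set_Delta1:
  fixes M :: "'a L2_struct"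
  assumes M: "isigma_model n M" "n \<ge> 1" and \<phi>: "is_Sigma 1 \<phi>" "is_Pi 1 \<psi>"
    and e0: "env M e0" "senv M s0"
    and eq: "\<And>x. x \<in> num_dom M \<Longrightarrow> sat M (case_nat x e0) s0 \<phi> = sat M (case_nat x e0) s0 \<psi>"
  defines "Y \<equiv> {x \<in> num_dom M. sat M (case_nat x e0) s0 \<phi>}"
  shows "isigma_model n (add_set Y M)"
proof -
  interpret pa M using M(1) by (rule isigma_pa)
  have [simp]: "num_dom (add_set Y M) = D" "set_dom (add_set Y M) = insert Y (set_dom M)"
    "zeroM (add_set Y M) = \<zero>" "oneM (add_set Y M) = \<one>" "addM (add_set Y M) = addM M"
    by (simp_all add: add_set_def)
  have L2': "L2_structure (add_set Y M)"
    using L2 by (auto simp: L2_structure_def add_set_def Y_def)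
  have sat': "sat (add_set Y M) e s p = sat M e s p" if "is_Sigma n p" for e s p
    unfolding add_set_def by (rule sat_set_dom[OF arithmetical_Sigma[OF that]])
  have "induct_at (add_set Y M) e \<sigma> p"
    if p: "is_Sigma n p" and e: "env (add_set Y M) e" and \<sigma>: "senv (add_set Y M) \<sigma>" for p e \<sigma>
  proof -
    obtain A where A: "A \<in> set_dom M" using M(1) unfolding isigma_model_def by blast
    obtain r where "fv_below r r p" using ex_fv_below by blast
    then have r: "fvN p \<subseteq> {..<Suc r}" unfolding fv_below_iff by fastforce
    \<comment> \<open>All set variables in \<open>J\<close> denote \<open>Y\<close>; if
      \<open>Y\<close> was already present, \<open>J\<close> is empty.\<close>
    define J where "J = {X. \<sigma> X \<notin> set_dom M}"
    \<comment> \<open>Even indices carry \<open>\<sigma>\<close>, odd ones the set parameters of the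
      definition. At the variables in \<open>J\<close>, which get eliminated, \<open>A\<close> is a
      filler.\<close>
    define s where "s = (\<lambda>i. if odd i then s0 (i div 2) else if i div 2 \<in> J then A else \<sigma> (i div 2))"
    \<comment> \<open>The number parameters of \<open>p\<close> come first, those of the definition
      after them.\<close>
    define e2 where "e2 = (\<lambda>i. if i < r then e i else e0 (i - r))"
    define q where "q = eliminate \<phi> \<psi> J (odd n) (Suc r) p"
    have s: "senv M s" using A e0 by (auto simp: senv_def s_def J_def)
    have e2: "env M e2" using e e0 by (simp add: env_def e2_def)
    have q: "isS {M} n q" unfolding q_def using isSP_eliminate(1)[OF _ M(2) \<phi> p M(2), of "{M}"] M(1) by blast
    have key: "sat (add_set Y M) (case_nat x e) \<sigma> p = sat M (case_nat x e2) s q" if x: "x \<in> D" for x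
    proof -
      have "sat M (case_nat x e2) s q = sat M (case_nat x e2) \<sigma> p"
        unfolding q_def
      proof (rule sat_eliminate[OF L2 arithmetical_Sigma[OF p], of "case_nat x e2" "Suc r" e0 J \<sigma> Y s s0])
        show "\<sigma> X = Y" if "X \<in> J" for X using that \<sigma> by (auto simp: J_def senv_def)
      qed (use x e2 eq in \<open>auto simp: e2_def s_def Y_def\<close>)
      moreover have "sat M (case_nat x e2) \<sigma> p = sat M (case_nat x e) \<sigma> p"
        by (rule sat_cong) (use r in \<open>auto simp: e2_def split: nat.split\<close>)
      ultimately show ?thesis using sat'[OF p] by simp
    qed
    show ?thesis unfolding induct_at_def
    proof (intro impI ballI)
      fix x assume base: "sat (add_set Y M) (case_nat (zeroM (add_set Y M)) e) \<sigma> p"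
        and step: "\<forall>x\<in>num_dom (add_set Y M). sat (add_set Y M) (case_nat x e) \<sigma> p \<longrightarrow>
          sat (add_set Y M) (case_nat (addM (add_set Y M) x (oneM (add_set Y M))) e) \<sigma> p"
        and x: "x \<in> num_dom (add_set Y M)"
      have "sat M (case_nat x e2) s q"
        by (rule isigma_induct[OF M(1) q e2 s]) (use base step x in \<open>simp_all add: key\<close>)
      then show "sat (add_set Y M) (case_nat x e) \<sigma> p" using key x by simp
    qed
  qed
  moreover have "pam (add_set Y M)" using pam unfolding add_set_def pam_set_dom .
  ultimately show ?thesis
    using models_ISigma[OF L2'] models_PA_minus[OF L2'] L2' unfolding isigma_model_def by auto
qed

section \<open>Unions of chains\<close>

text \<open>A sentence involves only finitely many values, and an assignment with finite range
  already lies in one member of a chain.\<close>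

lemma models_closures_finite:
  assumes "L2_structure M" "set_dom M \<noteq> {}"
    and *: "\<And>e s. env M e \<Longrightarrow> senv M s \<Longrightarrow> finite (range e) \<Longrightarrow> finite (range s) \<Longrightarrow> sat M e s p"
  shows "models M (closures p)"
  unfolding models_def
proof (intro ballI allI)
  obtain a A where a: "a \<in> num_dom M" "A \<in> set_dom M" using assms L2_nonempty by blast
  fix q e s assume "q \<in> closures p"
  then obtain k m where q: "sentence q" "q = (AllS ^^ m) ((All ^^ k) p)" unfolding closures_def by blast
  have "sat M (\<lambda>_. a) (\<lambda>_. A) q"
    unfolding q(2) sat_AllS_pow sat_All_pow
  proof (intro allI impI)
    fix f g assume f: "\<forall>i<m. f i \<in> set_dom M" and g: "\<forall>i<k. g i \<in> num_dom M"
    show "sat M (\<lambda>i. if i < k then g i else a) (\<lambda>i. if i < m then f i else A) p"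
    proof (rule *)
      show "env M (\<lambda>i. if i < k then g i else a)" using g a by (simp add: env_def)
      show "senv M (\<lambda>i. if i < m then f i else A)" using f a by (simp add: senv_def)
      show "finite (range (\<lambda>i. if i < k then g i else a))"
        by (rule finite_subset[of _ "insert a (g ` {..<k})"]) auto
      show "finite (range (\<lambda>i. if i < m then f i else A))"
        by (rule finite_subset[of _ "insert A (f ` {..<m})"]) auto
    qed
  qed
  then show "sat M e s q" using sentence_cong[OF q(1)] by blast
qed

lemma sat_clamp:
  assumes "fvS p \<subseteq> {..i}"
  shows "sat M e (\<lambda>X. s (if X \<le> i then X else 0)) p = sat M e s p"
  by (rule sat_cong) (use assms in auto)

text \<open>The equivalents obtained through \<open>isS\<close> may contain stray set variables.
  Sending those to 0 keeps the equivalence and leaves only names that are already fixed at stage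
  \<open>i\<close>.\<close>

lemma eqv_clamp:
  assumes "eqv C p q" "fvS p \<subseteq> {..i}"
  shows "eqv C p (subst Var (\<lambda>X. if X \<le> i then X else 0) q)"
  unfolding eqv_def sat_subst tval.simps
proof (intro ballI impI allI)
  fix M e s assume M: "M \<in> C" "L2_structure M" "env M e" "senv M s"
  have "senv M (\<lambda>X. s (if X \<le> i then X else 0))" using M by (simp add: senv_def)
  then have "sat M e (\<lambda>X. s (if X \<le> i then X else 0)) p = sat M e (\<lambda>X. s (if X \<le> i then X else 0)) q"
    using assms(1) M unfolding eqv_def by blast
  then show "sat M e s p = sat M e (\<lambda>X. s (if X \<le> i then X else 0)) q"
    by (simp only: sat_clamp[OF assms(2)])
qed

lemma fvS_clamp: "fvS (subst Var (\<lambda>X. if X \<le> i then X else 0) q) \<subseteq> {..i}"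
  by (auto simp: fv_subst)

lemma fvS_connectives [simp]:
  "fvS (Neg p) = fvS p" "fvS (ExN p) = fvS p" "fvS (BAll t p) = fvS p" "fvS (BEx t p) = fvS p" "fvS (ren f p) = fvS p"
  by (auto simp: Neg_def ExN_def BAll_def BEx_def ren_def fv_subst)

text \<open>On the way down the leading universal block only loses instances, and its Sigma_(n+1)
  matrix keeps its truth value.\<close>

lemma pi_downward:
  assumes sub: "num_dom M \<subseteq> num_dom K"
    and el: "\<And>p e. is_Sigma (Suc n) p \<Longrightarrow> fvS p \<subseteq> V \<Longrightarrow> env M e \<Longrightarrow> sat M e s p = sat K e t p"
    and p: "is_Pi (Suc (Suc n)) p" "fvS p \<subseteq> V" "env M e" "sat K e t p"
  shows "sat M e s p"
  using p
proof (induction arbitrary: e rule: Pi_Suc_induct)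
  case (Sigma p)
  then show ?case using el by blast
next
  case (All p)
  then show ?case using sub by auto
qed

text \<open>A name \<open>X\<close> has a lasting meaning only from stage \<open>X\<close> on, since
  each step assigns a new set to the next name; hence the restriction of elementarity at stage
  \<open>i\<close> to set variables up to \<open>i\<close>.\<close>

locale chain =
  fixes n :: nat and Mf :: "nat \<Rightarrow> 'a L2_struct" and sf :: "nat \<Rightarrow> nat \<Rightarrow> 'a set"
  assumes n: "n \<ge> 1" and Mf: "isigma_model n (Mf i)" "models (Mf i) (BSigma (Suc n))" "set_dom (Mf i) = range (sf i)"
    and incl: "num_dom (Mf i) \<subseteq> num_dom (Mf (Suc i))"
    and el: "is_Sigma (Suc n) p \<Longrightarrow> fvS p \<subseteq> {..i} \<Longrightarrow> env (Mf i) e \<Longrightarrow>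
      sat (Mf i) e (sf i) p = sat (Mf (Suc i)) e (sf (Suc i)) p"
begin

lemma Mf_L2: "L2_structure (Mf i)" and Mf_pam: "pam (Mf i)"
  using isigma_pa[OF Mf(1), of i] by (auto simp: pa_def)

lemma incl_le: "i \<le> j \<Longrightarrow> num_dom (Mf i) \<subseteq> num_dom (Mf j)"
  by (rule lift_Suc_mono_le[of "\<lambda>i. num_dom (Mf i)"]) (use incl in auto)

lemma env_le: "i \<le> j \<Longrightarrow> env (Mf i) e \<Longrightarrow> env (Mf j) e"
  using incl_le unfolding env_def by blast

lemma el_le:
  assumes "i \<le> j" "is_Sigma (Suc n) p" "fvS p \<subseteq> {..i}" "env (Mf i) e"
  shows "sat (Mf i) e (sf i) p = sat (Mf j) e (sf j) p"
  using assms(1)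
proof (induction j rule: dec_induct)
  case (step j)
  have "{..i} \<subseteq> {..j}" using step.hyps(1) by simp
  with assms(3) have "fvS p \<subseteq> {..j}" by (rule subset_trans)
  then have "sat (Mf j) e (sf j) p = sat (Mf (Suc j)) e (sf (Suc j)) p"
    by (rule el[OF assms(2) _ env_le[OF step.hyps(1) assms(4)]])
  with step.IH show ?case by (rule trans)
qed (rule refl)

lemma sf_senv: "senv (Mf i) (sf i)" "senv (Mf i) (\<lambda>X. sf i (\<rho> X))"
  by (simp_all add: senv_def Mf)

lemma el_isS: "i \<le> j \<Longrightarrow> isS {Mf i, Mf j} (Suc n) p \<Longrightarrow> fvS p \<subseteq> {..i} \<Longrightarrow> env (Mf i) e \<Longrightarrow>
    sat (Mf i) e (sf i) p = sat (Mf j) e (sf j) p"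
proof -
  assume a: "i \<le> j" "isS {Mf i, Mf j} (Suc n) p" "fvS p \<subseteq> {..i}" "env (Mf i) e"
  then obtain q where q: "is_Sigma (Suc n) q" "eqv {Mf i, Mf j} p q" unfolding isS_def by blast
  let ?q = "subst Var (\<lambda>X. if X \<le> i then X else 0) q"
  have eq: "eqv {Mf i, Mf j} p ?q" by (rule eqv_clamp[OF q(2) a(3)])
  have "sat (Mf i) e (sf i) ?q = sat (Mf j) e (sf j) ?q"
    using el_le[OF a(1) is_Sigma_subst[OF q(1)] fvS_clamp a(4)] .
  then show ?thesis using eq Mf_L2 a(4) env_le[OF a(1,4)] sf_senv(1) unfolding eqv_def by blast
qed

lemma el_isP: "i \<le> j \<Longrightarrow> isP {Mf i, Mf j} (Suc n) p \<Longrightarrow> fvS p \<subseteq> {..i} \<Longrightarrow> env (Mf i) e \<Longrightarrow>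
    sat (Mf i) e (sf i) p = sat (Mf j) e (sf j) p"
  using el_isS[of i j "Neg p" e] isS_Neg[of "{Mf i, Mf j}" "Suc n" p] by simp

definition stage :: "'a set \<Rightarrow> nat" where "stage A = (LEAST i. A \<subseteq> num_dom (Mf i))"

definition U :: "'a L2_struct" where
  "U = \<lparr>num_dom = (\<Union>i. num_dom (Mf i)), zeroM = zeroM (Mf 0), oneM = oneM (Mf 0),
     addM = (\<lambda>a b. addM (Mf (stage {a, b})) a b), mulM = (\<lambda>a b. mulM (Mf (stage {a, b})) a b),
     lessM = (\<lambda>a b. lessM (Mf (stage {a, b})) a b),
     set_dom = range (\<lambda>X. {x. \<exists>i\<ge>X. x \<in> num_dom (Mf i) \<and> x \<in> sf i X})\<rparr>"

definition sU :: "nat \<Rightarrow> 'a set" where "sU X = {x. \<exists>i\<ge>X. x \<in> num_dom (Mf i) \<and> x \<in> sf i X}"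

lemma stage: "A \<subseteq> num_dom (Mf i) \<Longrightarrow> stage A \<le> i \<and> A \<subseteq> num_dom (Mf (stage A))"
  unfolding stage_def by (metis (mono_tags, lifting) LeastI Least_le)

lemma el_Delta0: "i \<le> j \<Longrightarrow> is_Delta0 p \<Longrightarrow> fvS p \<subseteq> {..i} \<Longrightarrow> env (Mf i) e \<Longrightarrow>
    sat (Mf i) e (sf i) p = sat (Mf j) e (sf j) p"
  using el_le[of i j p e] is_Sigma_mono[of 0 p "Suc n"] by (simp add: is_Sigma_0)

lemma ops_le:
  assumes "i \<le> j" "a \<in> num_dom (Mf i)" "b \<in> num_dom (Mf i)"
  shows "addM (Mf i) a b = addM (Mf j) a b" "mulM (Mf i) a b = mulM (Mf j) a b" "lessM (Mf i) a b = lessM (Mf j) a b"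
proof -
  interpret pa "Mf i" using Mf(1) by (rule isigma_pa)
  have "env (Mf i) (case_nat c (case_nat a (\<lambda>_. b)))" if "c \<in> num_dom (Mf i)" for c
    using that assms by (simp add: env_def split: nat.split)
  then have e: "sat (Mf i) (case_nat c (case_nat a (\<lambda>_. b))) (sf i) p = sat (Mf j) (case_nat c (case_nat a (\<lambda>_. b))) (sf j) p"
    if "c \<in> num_dom (Mf i)" "is_Delta0 p" "fvS p = {}" for c p using el_Delta0[OF assms(1)] that by simp
  show "addM (Mf i) a b = addM (Mf j) a b"
    using e[of "addM (Mf i) a b" "Eq (Var 0) (Add (Var 1) (Var 2))"] assms by (simp add: is_Delta0.intros)
  show "mulM (Mf i) a b = mulM (Mf j) a b"
    using e[of "mulM (Mf i) a b" "Eq (Var 0) (Mul (Var 1) (Var 2))"] assms by (simp add: is_Delta0.intros)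
  show "lessM (Mf i) a b = lessM (Mf j) a b"
    using e[of a "Less (Var 1) (Var 2)"] assms by (simp add: is_Delta0.intros)
qed

lemma consts_le: "zeroM (Mf i) = zeroM (Mf 0)" "oneM (Mf i) = oneM (Mf 0)"
proof -
  have d: "zeroM (Mf 0) \<in> num_dom (Mf 0)" "oneM (Mf 0) \<in> num_dom (Mf 0)" using Mf_L2[of 0] by (simp_all add: L2_structure_def)
  show "zeroM (Mf i) = zeroM (Mf 0)"
    using el_Delta0[of 0 i "Eq (Var 0) Zero" "\<lambda>_. zeroM (Mf 0)"] d by (simp add: is_Delta0.intros env_def)
  show "oneM (Mf i) = oneM (Mf 0)"
    using el_Delta0[of 0 i "Eq (Var 0) One" "\<lambda>_. oneM (Mf 0)"] d by (simp add: is_Delta0.intros env_def)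
qed

lemma U_simps [simp]: "num_dom U = (\<Union>i. num_dom (Mf i))" "set_dom U = range sU"
  by (auto simp: U_def sU_def)

lemma U_consts: "zeroM U = zeroM (Mf i)" "oneM U = oneM (Mf i)"
  using consts_le[of i] by (simp_all add: U_def)

lemma ops_U:
  assumes "a \<in> num_dom (Mf i)" "b \<in> num_dom (Mf i)"
  shows "addM U a b = addM (Mf i) a b" "mulM U a b = mulM (Mf i) a b" "lessM U a b = lessM (Mf i) a b"
proof -
  have "stage {a, b} \<le> i \<and> {a, b} \<subseteq> num_dom (Mf (stage {a, b}))" by (rule stage) (use assms in simp)
  then show "addM U a b = addM (Mf i) a b" "mulM U a b = mulM (Mf i) a b" "lessM U a b = lessM (Mf i) a b"
    using ops_le[of "stage {a, b}" i a b] by (simp_all add: U_def)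
qed

lemma mem_sU:
  assumes "x \<in> num_dom (Mf i)" "X \<le> i"
  shows "x \<in> sU X \<longleftrightarrow> x \<in> sf i X"
proof -
  have *: "x \<in> sf j X \<longleftrightarrow> x \<in> sf k X" if "j \<le> k" "X \<le> j" "x \<in> num_dom (Mf j)" for j k
    using el_Delta0[OF that(1), of "Mem (Var 0) X" "\<lambda>_. x"] that by (simp add: is_Delta0.intros env_def)
  show ?thesis
  proof
    assume "x \<in> sU X"
    then obtain j where "j \<ge> X" "x \<in> num_dom (Mf j)" "x \<in> sf j X" unfolding sU_def by blast
    then show "x \<in> sf i X" using *[of i j] *[of j i] assms nat_le_linear[of i j] by blast
  qed (use assms in \<open>auto simp: sU_def\<close>)
qed

lemma tval_U: "env (Mf i) e \<Longrightarrow> tval U e t = tval (Mf i) e t"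
proof (induction t)
  case (Add t u)
  then show ?case using ops_U[of _ i] tval_dom[OF Mf_L2, of i e] by simp
next
  case (Mul t u)
  then show ?case using ops_U[of _ i] tval_dom[OF Mf_L2, of i e] by simp
qed (simp_all add: U_consts(1,2)[of i])

lemma in_later: "a \<in> num_dom U \<Longrightarrow> \<exists>j\<ge>i. a \<in> num_dom (Mf j)"
  using incl_le by (metis U_simps(1) UN_E max.cobounded1 max.cobounded2 subsetD)

lemma sat_U_Delta0: "is_Delta0 p \<Longrightarrow> fvS p \<subseteq> {..i} \<Longrightarrow> env (Mf i) e \<Longrightarrow> sat U e sU p = sat (Mf i) e (sf i) p"
proof (induction arbitrary: i e rule: is_Delta0.induct)
  case (3 t u)
  then show ?case using tval_U[of i e] ops_U(3) tval_dom[OF Mf_L2, of i e] by simp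
next
  case (4 t X)
  then show ?case using tval_U[of i e] mem_sU tval_dom[OF Mf_L2, of i e] by simp
next
  case (5 p q)
  have "sat U e sU p = sat (Mf i) e (sf i) p" "sat U e sU q = sat (Mf i) e (sf i) q"
    using 5 by simp_all
  then show ?case by simp
next
  case (6 p t)
  have less: "lessM U a (tval U e t) = lessM (Mf j) a (tval (Mf j) e t)" if "j \<ge> i" "a \<in> num_dom (Mf j)" for a j
    using tval_U[OF env_le[OF that(1) 6(4)]] ops_U(3)[OF that(2)] tval_dom[OF Mf_L2 env_le[OF that(1) 6(4)]] by simp
  have IH: "sat U (case_nat a e) sU p = sat (Mf j) (case_nat a e) (sf j) p" if "j \<ge> i" "a \<in> num_dom (Mf j)" for a j
  proof (rule 6(2))
    have "{..i} \<subseteq> {..j}" using that by auto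
    then show "fvS p \<subseteq> {..j}" using 6(3) by fastforce
    show "env (Mf j) (case_nat a e)" using that env_le 6(4) by auto
  qed
  show ?case
  proof
    assume "sat U e sU (BAll t p)"
    then show "sat (Mf i) e (sf i) (BAll t p)" using IH[OF order_refl] less[OF order_refl] by auto
  next
    assume L: "sat (Mf i) e (sf i) (BAll t p)"
    show "sat U e sU (BAll t p)"
      unfolding sat_simps
    proof (intro ballI impI)
      fix a assume a: "a \<in> num_dom U" "lessM U a (tval U e t)"
      obtain j where j: "j \<ge> i" "a \<in> num_dom (Mf j)" using in_later[OF a(1)] by blast
      have "sat (Mf j) e (sf j) (BAll t p)"
        using el_Delta0[OF j(1) _ 6(3,4)] is_Delta0.intros(6)[OF 6(1)] L by blast
      then show "sat U (case_nat a e) sU p" using IH[OF j] less[OF j] a(2) j(2) by simp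
    qed
  qed
qed (simp_all add: tval_U)

text \<open>Tarski's theorem on elementary chains, cut off at level n + 1. In the universal case an
  instance may enter late, but the universal formula, being of level at most n + 1, persists to that
  stage.\<close>

lemma sat_U:
  "is_Sigma k p \<Longrightarrow> k \<le> Suc n \<Longrightarrow> fvS p \<subseteq> {..i} \<Longrightarrow> env (Mf i) e \<Longrightarrow> sat U e sU p = sat (Mf i) e (sf i) p"
  "is_Pi k p \<Longrightarrow> k \<le> Suc n \<Longrightarrow> fvS p \<subseteq> {..i} \<Longrightarrow> env (Mf i) e \<Longrightarrow> sat U e sU p = sat (Mf i) e (sf i) p"
proof (induction arbitrary: i e and i e rule: is_Sigma_is_Pi.inducts)
  case (4 k p)
  have mono: "fvS p \<subseteq> {..j}" if "j \<ge> i" for j using 4(4) that by fastforce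
  show ?case
  proof
    assume "sat U e sU (ExN p)"
    then obtain a where a: "a \<in> num_dom U" "sat U (case_nat a e) sU p" unfolding sat_simps by blast
    obtain j where j: "j \<ge> i" "a \<in> num_dom (Mf j)" using in_later[OF a(1)] by blast
    then have "sat (Mf j) (case_nat a e) (sf j) p" using 4(2)[OF 4(3) mono] a env_le 4(5) by auto
    then have "sat (Mf j) e (sf j) (ExN p)" using j(2) unfolding sat_simps by blast
    then show "sat (Mf i) e (sf i) (ExN p)"
      using el_le[OF j(1) is_Sigma_mono[OF is_Sigma_is_Pi.intros(4)[OF 4(1)] 4(3)] 4(4,5)] by blast
  next
    assume "sat (Mf i) e (sf i) (ExN p)"
    then obtain a where a: "a \<in> num_dom (Mf i)" "sat (Mf i) (case_nat a e) (sf i) p" unfolding sat_simps by blast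
    then have "sat U (case_nat a e) sU p" using 4(2)[OF 4(3) mono, of i "case_nat a e"] 4(5) by simp
    then show "sat U e sU (ExN p)" using a(1) by auto
  qed
next
  case (6 k p)
  have mono: "fvS p \<subseteq> {..j}" if "j \<ge> i" for j using 6(4) that by fastforce
  show ?case
  proof
    assume "sat U e sU (All p)"
    moreover have "sat U (case_nat a e) sU p = sat (Mf i) (case_nat a e) (sf i) p" if "a \<in> num_dom (Mf i)" for a
      using 6(2)[OF 6(3) mono[OF order_refl], of "case_nat a e"] 6(5) that by simp
    ultimately show "sat (Mf i) e (sf i) (All p)" by auto
  next
    assume L: "sat (Mf i) e (sf i) (All p)"
    show "sat U e sU (All p)"
      unfolding sat.simps
    proof
      fix a assume a: "a \<in> num_dom U"
      obtain j where j: "j \<ge> i" "a \<in> num_dom (Mf j)" using in_later[OF a(1)] by blast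
      have "sat (Mf j) e (sf j) (All p)"
        using el_isP[OF j(1) isP_Pi[OF is_Pi_mono[OF is_Sigma_is_Pi.intros(6)[OF 6(1)] 6(3)]] 6(4,5)] L by blast
      then have "sat (Mf j) (case_nat a e) (sf j) p" using j(2) by simp
      then show "sat U (case_nat a e) sU p" using 6(2)[OF 6(3) mono, of j "case_nat a e"] j env_le 6(5) by auto
    qed
  qed
qed (auto simp: sat_U_Delta0)

lemma sat_U_ren: "is_Sigma k p \<Longrightarrow> k \<le> Suc n \<Longrightarrow> range \<rho> \<subseteq> {..i} \<Longrightarrow> env (Mf i) e \<Longrightarrow>
    sat U e (\<lambda>X. sU (\<rho> X)) p = sat (Mf i) e (\<lambda>X. sf i (\<rho> X)) p"
  using sat_U(1)[OF is_Sigma_subst[of k p Var \<rho>], of i e] by (auto simp: sat_subst fv_subst)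

lemma L2_U: "L2_structure U"
proof -
  have "addM U a b \<in> num_dom U \<and> mulM U a b \<in> num_dom U" if ab: "a \<in> num_dom U" "b \<in> num_dom U" for a b
  proof -
    obtain i where i: "a \<in> num_dom (Mf i)" using ab by auto
    obtain j where j: "j \<ge> i" "b \<in> num_dom (Mf j)" using in_later[OF ab(2)] by blast
    then have "a \<in> num_dom (Mf j)" using incl_le i by blast
    then show ?thesis using ops_U[of a j b] j Mf_L2[of j] by (auto simp: L2_structure_def)
  qed
  moreover have "set_dom U \<subseteq> Pow (num_dom U)" by (auto simp: sU_def)
  moreover have "zeroM (Mf 0) \<in> num_dom (Mf 0)" "oneM (Mf 0) \<in> num_dom (Mf 0)" using Mf_L2[of 0] by (simp_all add: L2_structure_def)
  moreover from this have "zeroM U \<in> num_dom U" "oneM U \<in> num_dom U"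
    unfolding U_consts(1,2)[of 0] U_simps by blast+
  ultimately show ?thesis unfolding L2_structure_def by simp
qed

lemma finite_stage: "finite A \<Longrightarrow> A \<subseteq> num_dom U \<Longrightarrow> \<exists>j\<ge>i. A \<subseteq> num_dom (Mf j)"
proof (induction rule: finite_induct)
  case (insert a A)
  then obtain j where j: "j \<ge> i" "A \<subseteq> num_dom (Mf j)" by blast
  obtain k where "k \<ge> j" "a \<in> num_dom (Mf k)" using in_later[of a j] insert by blast
  with j incl_le show ?case by (intro exI[of _ k]) auto
qed auto

lemma finite_envs:
  assumes "env U e" "senv U s" "finite (range e)" "finite (range s)"
  obtains \<rho> i where "s = (\<lambda>X. sU (\<rho> X))" "range \<rho> \<subseteq> {..i}" "env (Mf i) e"
proof -
  have "\<forall>A\<in>range s. \<exists>X. A = sU X" using assms(2) unfolding senv_def by auto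
  then obtain g where g: "\<And>A. A \<in> range s \<Longrightarrow> A = sU (g A)" by metis
  obtain m where m: "g ` range s \<subseteq> {..m}" using assms(4) finite_nat_iff_bounded_le by blast
  obtain j where "j \<ge> m" "range e \<subseteq> num_dom (Mf j)"
    using finite_stage[OF assms(3)] assms(1) unfolding env_def by blast
  moreover have "s = (\<lambda>X. sU (g (s X)))" using g by blast
  moreover have "g (s X) \<le> j" for X
  proof -
    have "g (s X) \<in> {..m}" using m by blast
    then show ?thesis using \<open>j \<ge> m\<close> by simp
  qed
  then have "range (\<lambda>X. g (s X)) \<subseteq> {..j}" by auto
  moreover have "env (Mf j) e" using \<open>range e \<subseteq> num_dom (Mf j)\<close> unfolding env_def by blast
  ultimately show thesis using that[of "\<lambda>X. g (s X)" j] by blast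
qed

section \<open>The axioms in the union\<close>

lemma pam_U: "pam U"
  unfolding pam_def
proof (intro ballI)
  fix x y z assume xyz: "x \<in> num_dom U" "y \<in> num_dom U" "z \<in> num_dom U"
  then obtain i where i: "{x, y, z} \<subseteq> num_dom (Mf i)" using finite_stage[of "{x, y, z}" 0] by auto
  interpret pa "Mf i" using Mf(1) by (rule isigma_pa)
  have D: "x \<in> D" "y \<in> D" "z \<in> D" using i by auto
  have ex: "lessM (Mf i) x y \<longrightarrow> (\<exists>d\<in>num_dom U. addM U x d = y)"
  proof
    assume "lessM (Mf i) x y"
    then obtain d where "d \<in> D" "addM (Mf i) x d = y" using less_sub[OF D] by blast
    then show "\<exists>d\<in>num_dom U. addM U x d = y" using ops_U(1)[OF D(1)] by auto
  qed
  note pam_i = pam[unfolded pam_def, THEN bspec[OF _ D(1)], THEN bspec[OF _ D(2)], THEN bspec[OF _ D(3)]]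
  show "addM U (addM U x y) z = addM U x (addM U y z) \<and>
     addM U x y = addM U y x \<and>
     mulM U (mulM U x y) z = mulM U x (mulM U y z) \<and>
     mulM U x y = mulM U y x \<and>
     mulM U x (addM U y z) = addM U (mulM U x y) (mulM U x z) \<and>
     addM U x (zeroM U) = x \<and> mulM U x (zeroM U) = zeroM U \<and> mulM U x (oneM U) = x \<and>
     \<not> lessM U x x \<and>
     (lessM U x y \<longrightarrow> lessM U y z \<longrightarrow> lessM U x z) \<and>
     (lessM U x y \<or> x = y \<or> lessM U y x) \<and>
     (lessM U x y \<longrightarrow> lessM U (addM U x z) (addM U y z)) \<and>
     (lessM U (zeroM U) z \<longrightarrow> lessM U x y \<longrightarrow> lessM U (mulM U x z) (mulM U y z)) \<and>
     (lessM U x y \<longrightarrow> (\<exists>d\<in>num_dom U. addM U x d = y)) \<and>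
     lessM U (zeroM U) (oneM U) \<and>
     (lessM U (zeroM U) x \<longrightarrow> lessM U (oneM U) x \<or> oneM U = x) \<and>
     (lessM U (zeroM U) x \<or> zeroM U = x)"
    using pam_i
    by (simp (no_asm) only: ops_U[of _ i] U_consts(1,2)[of i] closed D) (elim conjE, intro conjI; (rule ex | assumption))
qed

lemma set_dom_U: "set_dom U \<noteq> {}" by simp

text \<open>Sigma_n truth in the union agrees with truth in a member \<open>Mf j\<close> that
  contains the parameters and \<open>x\<close>, so induction up to \<open>x\<close> can be carried
  out there.\<close>

lemma isigma_U: "isigma_model n U"
proof -
  have "induct_at U e s p" if p: "is_Sigma n p" and e: "env U e" "senv U s" "finite (range e)" "finite (range s)" for p e s
    unfolding induct_at_def
  proof (intro impI ballI)
    obtain \<rho> i where \<rho>: "s = (\<lambda>X. sU (\<rho> X))" "range \<rho> \<subseteq> {..i}" "env (Mf i) e" using finite_envs[OF e] .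
    fix x
    assume base: "sat U (case_nat (zeroM U) e) s p"
      and step: "\<forall>x\<in>num_dom U. sat U (case_nat x e) s p \<longrightarrow> sat U (case_nat (addM U x (oneM U)) e) s p"
      and x: "x \<in> num_dom U"
    obtain j where j: "j \<ge> i" "x \<in> num_dom (Mf j)" using in_later[OF x] by blast
    interpret pa "Mf j" using Mf(1) by (rule isigma_pa)
    have "env (Mf j) e" using env_le j \<rho> by blast
    moreover have "range \<rho> \<subseteq> {..j}" using \<rho>(2) j(1) by fastforce
    ultimately have eq: "sat U (case_nat a e) s p = sat (Mf j) (case_nat a e) (\<lambda>X. sf j (\<rho> X)) p" if "a \<in> num_dom (Mf j)" for a
      unfolding \<rho>(1) using sat_U_ren[OF p] that by simp
    have "sat (Mf j) (case_nat x e) (\<lambda>X. sf j (\<rho> X)) p"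
    proof (rule isigma_induct[OF Mf(1) isS_Sigma[OF p]])
      show "sat (Mf j) (case_nat (zeroM (Mf j)) e) (\<lambda>X. sf j (\<rho> X)) p"
        using base eq[of "zeroM (Mf j)"] U_consts(1)[of j] by simp
      fix y assume y: "y \<in> num_dom (Mf j)" "sat (Mf j) (case_nat y e) (\<lambda>X. sf j (\<rho> X)) p"
      then have "y \<in> num_dom U" "sat U (case_nat y e) s p" using eq by auto
      then have "sat U (case_nat (addM U y (oneM U)) e) s p" using step by blast
      then show "sat (Mf j) (case_nat (addM (Mf j) y (oneM (Mf j))) e) (\<lambda>X. sf j (\<rho> X)) p"
        using eq[of "addM (Mf j) y (oneM (Mf j))"] ops_U(1)[of y j "oneM (Mf j)"] U_consts(2)[of j] y by simp
    qed (use \<open>env (Mf j) e\<close> sf_senv j in auto)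
    then show "sat U (case_nat x e) s p" using eq j by blast
  qed
  then have "models U (closures (induction_ax p))" if "is_Sigma n p" for p
    using models_closures_finite[OF L2_U set_dom_U] that by (simp add: sat_induction_ax)
  moreover have "models U PA_minus" using models_PA_minus[OF L2_U set_dom_U] pam_U by blast
  ultimately show ?thesis
    unfolding isigma_model_def ISigma_def models_Un models_Union using L2_U set_dom_U by auto
qed

text \<open>New elements below \<open>a\<close> may enter at later stages, so a bound from one
  member must be shown to remain a bound. Bounding in \<open>Mf i\<close> is therefore applied to
  \<open>q\<close>, whose variable \<open>z\<close> bounds the witness \<open>y\<close> together
  with the inner witness \<open>w\<close>. Then \<open>?G\<close>, which says that \<open>b\<close>
  bounds both, is Pi_n and persists.\<close>

lemma BSigma_U: "models U (BSigma (Suc n))"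
proof -
  have "bound_at U e s p" if p: "is_Sigma (Suc n) p" and e: "env U e" "senv U s" "finite (range e)" "finite (range s)" for p e s
    unfolding bound_at_def
  proof (intro impI ballI)
    obtain \<rho> i0 where \<rho>: "s = (\<lambda>X. sU (\<rho> X))" "range \<rho> \<subseteq> {..i0}" "env (Mf i0) e" using finite_envs[OF e] .
    fix a
    assume a: "a \<in> num_dom U"
      and hyp: "\<forall>x\<in>num_dom U. lessM U x a \<longrightarrow> (\<exists>y\<in>num_dom U. sat U (case_nat y (case_nat x e)) s p)"
    obtain i where i: "i \<ge> i0" "a \<in> num_dom (Mf i)" using in_later[OF a] by blast
    have ei: "env (Mf i) e" using env_le i \<rho> by blast
    define p' where "p' = subst Var \<rho> p"
    have p': "is_Sigma (Suc n) p'" "fvS p' \<subseteq> {..i}"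
      using \<rho>(2) i(1) is_Sigma_subst[OF p] by (fastforce simp: p'_def fv_subst)+
    have satp': "sat U e s p = sat U e sU p'" for e by (simp add: p'_def \<rho>(1) sat_subst)
    \<comment> \<open>One matrix \<open>T\<close> has to serve all later stages.\<close>
    let ?C = "{Mf j |j. j \<ge> i}"
    have C: "\<And>M. M \<in> ?C \<Longrightarrow> isigma_model n M" using Mf(1) by blast
    obtain T0 where T0: "is_Pi n T0" "eqv ?C p' (ExN T0)" using contract[OF C p'(1)] by blast
    define T where "T = subst Var (\<lambda>X. if X \<le> i then X else 0) T0"
    have T: "is_Pi n T" "fvS T \<subseteq> {..i}" unfolding T_def using is_Pi_subst[OF T0(1)] fvS_clamp by blast+
    have eqvT: "eqv ?C p' (ExN T)" using eqv_clamp[OF T0(2) p'(2)] unfolding T_def subst_ExN up_Var .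
    have fvj: "fvS q \<subseteq> {..j}" if "fvS q \<subseteq> {..i}" "i \<le> j" for q j using that by fastforce
    have eqT: "sat U g sU p' \<longleftrightarrow> (\<exists>w\<in>num_dom (Mf j). sat (Mf j) (case_nat w g) (sf j) T)" if "i \<le> j" "env (Mf j) g" for j g
    proof -
      have "sat U g sU p' = sat (Mf j) g (sf j) p'" using sat_U(1)[OF p'(1) order_refl fvj[OF p'(2)]] that by blast
      also have "\<dots> = sat (Mf j) g (sf j) (ExN T)" using eqvT that Mf_L2 sf_senv unfolding eqv_def by blast
      finally show ?thesis by simp
    qed
    let ?T2 = "BEx (Var 0) (BEx (Var 1) (ren (case_nat 0 (case_nat 1 drop3)) T))"
    have "isP ?C n ?T2" by (intro isP_BEx[OF C] isP_ren isP_Pi T) auto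
    then obtain q where q: "is_Pi n q" "eqv ?C ?T2 q" unfolding isP_def by blast
    interpret pa "Mf i" using Mf(1) by (rule isigma_pa)
    have satq: "sat (Mf i) (case_nat z (case_nat x e)) (sf i) q \<longleftrightarrow> (\<exists>y\<in>D. lessM (Mf i) y z \<and> (\<exists>w\<in>D. lessM (Mf i) w z \<and>
        sat (Mf i) (case_nat w (case_nat y (case_nat x e))) (sf i) T))" if "z \<in> D" "x \<in> D" for z x
    proof -
      have "sat (Mf i) (case_nat z (case_nat x e)) (sf i) ?T2 = sat (Mf i) (case_nat z (case_nat x e)) (sf i) q"
      proof -
        have "env (Mf i) (case_nat z (case_nat x e))" "Mf i \<in> ?C" using that ei by auto
        then show ?thesis using q(2) Mf_L2 sf_senv unfolding eqv_def by blast
      qed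
      then show ?thesis by simp
    qed
    have "bound_at (Mf i) e (sf i) q"
      using models_BSigma[OF Mf_L2, of i "Suc n"] Mf(2,3) is_Sigma_is_Pi.intros(3)[OF q(1)] ei sf_senv(1) by auto
    moreover have "\<exists>z\<in>D. sat (Mf i) (case_nat z (case_nat x e)) (sf i) q" if x: "x \<in> D" "lessM (Mf i) x a" for x
    proof -
      have "lessM U x a" using ops_U(3) x i(2) by blast
      moreover have "x \<in> num_dom U" using x(1) by auto
      ultimately obtain y where "y \<in> num_dom U" "sat U (case_nat y (case_nat x e)) s p" using hyp by blast
      then have "sat U (case_nat x e) sU (ExN p')" unfolding sat_simps satp' by blast
      then have "sat (Mf i) (case_nat x e) (sf i) (ExN p')"
        using sat_U(1)[OF is_Sigma_is_Pi.intros(4)[OF p'(1)] order_refl, of i "case_nat x e"] p'(2) ei x(1) by simp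
      then obtain y where y: "y \<in> D" "sat (Mf i) (case_nat y (case_nat x e)) (sf i) p'" by auto
      have ey: "env (Mf i) (case_nat y (case_nat x e))" using y x ei by simp
      then have "sat U (case_nat y (case_nat x e)) sU p'"
        using sat_U(1)[OF p'(1) order_refl p'(2)] y by blast
      then obtain w where w: "w \<in> D" "sat (Mf i) (case_nat w (case_nat y (case_nat x e))) (sf i) T"
        using eqT[OF order_refl ey] by blast
      have "lessM (Mf i) y (addM (Mf i) (addM (Mf i) y w) (oneM (Mf i)))" "lessM (Mf i) w (addM (Mf i) (addM (Mf i) y w) (oneM (Mf i)))" "addM (Mf i) (addM (Mf i) y w) (oneM (Mf i)) \<in> D" using less_add_suc y w by simp_all
      then show ?thesis using satq x y w by (intro bexI[of _ "addM (Mf i) (addM (Mf i) y w) (oneM (Mf i))"]) auto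
    qed
    ultimately obtain b where b: "b \<in> D" "\<And>x. x \<in> D \<Longrightarrow> lessM (Mf i) x a \<Longrightarrow> \<exists>z\<in>D. lessM (Mf i) z b \<and> sat (Mf i) (case_nat z (case_nat x e)) (sf i) q"
      unfolding bound_at_def using i(2) by blast
    let ?G = "BAll (Var 0) (BEx (Var 2) (BEx (Var 3) (ren (case_nat 0 (case_nat 1 (case_nat 2 drop5))) T)))"
    have satG: "sat M (case_nat a (case_nat b e)) s ?G \<longleftrightarrow> (\<forall>x\<in>num_dom M. lessM M x a \<longrightarrow> (\<exists>y\<in>num_dom M. lessM M y b \<and>
        (\<exists>w\<in>num_dom M. lessM M w b \<and> sat M (case_nat w (case_nat y (case_nat x e))) s T)))" for M :: "'a L2_struct" and s
      by simp
    have "sat (Mf i) (case_nat a (case_nat b e)) (sf i) ?G"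
      unfolding satG
    proof (intro ballI impI)
      fix x assume x: "x \<in> D" "lessM (Mf i) x a"
      then obtain z where z: "z \<in> D" "lessM (Mf i) z b" "sat (Mf i) (case_nat z (case_nat x e)) (sf i) q" using b by blast
      then obtain y w where "y \<in> D" "lessM (Mf i) y z" "w \<in> D" "lessM (Mf i) w z" "sat (Mf i) (case_nat w (case_nat y (case_nat x e))) (sf i) T"
        using satq x by blast
      then show "\<exists>y\<in>D. lessM (Mf i) y b \<and> (\<exists>w\<in>D. lessM (Mf i) w b \<and> sat (Mf i) (case_nat w (case_nat y (case_nat x e))) (sf i) T)"
        using less_trans z b(1) by blast
    qed
    moreover have "isP ?C n ?G" by (intro isP_BAll isP_BEx[OF C] isP_ren isP_Pi T) auto
    then have "isP {Mf i, Mf j} (Suc n) ?G" if "i \<le> j" for j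
      by (rule isP_mono[OF isP_subset]) (use that in auto)
    ultimately have G: "sat (Mf j) (case_nat a (case_nat b e)) (sf j) ?G" if "i \<le> j" for j
      using el_isP[OF that, of ?G "case_nat a (case_nat b e)"] that T(2) i(2) b(1) ei by simp
    show "\<exists>b\<in>num_dom U. \<forall>x\<in>num_dom U. lessM U x a \<longrightarrow> (\<exists>y\<in>num_dom U. lessM U y b \<and> sat U (case_nat y (case_nat x e)) s p)"
    proof (rule bexI[of _ b], intro ballI impI)
      fix x assume x: "x \<in> num_dom U" "lessM U x a"
      obtain j where j: "j \<ge> i" "x \<in> num_dom (Mf j)" using in_later[OF x(1)] by blast
      have ab: "a \<in> num_dom (Mf j)" "b \<in> num_dom (Mf j)" using incl_le[OF j(1)] i b by blast+
      have "lessM (Mf j) x a" using x(2) ops_U(3) j ab by blast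
      then obtain y w where yw: "y \<in> num_dom (Mf j)" "lessM (Mf j) y b" "w \<in> num_dom (Mf j)"
        "sat (Mf j) (case_nat w (case_nat y (case_nat x e))) (sf j) T"
        using G[OF j(1)] j(2) unfolding satG by blast
      have "env (Mf j) (case_nat y (case_nat x e))" using yw j env_le[OF j(1) ei] by simp
      then have "sat U (case_nat y (case_nat x e)) s p" using eqT[OF j(1)] yw satp' by blast
      moreover have "lessM U y b" "y \<in> num_dom U" using ops_U(3) yw ab by auto
      ultimately show "\<exists>y\<in>num_dom U. lessM U y b \<and> sat U (case_nat y (case_nat x e)) s p" by blast
    qed (use b in auto)
  qed
  then have "models U (closures (bounding_ax p))" if "is_Sigma (Suc n) p" for p
    using models_closures_finite[OF L2_U set_dom_U] that by (simp add: sat_bounding_ax)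
  moreover have "models U (ISigma 0)"
    using isigma_mono[OF isigma_U, of 0] unfolding isigma_model_def by simp
  ultimately show ?thesis
    unfolding BSigma_def models_Un models_Union by auto
qed

text \<open>That the new set is included in \<phi> and includes \<psi> are Pi_2 facts, which persist
  because \<open>n\<close> is at least 1. With \<phi> and \<psi> equivalent in the union they
  determine the set.\<close>

lemma RCA0_U:
  assumes comp: "\<And>\<phi> \<psi> i0 e. is_Sigma 1 \<phi> \<Longrightarrow> is_Pi 1 \<psi> \<Longrightarrow> fvS \<phi> \<subseteq> {..i0} \<Longrightarrow> fvS \<psi> \<subseteq> {..i0} \<Longrightarrow> env (Mf i0) e \<Longrightarrow>
    \<exists>i\<ge>i0. (\<forall>x\<in>num_dom (Mf i). sat (Mf i) (case_nat x e) (sf i) \<phi> = sat (Mf i) (case_nat x e) (sf i) \<psi>) \<longrightarrow>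
      (\<forall>x\<in>num_dom (Mf (Suc i)).
        (x \<in> sf (Suc i) (Suc i) \<longrightarrow> sat (Mf (Suc i)) (case_nat x e) (sf (Suc i)) \<phi>) \<and>
        (sat (Mf (Suc i)) (case_nat x e) (sf (Suc i)) \<psi> \<longrightarrow> x \<in> sf (Suc i) (Suc i)))"
  shows "models U RCA0"
proof -
  have "sat U e s (comprehension_ax \<phi> \<psi>)"
    if \<phi>: "is_Sigma 1 \<phi>" and \<psi>: "is_Pi 1 \<psi>" and e: "env U e" "senv U s" "finite (range e)" "finite (range s)" for \<phi> \<psi> e s
  proof -
    obtain \<rho> i0 where \<rho>: "s = (\<lambda>X. sU (\<rho> X))" "range \<rho> \<subseteq> {..i0}" "env (Mf i0) e" using finite_envs[OF e] .
    define \<phi>' \<psi>' where "\<phi>' = subst Var \<rho> \<phi>" and "\<psi>' = subst Var \<rho> \<psi>"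
    have cl: "is_Sigma 1 \<phi>'" "is_Pi 1 \<psi>'"
      unfolding \<phi>'_def \<psi>'_def by (rule is_Sigma_subst[OF \<phi>], rule is_Pi_subst[OF \<psi>])
    have fv: "fvS \<phi>' \<subseteq> {..i0}" "fvS \<psi>' \<subseteq> {..i0}"
      using \<rho>(2) by (auto simp: \<phi>'_def \<psi>'_def fv_subst)
    have eq: "sat U g s \<phi> = sat U g sU \<phi>'" "sat U g s \<psi> = sat U g sU \<psi>'" for g
      by (simp_all add: \<phi>'_def \<psi>'_def sat_subst \<rho>(1))
    obtain i where i: "i \<ge> i0" "(\<forall>x\<in>num_dom (Mf i). sat (Mf i) (case_nat x e) (sf i) \<phi>' = sat (Mf i) (case_nat x e) (sf i) \<psi>') \<Longrightarrow>
      (\<forall>x\<in>num_dom (Mf (Suc i)).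
        (x \<in> sf (Suc i) (Suc i) \<longrightarrow> sat (Mf (Suc i)) (case_nat x e) (sf (Suc i)) \<phi>') \<and>
        (sat (Mf (Suc i)) (case_nat x e) (sf (Suc i)) \<psi>' \<longrightarrow> x \<in> sf (Suc i) (Suc i)))"
      using comp[OF cl fv \<rho>(3)] by blast
    have fvi: "fvS \<phi>' \<subseteq> {..j}" "fvS \<psi>' \<subseteq> {..j}" if "j \<ge> i" for j using fv i(1) that by fastforce+
    have ej: "env (Mf j) e" if "j \<ge> i" for j using env_le[of i0 j] i(1) that \<rho>(3) by simp
    have satj: "sat U (case_nat x e) sU \<phi>' = sat (Mf j) (case_nat x e) (sf j) \<phi>'"
      "sat U (case_nat x e) sU \<psi>' = sat (Mf j) (case_nat x e) (sf j) \<psi>'" if "j \<ge> i" "x \<in> num_dom (Mf j)" for x j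
      using sat_U(1)[OF cl(1) _ fvi(1)[OF that(1)]] sat_U(2)[OF cl(2) _ fvi(2)[OF that(1)]] that ej by auto
    have "\<exists>A\<in>set_dom U. \<forall>x\<in>num_dom U. x \<in> A \<longleftrightarrow> sat U (case_nat x e) s \<phi>"
      if iff: "\<forall>x\<in>num_dom U. sat U (case_nat x e) s \<phi> = sat U (case_nat x e) s \<psi>"
    proof -
      have "\<forall>x\<in>num_dom (Mf i). sat (Mf i) (case_nat x e) (sf i) \<phi>' = sat (Mf i) (case_nat x e) (sf i) \<psi>'"
        using iff eq satj[OF order_refl] by auto
      note Y = i(2)[OF this]
      \<comment> \<open>The step from stage \<open>i\<close> to the next one assigns the name
        \<open>Suc i\<close>.\<close>
      let ?Y = "Mem (Var 0) (Suc i)"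
      let ?F = "All (Imp ?Y \<phi>')" and ?G = "All (Imp \<psi>' ?Y)"
      have cls: "isP C (Suc n) ?F" "isP C (Suc n) ?G" for C
      proof -
        have "isS C 1 (Imp ?Y \<phi>')" "isS C 1 (Imp \<psi>' ?Y)"
          by (intro isS_Imp isP_Delta0 isS_Delta0 is_Delta0.intros isS_Sigma isP_Pi cl)+
        then have "isP C (Suc 1) ?F" "isP C (Suc 1) ?G" using isP_All isP_Suc_isS by blast+
        then show "isP C (Suc n) ?F" "isP C (Suc n) ?G" 
            using n by (auto intro!: isP_mono[of C "Suc 1" _ "Suc n"])
      qed
      have "sat (Mf (Suc i)) e (sf (Suc i)) ?F" "sat (Mf (Suc i)) e (sf (Suc i)) ?G" using Y by simp_all
      moreover have "fvS ?F \<subseteq> {..Suc i}" "fvS ?G \<subseteq> {..Suc i}" using fvi[of "Suc i"] by simp_all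
      ultimately have j: "sat (Mf j) e (sf j) ?F \<and> sat (Mf j) e (sf j) ?G" if "j \<ge> Suc i" for j
        using el_isP[OF that cls(1)] el_isP[OF that cls(2)] ej[of "Suc i"] by simp
      have "x \<in> sU (Suc i) \<longleftrightarrow> sat U (case_nat x e) s \<phi>" if x: "x \<in> num_dom U" for x
      proof -
        obtain k where k: "k \<ge> Suc i" "x \<in> num_dom (Mf k)" using in_later[OF x] by blast
        have "k \<ge> i" using k by simp
        note S = satj[OF this k(2)]
        have "x \<in> sf k (Suc i) \<longrightarrow> sat (Mf k) (case_nat x e) (sf k) \<phi>'"
          "sat (Mf k) (case_nat x e) (sf k) \<psi>' \<longrightarrow> x \<in> sf k (Suc i)"
          using j[OF k(1)] k(2) by simp_all
        then show ?thesis
          unfolding mem_sU[OF k(2,1)] S[symmetric] eq[symmetric] using iff x by blast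
      qed
      then show ?thesis by (intro bexI[of _ "sU (Suc i)"]) auto
    qed
    then show ?thesis by (simp add: comprehension_ax_def)
  qed
  then have "models U (closures (comprehension_ax \<phi> \<psi>))" if "is_Sigma 1 \<phi>" "is_Pi 1 \<psi>" for \<phi> \<psi>
    using models_closures_finite[OF L2_U set_dom_U] that by blast
  moreover have "models U (ISigma 1)"
    using isigma_mono[OF isigma_U n] unfolding isigma_model_def by simp
  ultimately show ?thesis unfolding RCA0_def models_Un models_Union by auto
qed

end

section \<open>The chain\<close>

text \<open>\<open>Inl X\<close> demands a witness of \<theta> for the set named \<open>X\<close>,
  \<open>Inr (\<phi>, \<psi>, L)\<close> a comprehension instance with number parameters
  \<open>L\<close>. Each task must recur beyond every stage, because its parameters may not be there
  when it first comes up.\<close>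

definition task :: "nat \<Rightarrow> nat + fm \<times> fm \<times> nat list" where
  "task k = from_nat (fst (prod_decode k))"

lemma task_infinite: "\<exists>k\<ge>i. task k = \<tau>"
proof (intro exI conjI)
  show "prod_encode (to_nat \<tau>, i) \<ge> i" by (rule le_prod_encode_2)
  show "task (prod_encode (to_nat \<tau>, i)) = \<tau>" by (simp add: task_def)
qed

definition good :: "nat \<Rightarrow> nat \<Rightarrow> nat L2_struct \<Rightarrow> (nat \<Rightarrow> nat set) \<Rightarrow> bool" where
  "good n k M s \<longleftrightarrow> isigma_model n M \<and> models M (BSigma (Suc n)) \<and> recursively_saturated M \<and>
     set_dom M = range s \<and> num_dom M \<subseteq> level_below (Suc k)"

text \<open>Set variable \<open>k\<close> becomes a name of a new set, and only the set variables below \<open>k\<close> keep their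
  meaning.\<close>

definition one_step :: "nat \<Rightarrow> fm \<Rightarrow> nat \<Rightarrow> nat L2_struct \<Rightarrow> (nat \<Rightarrow> nat set) \<Rightarrow> nat L2_struct \<Rightarrow> (nat \<Rightarrow> nat set) \<Rightarrow> bool" where
  "one_step n \<theta> k M s M' s' \<longleftrightarrow> num_dom M \<subseteq> num_dom M' \<and>
     (\<forall>p e. is_Sigma (Suc n) p \<longrightarrow> fvS p \<subseteq> {..<k} \<longrightarrow> env M e \<longrightarrow> sat M e s p = sat M' e s' p) \<and>
     (\<forall>X e. task k = Inl X \<longrightarrow> X < k \<longrightarrow> env M e \<longrightarrow> sat M' e (case_nat (s' k) (case_nat (s' X) s')) \<theta>) \<and>
     (\<forall>\<phi> \<psi> L e. task k = Inr (\<phi>, \<psi>, L) \<longrightarrow> is_Sigma 1 \<phi> \<longrightarrow> is_Pi 1 \<psi> \<longrightarrow> fvS \<phi> \<subseteq> {..<k} \<longrightarrow> fvS \<psi> \<subseteq> {..<k} \<longrightarrow>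
        fvN \<phi> \<subseteq> {..<Suc (length L)} \<longrightarrow> fvN \<psi> \<subseteq> {..<Suc (length L)} \<longrightarrow> env M e \<longrightarrow> (\<forall>i<length L. e i = L ! i) \<longrightarrow>
        (\<forall>x\<in>num_dom M. sat M (case_nat x e) s \<phi> = sat M (case_nat x e) s \<psi>) \<longrightarrow>
        (\<forall>x\<in>num_dom M'. (x \<in> s' k \<longrightarrow> sat M' (case_nat x e) s' \<phi>) \<and> (sat M' (case_nat x e) s' \<psi> \<longrightarrow> x \<in> s' k)))"

lemma isigma_reduct:
  assumes M: "isigma_model n M" and S: "S \<subseteq> set_dom M" "S \<noteq> {}"
  shows "isigma_model n (M\<lparr>set_dom := S\<rparr>)"
proof -
  have L2: "L2_structure (M\<lparr>set_dom := S\<rparr>)" and ne: "set_dom (M\<lparr>set_dom := S\<rparr>) \<noteq> {}"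
    using M S by (auto simp: isigma_model_def L2_structure_def)
  have M': "L2_structure M" "set_dom M \<noteq> {}" "models M (ISigma n)" using M by (auto simp: isigma_model_def)
  have "induct_at (M\<lparr>set_dom := S\<rparr>) e s p"
    if p: "is_Sigma n p" and e: "env (M\<lparr>set_dom := S\<rparr>) e" "senv (M\<lparr>set_dom := S\<rparr>) s" for p e s
  proof -
    have "env M e" "senv M s" using e S by (auto simp: env_def senv_def)
    then have "induct_at M e s p" using models_ISigma[OF M'(1,2)] M'(3) p by blast
    moreover have "zeroM (M\<lparr>set_dom := S\<rparr>) = zeroM M" "oneM (M\<lparr>set_dom := S\<rparr>) = oneM M"
      "addM (M\<lparr>set_dom := S\<rparr>) = addM M" "num_dom (M\<lparr>set_dom := S\<rparr>) = num_dom M" by simp_all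
    ultimately show ?thesis by (simp only: induct_at_def sat_set_dom[OF arithmetical_Sigma[OF p]])
  qed
  moreover have "pam M" using isigma_pa[OF M] by (simp add: pa_def)
  then have "models (M\<lparr>set_dom := S\<rparr>) PA_minus" by (simp only: models_PA_minus[OF L2 ne] pam_set_dom)
  ultimately show ?thesis
    using L2 ne unfolding isigma_model_def models_ISigma[OF L2 ne] by blast
qed

locale extension_hyp =
  fixes n :: nat and \<theta> :: fm
  assumes n: "n \<ge> 1" and \<theta>: "is_Pi (Suc n) \<theta>" "fv_below 0 2 \<theta>"
    and hyp: "\<And>(M :: nat L2_struct) X.
       L2_structure M \<Longrightarrow> countable_structure M \<Longrightarrow> recursively_saturated M \<Longrightarrow>
       models M (BSigma (Suc n)) \<Longrightarrow> X \<in> set_dom M \<Longrightarrow>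
       \<exists>Y. Y \<subseteq> num_dom M \<and> models (add_set Y M) (ISigma n) \<and> holds_at (add_set Y M) \<theta> X Y"
begin

text \<open>The conclusions are stated in \<open>M\<close> with \<open>Y\<close> as a value of the
  assignment, even if \<open>Y\<close> is not in \<open>set_dom M\<close>; truth of arithmetical
  formulas does not depend on the set domain.\<close>

lemma new_set:
  assumes "good n k M s"
  obtains Y where "isigma_model n (add_set Y M)"
    "\<And>X e. task k = Inl X \<Longrightarrow> X < k \<Longrightarrow> sat M e (case_nat Y (case_nat (s X) s)) \<theta>"
    "\<And>\<phi> \<psi> L e x. task k = Inr (\<phi>, \<psi>, L) \<Longrightarrow> is_Sigma 1 \<phi> \<Longrightarrow> is_Pi 1 \<psi> \<Longrightarrow>
        fvN \<phi> \<subseteq> {..<Suc (length L)} \<Longrightarrow> fvN \<psi> \<subseteq> {..<Suc (length L)} \<Longrightarrow> env M e \<Longrightarrow> \<forall>i<length L. e i = L ! i \<Longrightarrow>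
        \<forall>x\<in>num_dom M. sat M (case_nat x e) s \<phi> = sat M (case_nat x e) s \<psi> \<Longrightarrow> x \<in> num_dom M \<Longrightarrow>
        (x \<in> Y \<longrightarrow> sat M (case_nat x e) s \<phi>) \<and> (sat M (case_nat x e) s \<psi> \<longrightarrow> x \<in> Y)"
proof -
  have M: "isigma_model n M" "L2_structure M" "set_dom M = range s" "models M (BSigma (Suc n))" "recursively_saturated M"
    using assms by (auto simp: good_def isigma_model_def)
  \<comment> \<open>If the task does not apply, an old set is adjoined, which changes
    nothing.\<close>
  have "add_set (s 0) M = M" using M(3) by (simp add: add_set_def insert_absorb)
  then have default: "isigma_model n (add_set (s 0) M)" using M(1) by simp
  show thesis
  proof (cases "task k")
    case (Inl X)
    show thesis
    proof (cases "X < k")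
      case True
      have "countable_structure M" "s X \<in> set_dom M" using M(3) by (simp_all add: countable_structure_def)
      obtain Y where Y: "Y \<subseteq> num_dom M" "models (add_set Y M) (ISigma n)" "holds_at (add_set Y M) \<theta> (s X) Y"
        using hyp[OF M(2) \<open>countable_structure M\<close> M(5,4) \<open>s X \<in> set_dom M\<close>] by (elim exE conjE)
      have "isigma_model n (add_set Y M)"
        unfolding isigma_model_def
      proof (intro conjI)
        show "L2_structure (add_set Y M)" using Y(1) M(2) by (simp add: L2_structure_def add_set_def)
        show "set_dom (add_set Y M) \<noteq> {}" by (simp add: add_set_def)
      qed (rule Y(2))
      moreover have "sat M e (case_nat Y (case_nat (s X) s)) \<theta>" for e
      proof -
        have "sat (add_set Y M) e \<sigma> \<theta> = sat M e \<sigma> \<theta>" for \<sigma>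
          unfolding add_set_def by (rule sat_set_dom[OF arithmetical_Pi[OF \<theta>(1)]])
        then show ?thesis using Y(3) unfolding holds_at_def by blast
      qed
      ultimately show thesis using Inl by (intro that[of Y]) auto
    next
      case False
      then show thesis using Inl by (intro that[OF default]) auto
    qed
  next
    case (Inr \<tau>)
    obtain \<phi> \<psi> L where \<tau>: "\<tau> = (\<phi>, \<psi>, L)" by (cases \<tau>)
    \<comment> \<open>The task fixes only the values listed in \<open>L\<close>; zero is a
      filler.\<close>
    define e0 where "e0 = (\<lambda>i. if i < length L then L ! i else zeroM M)"
    let ?ok = "is_Sigma 1 \<phi> \<and> is_Pi 1 \<psi> \<and> env M e0 \<and>
      (\<forall>x\<in>num_dom M. sat M (case_nat x e0) s \<phi> = sat M (case_nat x e0) s \<psi>)"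
    define Y where "Y = (if ?ok then {x \<in> num_dom M. sat M (case_nat x e0) s \<phi>} else s 0)"
    have "senv M s" using M(3) by (simp add: senv_def)
    then have iY: "isigma_model n (add_set Y M)"
      using default add_set_Delta1[OF M(1) n, of \<phi> \<psi> e0 s] by (auto simp: Y_def)
    have dY: "(x \<in> Y \<longrightarrow> sat M (case_nat x e) s \<phi>) \<and> (sat M (case_nat x e) s \<psi> \<longrightarrow> x \<in> Y)"
      if cl: "is_Sigma 1 \<phi>" "is_Pi 1 \<psi>" and fv: "fvN \<phi> \<subseteq> {..<Suc (length L)}" "fvN \<psi> \<subseteq> {..<Suc (length L)}"
        and e: "env M e" "\<forall>i<length L. e i = L ! i"
        and iff: "\<forall>x\<in>num_dom M. sat M (case_nat x e) s \<phi> = sat M (case_nat x e) s \<psi>" and x: "x \<in> num_dom M" for e x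
    proof -
      have eq: "sat M (case_nat x e) s \<phi> = sat M (case_nat x e0) s \<phi>" "sat M (case_nat x e) s \<psi> = sat M (case_nat x e0) s \<psi>" for x
        by (rule sat_cong; use fv e(2) in \<open>auto simp: e0_def split: nat.split\<close>)+
      have "e0 i \<in> num_dom M" for i
        using e M(2) by (auto simp: e0_def env_def L2_structure_def dest!: spec[of _ i])
      then have "?ok" using cl iff eq by (simp add: env_def)
      then show ?thesis using eq iff x by (simp add: Y_def)
    qed
    show thesis
    proof (rule that[OF iY])
      fix X e assume "task k = Inl X"
      then show "sat M e (case_nat Y (case_nat (s X) s)) \<theta>" using Inr by simp
    next
      fix \<phi>' \<psi>' L' e x assume "task k = Inr (\<phi>', \<psi>', L')"
      then have eq: "\<phi>' = \<phi>" "\<psi>' = \<psi>" "L' = L" using Inr \<tau> by simp_all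
      assume "is_Sigma 1 \<phi>'" "is_Pi 1 \<psi>'" "fvN \<phi>' \<subseteq> {..<Suc (length L')}" "fvN \<psi>' \<subseteq> {..<Suc (length L')}"
        "env M e" "\<forall>i<length L'. e i = L' ! i"
        "\<forall>x\<in>num_dom M. sat M (case_nat x e) s \<phi>' = sat M (case_nat x e) s \<psi>'" "x \<in> num_dom M"
      then show "(x \<in> Y \<longrightarrow> sat M (case_nat x e) s \<phi>') \<and> (sat M (case_nat x e) s \<psi>' \<longrightarrow> x \<in> Y)"
        unfolding eq by (rule dY)
    qed
  qed
qed

lemma step:
  assumes "good n k M s"
  obtains M' s' where "good n (Suc k) M' s'" "one_step n \<theta> k M s M' s'"
proof (rule new_set[OF assms])
  fix Y
  assume Y: "isigma_model n (add_set Y M)"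
    "\<And>X e. task k = Inl X \<Longrightarrow> X < k \<Longrightarrow> sat M e (case_nat Y (case_nat (s X) s)) \<theta>"
    "\<And>\<phi> \<psi> L e x. task k = Inr (\<phi>, \<psi>, L) \<Longrightarrow> is_Sigma 1 \<phi> \<Longrightarrow> is_Pi 1 \<psi> \<Longrightarrow>
        fvN \<phi> \<subseteq> {..<Suc (length L)} \<Longrightarrow> fvN \<psi> \<subseteq> {..<Suc (length L)} \<Longrightarrow> env M e \<Longrightarrow> \<forall>i<length L. e i = L ! i \<Longrightarrow>
        \<forall>x\<in>num_dom M. sat M (case_nat x e) s \<phi> = sat M (case_nat x e) s \<psi> \<Longrightarrow> x \<in> num_dom M \<Longrightarrow>
        (x \<in> Y \<longrightarrow> sat M (case_nat x e) s \<phi>) \<and> (sat M (case_nat x e) s \<psi> \<longrightarrow> x \<in> Y)"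
  have M: "set_dom M = range s" "num_dom M \<subseteq> level_below (Suc k)" using assms by (auto simp: good_def)
  \<comment> \<open>The set formerly named \<open>k\<close> may get lost, but formulas with set
    variables below \<open>k\<close> do not see it.\<close>
  define s1 where "s1 = s(k := Y)"
  define M1 where "M1 = M\<lparr>set_dom := range s1\<rparr>"
  have "range s1 \<subseteq> set_dom (add_set Y M)" using M(1) by (auto simp: s1_def add_set_def)
  then have "isigma_model n (add_set Y M\<lparr>set_dom := range s1\<rparr>)" by (intro isigma_reduct[OF Y(1)]) auto
  then have M1: "isigma_model n M1" by (simp add: M1_def add_set_def)
  have [simp]: "num_dom M1 = num_dom M" "set_dom M1 = range s1" by (simp_all add: M1_def)
  have env1: "env M1 e = env M e" for e by (simp add: env_def)
  obtain K :: "nat L2_struct" and t where K: "isigma_model n K" "recursively_saturated K" "set_dom K = range t" "models K (BSigma (Suc n))"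
    "num_dom M \<subseteq> num_dom K" "num_dom K \<subseteq> level_below (Suc (Suc k))"
    "\<And>p e. is_Sigma (Suc n) p \<Longrightarrow> env M e \<Longrightarrow> sat M1 e s1 p = sat K e t p"
    using BSigma_extension_incl[OF n M1, of s1 "Suc k"] M(2) env1 by (metis \<open>num_dom M1 = num_dom M\<close> \<open>set_dom M1 = range s1\<close>)
  have satM1: "sat M1 e \<sigma> p = sat M e \<sigma> p" if "arithmetical p" for e \<sigma> p
    unfolding M1_def by (rule sat_set_dom[OF that])
  have envK: "env K e" if "env M e" for e using that K(5) by (auto simp: env_def)
  have L2: "L2_structure M1" "L2_structure K" using M1 K(1) by (simp_all add: isigma_model_def)
  have elP: "sat M1 e s1 p = sat K e t p" if pe: "isP {M1, K} (Suc n) p" "env M e" for p e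
  proof -
    obtain q where q: "is_Sigma (Suc n) q" "eqv {M1, K} (Neg p) q" using isS_Neg[OF pe(1)] unfolding isS_def by blast
    have "senv M1 s1" "senv K t" using K(3) by (simp_all add: senv_def)
    then have "sat M1 e s1 (Neg p) = sat M1 e s1 q" "sat K e t (Neg p) = sat K e t q"
      using q(2) L2 pe(2) envK env1 unfolding eqv_def by blast+
    then show ?thesis using K(7)[OF q(1) pe(2)] by (simp; blast)
  qed
  have same: "sat M e s1 p = sat M e s p" if "fvS p \<subseteq> {..<k}" for e p
    by (rule sat_cong) (use that in \<open>auto simp: s1_def\<close>)
  show thesis
  proof
    show "good n (Suc k) K t" using K by (simp add: good_def)
    show "one_step n \<theta> k M s K t"
      unfolding one_step_def
    proof (intro conjI allI impI ballI)
      show "num_dom M \<subseteq> num_dom K" by fact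
    next
      fix p e assume p: "is_Sigma (Suc n) p" "fvS p \<subseteq> {..<k}" "env M e"
      then show "sat M e s p = sat K e t p" using K(7) satM1[OF arithmetical_Sigma] same by metis
    next
      fix X e assume X: "task k = Inl X" "X < k" and e: "env M e"
      \<comment> \<open>Variables 0 and 1 of \<theta> are replaced by the names \<open>k\<close> and
        \<open>X\<close>, as elementarity is stated for the fixed assignments \<open>s1\<close> and
        \<open>t\<close>.\<close>
      let ?q = "subst Var (case_nat k (case_nat X (\<lambda>i. i))) \<theta>"
      have *: "(\<lambda>i. \<sigma> (case_nat k (case_nat X (\<lambda>i. i)) i)) = case_nat (\<sigma> k) (case_nat (\<sigma> X) \<sigma>)" for \<sigma> :: "nat \<Rightarrow> nat set"
        by (auto simp: fun_eq_iff split: nat.split)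
      have "sat M e (case_nat Y (case_nat (s X) s)) \<theta>" using Y(2)[OF X] .
      moreover have "sat M e (case_nat Y (case_nat (s X) s)) \<theta> = sat M e (case_nat (s1 k) (case_nat (s1 X) s1)) \<theta>"
        by (rule sat_cong) (use \<theta>(2) X(2) in \<open>auto simp: fv_below_iff s1_def numeral_2_eq_2 less_Suc_eq split: nat.split\<close>)
      ultimately have "sat M e s1 ?q" by (simp add: sat_subst *)
      then have "sat M1 e s1 ?q" using satM1 arithmetical_Pi[OF \<theta>(1)] by simp
      then have "sat K e t ?q" using elP[OF isP_Pi[OF is_Pi_subst[OF \<theta>(1)]] e] by simp
      then show "sat K e (case_nat (t k) (case_nat (t X) t)) \<theta>" by (simp add: sat_subst *)
    next
      fix \<phi> \<psi> L e x
      assume a: "task k = Inr (\<phi>, \<psi>, L)" "is_Sigma 1 \<phi>" "is_Pi 1 \<psi>" "fvS \<phi> \<subseteq> {..<k}" "fvS \<psi> \<subseteq> {..<k}"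
        "fvN \<phi> \<subseteq> {..<Suc (length L)}" "fvN \<psi> \<subseteq> {..<Suc (length L)}" "env M e" "\<forall>i<length L. e i = L ! i"
        "\<forall>x\<in>num_dom M. sat M (case_nat x e) s \<phi> = sat M (case_nat x e) s \<psi>"
      let ?Y = "Mem (Var 0) k"
      let ?F = "All (Imp ?Y \<phi>)" and ?G = "All (Imp \<psi> ?Y)"
      have cls: "isP C (Suc n) ?F" "isP C (Suc n) ?G" for C :: "nat L2_struct set"
      proof -
        have "isS C 1 (Imp ?Y \<phi>)" "isS C 1 (Imp \<psi> ?Y)"
          by (intro isS_Imp isP_Delta0 isS_Delta0 is_Delta0.intros isS_Sigma isP_Pi a)+
        then have "isP C (Suc 1) ?F" "isP C (Suc 1) ?G" using isP_All isP_Suc_isS by blast+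
        then show "isP C (Suc n) ?F" "isP C (Suc n) ?G"
          using n by (auto intro!: isP_mono[of C "Suc 1" _ "Suc n"])
      qed
      have "s1 k = Y" by (simp add: s1_def)
      then have "sat M e s1 ?F \<and> sat M e s1 ?G"
        using Y(3)[OF a(1-3,6-10)] same[OF a(4)] same[OF a(5)] by simp
      then have "sat M1 e s1 ?F \<and> sat M1 e s1 ?G"
        using satM1 arithmetical_Sigma[OF a(2)] arithmetical_Pi[OF a(3)] by simp
      then have FG: "sat K e t ?F \<and> sat K e t ?G" using elP[OF cls(1) a(8)] elP[OF cls(2) a(8)] by simp
      assume x: "x \<in> num_dom K"
      show "x \<in> t k \<Longrightarrow> sat K (case_nat x e) t \<phi>" "sat K (case_nat x e) t \<psi> \<Longrightarrow> x \<in> t k"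
        using FG x by simp_all
    qed
  qed
qed

lemma model_of_extension:
  fixes M :: "nat L2_struct"
  assumes M: "isigma_model n M" and A: "A \<in> set_dom M"
    and p: "is_Pi (Suc (Suc n)) p" "fvS p \<subseteq> {0}" "env M e" "\<not> sat M e (\<lambda>_. A) p"
  obtains U :: "nat L2_struct" and e' s' where "L2_structure U" "env U e'" "senv U s'"
    "models U (RCA0 \<union> BSigma (Suc n) \<union> {AllS (ExS \<theta>)})" "\<not> sat U e' s' p"
proof -
  \<comment> \<open>First component 0 puts the initial universe into \<open>level_below 1\<close>,
    apart from all elements added later.\<close>
  let ?f = "\<lambda>y :: nat. prod_encode (0, y)"
  \<comment> \<open>With \<open>A\<close> as the only set, the constant assignment names all sets of
    the initial model.\<close>
  define M1 where "M1 = M\<lparr>set_dom := {A}\<rparr>"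
  have M1: "isigma_model n M1" unfolding M1_def by (rule isigma_reduct[OF M]) (use A in auto)
  interpret iso ?f M1
    by unfold_locales (use M1 in \<open>auto simp: isigma_model_def inj_on_def prod_encode_eq\<close>)
  have M2: "isigma_model n K'"
    using models'[of "ISigma n"] sentence_ISigma M1 L2' by (auto simp: isigma_model_def)
  have sub: "A \<subseteq> num_dom M1" using sub_dom by (simp add: M1_def)
  have "sat K' (?f \<circ> e) (\<lambda>_. ?f ` A) p = sat M1 e (\<lambda>_. A) p"
    by (rule sat') (use p(3) sub in \<open>auto simp: env_def M1_def\<close>)
  moreover have "sat M1 e (\<lambda>_. A) p = sat M e (\<lambda>_. A) p"
    unfolding M1_def by (rule sat_set_dom[OF arithmetical_Pi[OF p(1)]])
  ultimately have nsat: "\<not> sat K' (?f \<circ> e) (\<lambda>_. ?f ` A) p" using p(4) by blast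
  have "num_dom M1 = num_dom M" by (simp add: M1_def)
  then have env2: "env K' (?f \<circ> e)" using p(3) by (simp add: env_def)
  have sd: "set_dom K' = range (\<lambda>_ :: nat. ?f ` A)"
  proof -
    have "set_dom M1 = {A}" by (simp add: M1_def)
    then show ?thesis by simp
  qed
  have lv: "num_dom K' \<subseteq> level_below 1" by (auto simp: level_below_def)
  show thesis
  proof (rule BSigma_extension_incl[OF n M2 sd lv])
    fix K0 :: "nat L2_struct" and t0
    assume K0: "isigma_model n K0" "recursively_saturated K0"
      "set_dom K0 = range t0" "models K0 (BSigma (Suc n))" "num_dom K' \<subseteq> num_dom K0" "num_dom K0 \<subseteq> level_below (Suc 1)"
      "\<And>p e. is_Sigma (Suc n) p \<Longrightarrow> env K' e \<Longrightarrow> sat K' e (\<lambda>_. ?f ` A) p = sat K0 e t0 p"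
    let ?P = "\<lambda>i x. good n (Suc i) (fst x) (snd x) \<and> (i = 0 \<longrightarrow> x = (K0, t0))"
    \<comment> \<open>Stage \<open>i\<close> carries out step \<open>Suc i\<close>, so the name 0,
      which stems from \<open>A\<close>, is never reassigned.\<close>
    let ?Q = "\<lambda>i x y. one_step n \<theta> (Suc i) (fst x) (snd x) (fst y) (snd y)"
    have "\<exists>f. \<forall>i. ?P i (f i) \<and> ?Q i (f i) (f (Suc i))"
    proof (rule dependent_nat_choice)
      show "\<exists>x. ?P 0 x" using K0 by (intro exI[of _ "(K0, t0)"]) (simp add: good_def)
      fix x i assume "?P i x"
      then obtain M' s' where "good n (Suc (Suc i)) M' s'" "one_step n \<theta> (Suc i) (fst x) (snd x) M' s'"
        using step by blast
      then show "\<exists>y. ?P (Suc i) y \<and> ?Q i x y" by (intro exI[of _ "(M', s')"]) simp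
    qed
    then obtain f where f: "\<And>i. ?P i (f i)" "\<And>i. ?Q i (f i) (f (Suc i))" by blast
    define Mf where "Mf = (\<lambda>i. fst (f i))"
    define sf where "sf = (\<lambda>i. snd (f i))"
    have g: "good n (Suc i) (Mf i) (sf i)" and st: "one_step n \<theta> (Suc i) (Mf i) (sf i) (Mf (Suc i)) (sf (Suc i))" for i
      using f by (simp_all add: Mf_def sf_def)
    have f0: "Mf 0 = K0" "sf 0 = t0" using f(1)[of 0] by (simp_all add: Mf_def sf_def)
    interpret C: chain n Mf sf
    proof
      show "n \<ge> 1" by (rule n)
      show "isigma_model n (Mf i)" "models (Mf i) (BSigma (Suc n))" "set_dom (Mf i) = range (sf i)" for i
        using g[of i] by (simp_all add: good_def)
      show "num_dom (Mf i) \<subseteq> num_dom (Mf (Suc i))" for i using st[of i] by (simp add: one_step_def)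
      show "sat (Mf i) e (sf i) p = sat (Mf (Suc i)) e (sf (Suc i)) p"
        if "is_Sigma (Suc n) p" "fvS p \<subseteq> {..i}" "env (Mf i) e" for p i e
        using st[of i] that unfolding one_step_def lessThan_Suc_atMost by blast
    qed
    have sU: "senv C.U C.sU" by (simp add: senv_def)
    have "models C.U RCA0"
    proof (rule C.RCA0_U)
      fix \<phi> \<psi> i0 e
      assume a: "is_Sigma 1 \<phi>" "is_Pi 1 \<psi>" "fvS \<phi> \<subseteq> {..i0}" "fvS \<psi> \<subseteq> {..i0}" "env (Mf i0) e"
      obtain r1 r2 where r: "fv_below r1 r1 \<phi>" "fv_below r2 r2 \<psi>" using ex_fv_below by metis
      let ?L = "map e [0..<r1 + r2]"
      \<comment> \<open>Late enough for the set variables up to \<open>i0\<close> to be fixed and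
        for the parameters to be present.\<close>
      obtain k where k: "k \<ge> Suc i0" "task k = Inr (\<phi>, \<psi>, ?L)" using task_infinite by blast
      then obtain i where i: "k = Suc i" "i \<ge> i0" by (cases k) auto
      have "fvN \<phi> \<subseteq> {..<Suc (length ?L)}" "fvN \<psi> \<subseteq> {..<Suc (length ?L)}"
        using r unfolding fv_below_iff by fastforce+
      moreover have "fvS \<phi> \<subseteq> {..<Suc i}" "fvS \<psi> \<subseteq> {..<Suc i}" using a(3,4) i(2) by fastforce+
      moreover have "env (Mf i) e" using C.env_le[OF i(2) a(5)] .
      ultimately show "\<exists>i\<ge>i0. (\<forall>x\<in>num_dom (Mf i). sat (Mf i) (case_nat x e) (sf i) \<phi> = sat (Mf i) (case_nat x e) (sf i) \<psi>) \<longrightarrow>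
        (\<forall>x\<in>num_dom (Mf (Suc i)).
          (x \<in> sf (Suc i) (Suc i) \<longrightarrow> sat (Mf (Suc i)) (case_nat x e) (sf (Suc i)) \<phi>) \<and>
          (sat (Mf (Suc i)) (case_nat x e) (sf (Suc i)) \<psi> \<longrightarrow> x \<in> sf (Suc i) (Suc i)))"
        using st[of i] k(2) i a(1,2) unfolding one_step_def
        by (intro exI[of _ i]) simp
    qed
    moreover have "models C.U {AllS (ExS \<theta>)}"
      unfolding models_def
    proof (intro ballI allI)
      fix q e0 s assume "q \<in> {AllS (ExS \<theta>)}"
      moreover have "\<exists>B\<in>set_dom C.U. sat C.U e0 (case_nat B (case_nat A s)) \<theta>" if A: "A \<in> set_dom C.U" for A
      proof -
        obtain X where X: "A = C.sU X" using A by auto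
        obtain k where k: "k \<ge> Suc X" "task k = Inl X" using task_infinite by blast
        then obtain i where i: "k = Suc i" by (cases k) auto
        obtain a where a: "a \<in> num_dom (Mf i)" using L2_nonempty[OF C.Mf_L2] by blast
        let ?e = "\<lambda>_ :: nat. a"
        let ?q = "subst Var (case_nat k (case_nat X (\<lambda>i. i))) \<theta>"
        have *: "(\<lambda>i. \<sigma> (case_nat k (case_nat X (\<lambda>i. i)) i)) = case_nat (\<sigma> k) (case_nat (\<sigma> X) \<sigma>)" for \<sigma> :: "nat \<Rightarrow> nat set"
          by (auto simp: fun_eq_iff split: nat.split)
        have e: "env (Mf i) ?e" using a by (simp add: env_def)
        then have "sat (Mf k) ?e (sf k) ?q"
          using st[of i] k i unfolding one_step_def sat_subst tval.simps * by simp
        moreover have "fvS ?q \<subseteq> {..k}"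
          using \<theta>(2) k(1) by (auto simp: fv_subst fv_below_iff numeral_2_eq_2 less_Suc_eq split: nat.split)
        moreover have "env (Mf k) ?e" using C.env_le[of i k] e i by simp
        ultimately have "sat C.U ?e C.sU ?q"
          using C.sat_U(2)[OF is_Pi_subst[OF \<theta>(1)] order_refl] by blast
        then have "sat C.U ?e (case_nat (C.sU k) (case_nat (C.sU X) C.sU)) \<theta>" by (simp add: sat_subst *)
        moreover have "sat C.U ?e (case_nat (C.sU k) (case_nat (C.sU X) C.sU)) \<theta> = sat C.U e0 (case_nat (C.sU k) (case_nat A s)) \<theta>"
          by (rule sat_cong) (use \<theta>(2) X in \<open>auto simp: fv_below_iff numeral_2_eq_2 less_Suc_eq split: nat.split\<close>)
        ultimately show ?thesis by auto
      qed
      ultimately show "sat C.U e0 s q" by simp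
    qed
    ultimately have "models C.U (RCA0 \<union> BSigma (Suc n) \<union> {AllS (ExS \<theta>)})"
      using C.BSigma_U unfolding models_Un by blast
    \<comment> \<open>By contraposition: truth in the union would descend to the first stage and
      from there to the initial model.\<close>
    moreover have "\<not> sat C.U (?f \<circ> e) C.sU p"
    proof
      assume "sat C.U (?f \<circ> e) C.sU p"
      moreover have env3: "env (Mf 0) (?f \<circ> e)" using env2 K0(5) f0 unfolding env_def by blast
      ultimately have "sat (Mf 0) (?f \<circ> e) (sf 0) p"
      proof (intro pi_downward[of "Mf 0" C.U n "{0}" "sf 0" C.sU p])
        show "sat (Mf 0) e (sf 0) p = sat C.U e C.sU p" if "is_Sigma (Suc n) p" "fvS p \<subseteq> {0}" "env (Mf 0) e" for p e
          using C.sat_U(1)[OF that(1) order_refl, of 0 e] that by simp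
      qed (use p in auto)
      then have "sat K' (?f \<circ> e) (\<lambda>_. ?f ` A) p"
        using pi_downward[of K' K0 n "{0}" "\<lambda>_. ?f ` A" t0 p "?f \<circ> e", OF K0(5) K0(7) p(1,2) env2] f0 by simp
      then show False using nsat by blast
    qed
    moreover have "env C.U (?f \<circ> e)" using env2 K0(5) f0 by (auto simp: env_def)
    ultimately show thesis using that C.L2_U sU by blast
  qed
qed

end

lemma sentence_fv: "sentence p \<Longrightarrow> fvN p = {} \<and> fvS p = {}"
  by (auto simp: sentence_def fv_below_iff)

theorem theorem6p1:
  fixes n :: nat and \<theta> \<Gamma> :: fm
  assumes "n \<ge> 1"
    and "is_Pi (n + 1) \<theta>"
    and "\<Gamma> = AllS (ExS \<theta>)"
    and "sentence \<Gamma>"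
    and "\<And>(M :: nat L2_struct) X.
           L2_structure M \<Longrightarrow> countable_structure M \<Longrightarrow> recursively_saturated M \<Longrightarrow>
           models M (BSigma (n + 1)) \<Longrightarrow> X \<in> set_dom M \<Longrightarrow>
           \<exists>Y. Y \<subseteq> num_dom M \<and> models (add_set Y M) (ISigma n) \<and> holds_at (add_set Y M) \<theta> X Y"
  shows "conservative_over (tilde_Pi_sentence (n + 2)) (RCA0 \<union> BSigma (n + 1) \<union> {\<Gamma>}) (ISigma n)"
  unfolding conservative_over_def
proof (intro allI impI, rule ccontr)
  interpret extension_hyp n \<theta>
  proof
    show "fv_below 0 2 \<theta>" using assms(3,4) by (simp add: sentence_def ExS_def Neg_def numeral_2_eq_2)
  qed (use assms in \<open>simp_all only: Suc_eq_plus1\<close>)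
  fix \<psi> assume \<psi>: "tilde_Pi_sentence (n + 2) \<psi>" and T: "RCA0 \<union> BSigma (n + 1) \<union> {\<Gamma>} \<turnstile> \<psi>" and not: "\<not> ISigma n \<turnstile> \<psi>"
  obtain p where p: "is_Pi (Suc (Suc n)) p" "\<psi> = AllS p" and sen: "sentence \<psi>"
    using \<psi> unfolding tilde_Pi_sentence_def by (auto simp: numeral_2_eq_2)
  have con: "con (insert (Neg \<psi>) (ISigma n))" using not Contr unfolding con_def by blast
  have "sentence q" if "q \<in> insert (Neg \<psi>) (ISigma n)" for q
    using that sen sentence_ISigma by (auto simp: sentence_def Neg_def)
  then have fv: "\<forall>q\<in>insert (Neg \<psi>) (ISigma n). fvN q \<subseteq> Collect even \<and> fvS q \<subseteq> Collect even"
    using sentence_fv by blast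
  obtain M :: "nat L2_struct" and e s where M: "L2_structure M" "env M e" "senv M s"
      "\<forall>q\<in>insert (Neg \<psi>) (ISigma n). sat M e s q"
    using model_existence[OF con fv] by (elim exE conjE)
  have "models M (ISigma n)" unfolding models_def
    using M(4) sentence_ISigma sentence_cong by blast
  moreover have "set_dom M \<noteq> {}" using M(3) by (auto simp: senv_def)
  ultimately have iM: "isigma_model n M" using M(1) by (simp add: isigma_model_def)
  have "\<not> sat M e s (AllS p)" using M(4) p(2) by simp
  then obtain A where A: "A \<in> set_dom M" "\<not> sat M e (case_nat A s) p" by auto
  have "Suc i \<notin> fvS p" for i using sen p(2) by (auto simp: sentence_def fv_below_iff)
  then have fvp: "fvS p \<subseteq> {0}" by (metis not0_implies_Suc singletonI subsetI)
  have "sat M e (case_nat A s) p = sat M e (\<lambda>_. A) p"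
    by (rule sat_cong) (use fvp in \<open>auto split: nat.split\<close>)
  with A(2) have "\<not> sat M e (\<lambda>_. A) p" by blast
  then obtain U :: "nat L2_struct" and e' s' where U: "L2_structure U" "env U e'" "senv U s'"
    "models U (RCA0 \<union> BSigma (Suc n) \<union> {AllS (ExS \<theta>)})" "\<not> sat U e' s' p"
    using model_of_extension[OF iM A(1) p(1) fvp M(2)] by blast
  have "sat U e' s' \<psi>"
    using soundness[OF T U(1-3)] U(4) assms(3) unfolding models_def by simp
  then have "sat U e' (case_nat (s' 0) s') p" using U(3) p(2) by (simp add: senv_def)
  moreover have "sat U e' (case_nat (s' 0) s') p = sat U e' s' p"
    by (rule sat_cong) (use fvp in auto)
  ultimately show False using U(5) by blast
qed

end
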